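(* Suppose that $\delta$ is small (i.e. $0<\delta\le\delta_0$ for a suitable $\delta_0>0$ independent of $h$). Let $\mathbf v=(v_1,\dots,v_{n_e})$ be the weak solution of problem (P) of the context, and let $\mathbf V^{(n+1)}=(V_1^{(n+1)},\dots,V_{n_e}^{(n+1)})\in(S_h^k)^{n_e}$ be the solution of the backward Euler system $$\left(\frac{V_i^{(n+1)}-V_i^{(n)}}{\delta},W_i\right)+b_2^{(n+1)}a_i^{(n+1)}\left(\frac{\partial V_i^{(n+1)}}{\partial y},\frac{\partial W_i}{\partial y}\right)-\left(b_1^{(n+1)}\frac{\partial V_i^{(n+1)}}{\partial y},W_i\right)=(g_i^{(n+1)},W_i)$$ for all $W_i\in S_h^k$, $i=1,\dots,n_e$, where $a_i^{(n+1)}=a_i\big(l^{(n+1)}(V_1^{(n+1)}),\dots,l^{(n+1)}(V_{n_e}^{(n+1)})\big)$ and $V_i^{(0)}=I_hv_{i0}$. Then $$\left\|V_i^{(n+1)}(y)-v_i(y,t_{n+1})\right\|\le C(h^{k+1}+\delta),\qquad i=1,\dots,n_e,\quad n=0,\dots,n_i-1,$$ where $C$ does not depend on $h$, $k$ or $\delta$, but could depend on $\gamma_0$, $\gamma_1$, $m_a$, $\gamma'_{\max}$, $\alpha'_{\max}$, $\left\|\frac{\partial^2\mathbf v}{\partial t^2}\right\|_{L_\infty(0,T;L_2(0,1))}$, $\left\|\frac{\partial\mathbf v}{\partial t}\right\|_{L_\infty(0,T;H^{k+1}(0,1))}$, $\left\|\frac{\partial\mathbf v}{\partial y}\right\|_{L_\infty(0,T;L_2(0,1))}$,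 $\left\|\frac{\partial\mathbf v}{\partial y}\right\|_{L_\infty(0,T;H^{k+1}(0,1))}$ and $\|\mathbf v\|_{L_\infty(0,T;H^{k+1}(0,1))}$ (all assumed finite).
   Context: Let $n_e\ge1$ be an integer and $T>0$. Let $\alpha,\beta\in\mathcal C^2([0,T])$ with $\alpha',\beta'\in L_2(]0,T[)$, put $\gamma=\beta-\alpha$, and assume $0<\gamma_0<\gamma(t)<\gamma_1<\infty$, $|\gamma'(t)|\le\gamma'_{\max}$ and $|\alpha'(t)|\le\alpha'_{\max}$ for all $t\in[0,T]$. Put $\Omega_t=]\alpha(t),\beta(t)[$ and $\Omega=]0,1[$. For $i=1,\dots,n_e$: $u_{i0}\in H_0^1(\Omega_0)$; $f_i$ satisfies $\int_0^T\int_{\Omega_t}f_i^2\,dx\,dt<\infty$; $a_i:\mathbb R^{n_e}\to\mathbb R^+$ is Lipschitz-continuous with $0<m_a\le a_i(s)\le M_a$ for all $s\in\mathbb R^{n_e}$. Notation: $b_1(y,t)=\dfrac{\alpha'(t)+\gamma'(t)y}{\gamma(t)}$, $b_2(t)=\dfrac1{\gamma(t)^2}$, $g_i(y,t)=f_i(\alpha(t)+\gamma(t)y,t)$, $v_{i0}(y)=u_{i0}(\alpha(0)+\gamma(0)y)$, $l(w)(t)=\gamma(t)\int_0^1w(y,t)\,dy$. Problem (P): for $i=1,\dots,n_e$, $$\frac{\partial v_i}{\partial t}-a_i(l(v_1),\dots,l(v_{n_e}))\,b_2(t)\frac{\partial^2v_i}{\partial y^2}-b_1(y,t)\frac{\partial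 v_i}{\partial y}=g_i\ \text{ in }\ ]0,1[\times]0,T[,\quad v_i(0,t)=v_i(1,t)=0,\quad v_i(y,0)=v_{i0}(y).$$ A weak solution is $\mathbf v=(v_1,\dots,v_{n_e})$ with $v_i\in L_\infty(0,T;H_0^1(\Omega)\cap H^2(\Omega))$, $\frac{\partial v_i}{\partial t}\in L_2(0,T;L_2(\Omega))$, $v_i(\cdot,0)=v_{i0}$, and, for all $w_i\in H_0^1(\Omega)$ and $t\in]0,T[$, $$\int_0^1\frac{\partial v_i}{\partial t}w_i\,dy+a_i(l(v_1),\dots,l(v_{n_e}))b_2\int_0^1\frac{\partial v_i}{\partial y}\frac{\partial w_i}{\partial y}dy-\int_0^1b_1\frac{\partial v_i}{\partial y}w_i\,dy=\int_0^1g_iw_i\,dy.$$ Time is discretised with step $\delta>0$, $t_n=n\delta$, $n=0,\dots,n_i$, $T=n_i\delta$; a superscript $(n)$ on a given function denotes its value at $t_n$, so $b_1^{(n)}=b_1(\cdot,t_n)$, $b_2^{(n)}=b_2(t_n)$, $g_i^{(n)}=g_i(\cdot,t_n)$ (assumed to be in $L_2(\Omega)$), and $l^{(n)}(w)=\gamma(t_n)\int_0^1w(y)\,dy$. $\|\cdot\|$ and $(\cdot,\cdot)$ are the norm and inner product of $L_2(\Omega)$. $\mathcal T_h$ is a partition of $\Omega$ into disjoint intervals of maximal length $h$; $S_h^k$ ($k\ge1$ an integer) is the space of continuous functions on $[0,1]$ that vanish at $0$ and $1$ and are polynomials of degree $k$ on each interval of $\mathcal T_h$; $I_h$ is the Lagrange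 interpolation operator onto $S_h^k$. The constant $C$ may also depend on the other fixed data of the problem ($T$, $n_e$, Lipschitz constants of the $a_i$). *)

theory Defs
  imports "HOL-Analysis.Analysis" "HOL-Computational_Algebra.Polynomial"
begin

abbreviation leb :: "real \<Rightarrow> real \<Rightarrow> real measure" where
  "leb a b \<equiv> lebesgue_on {a<..<b}"

definition L2 :: "real \<Rightarrow> real \<Rightarrow> (real \<Rightarrow> real) set" where
  "L2 a b = {u. u \<in> borel_measurable (leb a b) \<and> integrable (leb a b) (\<lambda>x. (u x)\<^sup>2)}"

definition L2_inner :: "real \<Rightarrow> real \<Rightarrow> (real \<Rightarrow> real) \<Rightarrow> (real \<Rightarrow> real) \<Rightarrow> real" where
  "L2_inner a b u w = (LINT x|leb a b. u x * w x)"

definition L2_norm :: "real \<Rightarrow> real \<Rightarrow> (real \<Rightarrow> real) \<Rightarrow> real" where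
  "L2_norm a b u = sqrt (L2_inner a b u u)"

definition test_functions :: "real \<Rightarrow> real \<Rightarrow> (real \<Rightarrow> real) set" where
  "test_functions a b =
     {\<phi>. (\<forall>n x. ((deriv ^^ n) \<phi>) field_differentiable (at x)) \<and>
         (\<exists>c d. a < c \<and> d < b \<and> (\<forall>x. x \<notin> {c..d} \<longrightarrow> \<phi> x = 0))}"

definition is_weak_deriv :: "real \<Rightarrow> real \<Rightarrow> nat \<Rightarrow> (real \<Rightarrow> real) \<Rightarrow> (real \<Rightarrow> real) \<Rightarrow> bool" where
  "is_weak_deriv a b j u w \<longleftrightarrow>
     (\<forall>\<phi>\<in>test_functions a b.
        L2_inner a b u ((deriv ^^ j) \<phi>) = (- 1) ^ j * L2_inner a b w \<phi>)"

text \<open>A square integrable weak derivative is unique only up to null sets; the following picks a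
  representative.  Everything below depends on it only through its almost everywhere class.\<close>

definition weak_deriv :: "real \<Rightarrow> real \<Rightarrow> nat \<Rightarrow> (real \<Rightarrow> real) \<Rightarrow> real \<Rightarrow> real" where
  "weak_deriv a b j u = (SOME w. w \<in> L2 a b \<and> is_weak_deriv a b j u w)"

definition sobolev :: "real \<Rightarrow> real \<Rightarrow> nat \<Rightarrow> (real \<Rightarrow> real) set" where
  "sobolev a b m = {u \<in> L2 a b. \<forall>j\<le>m. \<exists>w\<in>L2 a b. is_weak_deriv a b j u w}"

definition sobolev_norm :: "real \<Rightarrow> real \<Rightarrow> nat \<Rightarrow> (real \<Rightarrow> real) \<Rightarrow> real" where
  "sobolev_norm a b m u = sqrt (\<Sum>j\<le>m. (L2_norm a b (weak_deriv a b j u))\<^sup>2)"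

definition sobolev0 :: "real \<Rightarrow> real \<Rightarrow> (real \<Rightarrow> real) set" where
  "sobolev0 a b =
     {u \<in> sobolev a b 1. \<forall>e>0. \<exists>\<phi>\<in>test_functions a b. sobolev_norm a b 1 (\<lambda>x. u x - \<phi> x) < e}"

text \<open>A function of time and space is curried with time first.  A space of functions of the space
  variable is given by its carrier \<open>X\<close> and its norm \<open>N\<close>.  Strong (Bochner) measurability is
  almost everywhere approximation in norm by simple functions; it does not change
  when every \<open>u t\<close> is modified on a null set depending on \<open>t\<close>.\<close>

definition simple_in_time ::
    "real \<Rightarrow> (real \<Rightarrow> real) set \<Rightarrow> (real \<Rightarrow> real \<Rightarrow> real) \<Rightarrow> bool" where
  "simple_in_time T X s \<longleftrightarrow>
     finite (s ` {0<..<T}) \<and> s ` {0<..<T} \<subseteq> X \<and>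
     (\<forall>w. {t \<in> {0<..<T}. s t = w} \<in> sets lebesgue)"

definition bochner_measurable ::
    "real \<Rightarrow> (real \<Rightarrow> real) set \<Rightarrow> ((real \<Rightarrow> real) \<Rightarrow> real) \<Rightarrow> (real \<Rightarrow> real \<Rightarrow> real) \<Rightarrow> bool" where
  "bochner_measurable T X N u \<longleftrightarrow>
     (\<exists>s. (\<forall>n::nat. simple_in_time T X (s n)) \<and>
          (AE t in leb 0 T. u t \<in> X \<and> (\<lambda>n. N (\<lambda>y. s n t y - u t y)) \<longlonglongrightarrow> 0))"

definition Linf_norm ::
    "real \<Rightarrow> (real \<Rightarrow> real) set \<Rightarrow> ((real \<Rightarrow> real) \<Rightarrow> real) \<Rightarrow> (real \<Rightarrow> real \<Rightarrow> real) \<Rightarrow> ereal" where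
  "Linf_norm T X N u =
     (if bochner_measurable T X N u
      then Inf {ereal R |R. AE t in leb 0 T. N (u t) \<le> R} else \<infinity>)"

definition L2_in_time ::
    "real \<Rightarrow> (real \<Rightarrow> real) set \<Rightarrow> ((real \<Rightarrow> real) \<Rightarrow> real) \<Rightarrow> (real \<Rightarrow> real \<Rightarrow> real) \<Rightarrow> bool" where
  "L2_in_time T X N u \<longleftrightarrow>
     bochner_measurable T X N u \<and> integrable (leb 0 T) (\<lambda>t. (N (u t))\<^sup>2)"

definition continuous_in_L2 :: "real \<Rightarrow> (real \<Rightarrow> real \<Rightarrow> real) \<Rightarrow> bool" where
  "continuous_in_L2 T u \<longleftrightarrow>
     (\<forall>t\<in>{0..T}. u t \<in> L2 0 1) \<and>
     (\<forall>t\<in>{0..T}. ((\<lambda>s. L2_norm 0 1 (\<lambda>y. u s y - u t y)) \<longlongrightarrow> 0) (at t within {0..T}))"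

text \<open>The distributional derivative in time of a function with values in the square integrable
  functions on the unit interval; the identity between two vector-valued integrals is tested
  with every square integrable \<open>w\<close>.\<close>

definition weak_time_deriv ::
    "real \<Rightarrow> (real \<Rightarrow> real \<Rightarrow> real) \<Rightarrow> (real \<Rightarrow> real \<Rightarrow> real) \<Rightarrow> bool" where
  "weak_time_deriv T u ut \<longleftrightarrow>
     (\<forall>\<phi>\<in>test_functions 0 T. \<forall>w\<in>L2 0 1.
        (LINT t|leb 0 T. deriv \<phi> t * L2_inner 0 1 (u t) w) =
        - (LINT t|leb 0 T. \<phi> t * L2_inner 0 1 (ut t) w))"

text \<open>\<open>da\<close> and \<open>db\<close> are the derivatives of the boundary curves \<open>\<alpha>\<close> and \<open>\<beta>\<close>.\<close>

definition C2_curve :: "real \<Rightarrow> (real \<Rightarrow> real) \<Rightarrow> (real \<Rightarrow> real) \<Rightarrow> bool" where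
  "C2_curve T c dc \<longleftrightarrow>
     (\<forall>t\<in>{0..T}. (c has_real_derivative dc t) (at t within {0..T})) \<and>
     (\<exists>ddc. (\<forall>t\<in>{0..T}. (dc has_real_derivative ddc t) (at t within {0..T})) \<and>
            continuous_on {0..T} ddc)"

definition gap :: "(real \<Rightarrow> real) \<Rightarrow> (real \<Rightarrow> real) \<Rightarrow> real \<Rightarrow> real" where
  "gap \<alpha> \<beta> t = \<beta> t - \<alpha> t"

definition b1 ::
    "(real \<Rightarrow> real) \<Rightarrow> (real \<Rightarrow> real) \<Rightarrow> (real \<Rightarrow> real) \<Rightarrow> (real \<Rightarrow> real) \<Rightarrow> real \<Rightarrow> real \<Rightarrow> real" where
  "b1 \<alpha> da \<beta> db t y = (da t + (db t - da t) * y) / gap \<alpha> \<beta> t"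

definition b2 :: "(real \<Rightarrow> real) \<Rightarrow> (real \<Rightarrow> real) \<Rightarrow> real \<Rightarrow> real" where
  "b2 \<alpha> \<beta> t = 1 / (gap \<alpha> \<beta> t)\<^sup>2"

definition to_moving :: "(real \<Rightarrow> real) \<Rightarrow> (real \<Rightarrow> real) \<Rightarrow> real \<Rightarrow> real \<Rightarrow> real" where
  "to_moving \<alpha> \<beta> t y = \<alpha> t + gap \<alpha> \<beta> t * y"

definition source ::
    "(real \<Rightarrow> real) \<Rightarrow> (real \<Rightarrow> real) \<Rightarrow> ('n \<Rightarrow> real \<Rightarrow> real \<Rightarrow> real) \<Rightarrow> 'n \<Rightarrow> real \<Rightarrow> real \<Rightarrow> real" where
  "source \<alpha> \<beta> f i t y = f i (to_moving \<alpha> \<beta> t y) t"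

definition initial ::
    "(real \<Rightarrow> real) \<Rightarrow> (real \<Rightarrow> real) \<Rightarrow> ('n \<Rightarrow> real \<Rightarrow> real) \<Rightarrow> 'n \<Rightarrow> real \<Rightarrow> real" where
  "initial \<alpha> \<beta> u0 i y = u0 i (to_moving \<alpha> \<beta> 0 y)"

definition nonlocal :: "(real \<Rightarrow> real) \<Rightarrow> (real \<Rightarrow> real) \<Rightarrow> real \<Rightarrow> (real \<Rightarrow> real) \<Rightarrow> real" where
  "nonlocal \<alpha> \<beta> t w = gap \<alpha> \<beta> t * (LINT y|leb 0 1. w y)"

definition diffusion ::
    "(real \<Rightarrow> real) \<Rightarrow> (real \<Rightarrow> real) \<Rightarrow> ('n::finite \<Rightarrow> real^'n \<Rightarrow> real) \<Rightarrow> real \<Rightarrow>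
     ('n \<Rightarrow> real \<Rightarrow> real) \<Rightarrow> 'n \<Rightarrow> real" where
  "diffusion \<alpha> \<beta> a t z i = a i (\<chi> j. nonlocal \<alpha> \<beta> t (z j))"

definition admissible_domain ::
    "real \<Rightarrow> real \<Rightarrow> real \<Rightarrow> real \<Rightarrow> real \<Rightarrow>
     (real \<Rightarrow> real) \<Rightarrow> (real \<Rightarrow> real) \<Rightarrow> (real \<Rightarrow> real) \<Rightarrow> (real \<Rightarrow> real) \<Rightarrow> bool" where
  "admissible_domain T \<gamma>0 \<gamma>1 dgmax damax \<alpha> da \<beta> db \<longleftrightarrow>
     C2_curve T \<alpha> da \<and> C2_curve T \<beta> db \<and> da \<in> L2 0 T \<and> db \<in> L2 0 T \<and>
     (\<forall>t\<in>{0..T}. \<gamma>0 < gap \<alpha> \<beta> t \<and> gap \<alpha> \<beta> t < \<gamma>1 \<and>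
                 \<bar>db t - da t\<bar> \<le> dgmax \<and> \<bar>da t\<bar> \<le> damax)"

definition admissible_coefficients ::
    "real \<Rightarrow> real \<Rightarrow> real \<Rightarrow> ('n::finite \<Rightarrow> real^'n \<Rightarrow> real) \<Rightarrow> bool" where
  "admissible_coefficients m M L a \<longleftrightarrow>
     (\<forall>i. L-lipschitz_on UNIV (a i) \<and> (\<forall>s. m \<le> a i s \<and> a i s \<le> M))"

definition admissible_source ::
    "real \<Rightarrow> (real \<Rightarrow> real) \<Rightarrow> (real \<Rightarrow> real) \<Rightarrow> ('n \<Rightarrow> real \<Rightarrow> real \<Rightarrow> real) \<Rightarrow> bool" where
  "admissible_source T \<alpha> \<beta> f \<longleftrightarrow>
     (\<forall>i. let Q = lebesgue_on {(x, t). 0 < t \<and> t < T \<and> \<alpha> t < x \<and> x < \<beta> t} in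
          (\<lambda>(x, t). f i x t) \<in> borel_measurable Q \<and>
          integrable Q (\<lambda>(x, t). (f i x t)\<^sup>2))"

text \<open>\<open>vt\<close> is the time derivative of \<open>v\<close>.  The values of \<open>v\<close> at single times, in particular at
  time 0, are those of the representative that is continuous in time with values in the square
  integrable functions.\<close>

definition weak_solution ::
    "real \<Rightarrow> (real \<Rightarrow> real) \<Rightarrow> (real \<Rightarrow> real) \<Rightarrow> (real \<Rightarrow> real) \<Rightarrow> (real \<Rightarrow> real) \<Rightarrow>
     ('n::finite \<Rightarrow> real^'n \<Rightarrow> real) \<Rightarrow> ('n \<Rightarrow> real \<Rightarrow> real \<Rightarrow> real) \<Rightarrow> ('n \<Rightarrow> real \<Rightarrow> real) \<Rightarrow>
     ('n \<Rightarrow> real \<Rightarrow> real \<Rightarrow> real) \<Rightarrow> ('n \<Rightarrow> real \<Rightarrow> real \<Rightarrow> real) \<Rightarrow> bool" where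
  "weak_solution T \<alpha> da \<beta> db a f u0 v vt \<longleftrightarrow>
     (\<forall>i. Linf_norm T (sobolev0 0 1 \<inter> sobolev 0 1 2) (sobolev_norm 0 1 2) (v i) < \<infinity> \<and>
          L2_in_time T (L2 0 1) (L2_norm 0 1) (vt i) \<and>
          weak_time_deriv T (v i) (vt i) \<and>
          continuous_in_L2 T (v i) \<and>
          (AE y in leb 0 1. v i 0 y = initial \<alpha> \<beta> u0 i y)) \<and>
     (\<forall>t\<in>{0<..<T}. \<forall>i. \<forall>w\<in>sobolev0 0 1.
          integrable (leb 0 1) (\<lambda>y. source \<alpha> \<beta> f i t y * w y) \<and>
          L2_inner 0 1 (vt i t) w
          + diffusion \<alpha> \<beta> a t (\<lambda>j. v j t) i * b2 \<alpha> \<beta> t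
              * L2_inner 0 1 (weak_deriv 0 1 1 (v i t)) (weak_deriv 0 1 1 w)
          - L2_inner 0 1 (\<lambda>y. b1 \<alpha> da \<beta> db t y * weak_deriv 0 1 1 (v i t) y) w
          = L2_inner 0 1 (source \<alpha> \<beta> f i t) w)"

definition is_partition :: "nat \<Rightarrow> (nat \<Rightarrow> real) \<Rightarrow> bool" where
  "is_partition M x \<longleftrightarrow> 0 < M \<and> x 0 = 0 \<and> x M = 1 \<and> (\<forall>j<M. x j < x (Suc j))"

definition mesh_size :: "nat \<Rightarrow> (nat \<Rightarrow> real) \<Rightarrow> real" where
  "mesh_size M x = Max ((\<lambda>j. x (Suc j) - x j) ` {..<M})"

definition fe_space :: "nat \<Rightarrow> (nat \<Rightarrow> real) \<Rightarrow> nat \<Rightarrow> (real \<Rightarrow> real) set" where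
  "fe_space M x k =
     {w. continuous_on {0..1} w \<and> w 0 = 0 \<and> w 1 = 0 \<and>
         (\<forall>j<M. \<exists>p::real poly. degree p \<le> k \<and> (\<forall>y\<in>{x j..x (Suc j)}. w y = poly p y))}"

text \<open>\<open>\<xi> k 0, \<dots>, \<xi> k k\<close> are the Lagrange nodes of degree \<open>k\<close> on the reference element; they
  contain its end points, so that the piecewise interpolant is continuous (for instance
  \<open>\<xi> k r = r / k\<close>).\<close>

definition reference_nodes :: "(nat \<Rightarrow> nat \<Rightarrow> real) \<Rightarrow> bool" where
  "reference_nodes \<xi> \<longleftrightarrow> (\<forall>k\<ge>1. \<xi> k 0 = 0 \<and> \<xi> k k = 1 \<and> (\<forall>r<k. \<xi> k r < \<xi> k (Suc r)))"

text \<open>Point values of \<open>w\<close> are those of its continuous representative.\<close>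

definition is_interpolant ::
    "(nat \<Rightarrow> nat \<Rightarrow> real) \<Rightarrow> nat \<Rightarrow> (nat \<Rightarrow> real) \<Rightarrow> nat \<Rightarrow> (real \<Rightarrow> real) \<Rightarrow> (real \<Rightarrow> real) \<Rightarrow> bool" where
  "is_interpolant \<xi> M x k w W \<longleftrightarrow>
     W \<in> fe_space M x k \<and>
     (\<exists>w'. continuous_on {0..1} w' \<and> (AE y in leb 0 1. w' y = w y) \<and>
        (\<forall>j<M. \<forall>r\<le>k. let z = x j + (x (Suc j) - x j) * \<xi> k r in W z = w' z))"

definition backward_euler ::
    "(real \<Rightarrow> real) \<Rightarrow> (real \<Rightarrow> real) \<Rightarrow> (real \<Rightarrow> real) \<Rightarrow> (real \<Rightarrow> real) \<Rightarrow>
     ('n::finite \<Rightarrow> real^'n \<Rightarrow> real) \<Rightarrow> ('n \<Rightarrow> real \<Rightarrow> real \<Rightarrow> real) \<Rightarrow> ('n \<Rightarrow> real \<Rightarrow> real) \<Rightarrow>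
     (nat \<Rightarrow> nat \<Rightarrow> real) \<Rightarrow> nat \<Rightarrow> (nat \<Rightarrow> real) \<Rightarrow> nat \<Rightarrow> real \<Rightarrow> nat \<Rightarrow>
     ('n \<Rightarrow> nat \<Rightarrow> real \<Rightarrow> real) \<Rightarrow> bool" where
  "backward_euler \<alpha> da \<beta> db a f u0 \<xi> M x k \<delta> ni V \<longleftrightarrow>
     (\<forall>i. is_interpolant \<xi> M x k (initial \<alpha> \<beta> u0 i) (V i 0)) \<and>
     (\<forall>n<ni. \<forall>i. V i (Suc n) \<in> fe_space M x k \<and>
        (\<forall>W\<in>fe_space M x k.
           let t = real (Suc n) * \<delta> in
           L2_inner 0 1 (\<lambda>y. (V i (Suc n) y - V i n y) / \<delta>) W
           + b2 \<alpha> \<beta> t * diffusion \<alpha> \<beta> a t (\<lambda>j. V j (Suc n)) i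
               * L2_inner 0 1 (weak_deriv 0 1 1 (V i (Suc n))) (weak_deriv 0 1 1 W)
           - L2_inner 0 1 (\<lambda>y. b1 \<alpha> da \<beta> db t y * weak_deriv 0 1 1 (V i (Suc n)) y) W
           = L2_inner 0 1 (source \<alpha> \<beta> f i t) W))"

text \<open>As \<open>vtt\<close> is
  essentially bounded in time, \<open>vt\<close> has a representative that is continuous in time; \<open>vt\<close> is
  required to be this representative, which gives the variational equation at a single time
  its meaning.\<close>

definition regular_solution ::
    "real \<Rightarrow> nat \<Rightarrow> real \<Rightarrow> real \<Rightarrow> real \<Rightarrow> real \<Rightarrow> real \<Rightarrow>
     ('n \<Rightarrow> real \<Rightarrow> real \<Rightarrow> real) \<Rightarrow> ('n \<Rightarrow> real \<Rightarrow> real \<Rightarrow> real) \<Rightarrow> ('n \<Rightarrow> real \<Rightarrow> real \<Rightarrow> real) \<Rightarrow> bool" where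
  "regular_solution T k Rtt Rt Ry RyH RH v vt vtt \<longleftrightarrow>
     (\<forall>i. continuous_in_L2 T (vt i) \<and> weak_time_deriv T (vt i) (vtt i) \<and>
        Linf_norm T (L2 0 1) (L2_norm 0 1) (vtt i) \<le> ereal Rtt \<and>
        Linf_norm T (sobolev 0 1 (k + 1)) (sobolev_norm 0 1 (k + 1)) (vt i) \<le> ereal Rt \<and>
        Linf_norm T (L2 0 1) (L2_norm 0 1) (\<lambda>t. weak_deriv 0 1 1 (v i t)) \<le> ereal Ry \<and>
        Linf_norm T (sobolev 0 1 (k + 1)) (sobolev_norm 0 1 (k + 1))
          (\<lambda>t. weak_deriv 0 1 1 (v i t)) \<le> ereal RyH \<and>
        Linf_norm T (sobolev 0 1 (k + 1)) (sobolev_norm 0 1 (k + 1)) (v i) \<le> ereal RH)"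

end

theory Submission
  imports Defs
begin

text \<open>
  Let \<open>R\<close> be the Ritz projection onto the finite element space for the form
  \<open>(u', w')\<close>, and split \<open>V - v = \<theta> - \<rho>\<close> with \<open>\<theta> = V - R v\<close> and \<open>\<rho> = v - R v\<close>.  As the
  diffusion coefficient does not depend on space, \<open>R\<close> removes the diffusion term of \<open>\<rho>\<close> from the
  equation for \<open>\<theta>\<close>.  In one dimension \<open>R\<close> is local: \<open>R v\<close> agrees with \<open>v\<close> at the mesh points, and
  on each element \<open>(R v)'\<close> is the \<open>L\<^sub>2\<close> projection of \<open>v'\<close>.  So \<open>\<rho>\<close> gains a factor \<open>h\<close> over \<open>\<rho>'\<close>
  by integration, and the order \<open>h ^ (k + 1)\<close> in \<open>L\<^sub>2\<close> needs no duality argument.  Every derivative of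
  order at most \<open>k\<close> of an interpolation error has a zero in each element, by Rolle's theorem; hence
  both errors are bounded with constant 1, uniformly in \<open>k\<close> and in the Lagrange nodes.  Testing the
  equation for \<open>\<theta>\<close> with \<open>\<theta>\<close> and a discrete Gronwall argument give the estimate; the convection
  term of \<open>\<rho>\<close> is integrated by parts.

  The bounds on the solution hold for almost every time only.  They are carried to every time in
  dual form, as bounds of \<open>(v, \<phi>\<^sup>(\<^sup>m\<^sup>))\<close> by \<open>\<parallel>\<phi>\<parallel>\<close> for test functions \<open>\<phi>\<close>, which survive \<open>L\<^sub>2\<close> limits and
  integration in time, and are turned back into weak derivatives by the Riesz representation.
\<close>

section \<open>Square integrable functions\<close>

text \<open>The exact solution satisfies its equation against \<open>sobolev0\<close>, the discrete
  one against \<open>fe_space\<close>. Rather than embedding one test space in the other, the exact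
  equation is reduced to an almost everywhere identity, using smooth test functions only. Its
  residual can then be paired with \<open>\<theta>\<close>, and the norm of this residual makes
  sense also at the final time, where the equation is not assumed. There the residual is merely
  bounded; since it enters in one step only and with a factor \<open>\<delta>\<close>, it still
  contributes order \<open>\<delta>\<close> to the norm of the error.

  The constant has to be named before the solution, the degree and the mesh. This rules out
  constants from compactness arguments and is the reason for working with zeros, primitives and
  explicit Young weights: every bound must be an expression in the prescribed numbers.\<close>

lemma L2_measurable [measurable_dest]: "u \<in> L2 a b \<Longrightarrow> u \<in> borel_measurable (leb a b)"
  by (simp add: L2_def)

lemma finite_measure_leb: "finite_measure (leb a b)"
  by (rule finite_measure_lebesgue_on) auto

lemma L2_integrable_mult:
  assumes "u \<in> L2 a b" "w \<in> L2 a b"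
  shows "integrable (leb a b) (\<lambda>x. u x * w x)"
proof -
  note [measurable] = assms[THEN L2_measurable]
  have "integrable (leb a b) (\<lambda>x. (u x)\<^sup>2 + (w x)\<^sup>2)"
    using assms by (auto simp: L2_def)
  then show ?thesis
  proof (rule Bochner_Integration.integrable_bound)
    have "\<bar>u x * w x\<bar> \<le> (u x)\<^sup>2 + (w x)\<^sup>2" for x
    proof -
      have "2 * (\<bar>u x\<bar> * \<bar>w x\<bar>) \<le> (u x)\<^sup>2 + (w x)\<^sup>2"
        using sum_squares_bound[of "\<bar>u x\<bar>" "\<bar>w x\<bar>"] by (simp add: mult.assoc)
      moreover have "0 \<le> \<bar>u x\<bar> * \<bar>w x\<bar>" by simp
      ultimately show ?thesis unfolding abs_mult by linarith
    qed
    then show "AE x in leb a b. norm (u x * w x) \<le> norm ((u x)\<^sup>2 + (w x)\<^sup>2)" by simp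
  qed measurable
qed

lemma L2_add: "u \<in> L2 a b \<Longrightarrow> w \<in> L2 a b \<Longrightarrow> (\<lambda>x. u x + w x) \<in> L2 a b"
proof -
  assume u: "u \<in> L2 a b" "w \<in> L2 a b"
  note [measurable] = u[THEN L2_measurable]
  have "integrable (leb a b) (\<lambda>x. (u x * u x + 2 * (u x * w x)) + w x * w x)"
    using u by (intro Bochner_Integration.integrable_add integrable_mult_right L2_integrable_mult)
  then have "integrable (leb a b) (\<lambda>x. (u x + w x)\<^sup>2)"
    by (rule Bochner_Integration.integrable_cong[THEN iffD1, rotated -1]) (auto simp: power2_eq_square algebra_simps)
  then show ?thesis by (simp add: L2_def)
qed

lemma L2_cmult: "u \<in> L2 a b \<Longrightarrow> (\<lambda>x. c * u x) \<in> L2 a b"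
  by (auto simp: L2_def power_mult_distrib)

lemma L2_uminus: "u \<in> L2 a b \<Longrightarrow> (\<lambda>x. - u x) \<in> L2 a b"
  by (auto simp: L2_def)

lemma L2_diff: "u \<in> L2 a b \<Longrightarrow> w \<in> L2 a b \<Longrightarrow> (\<lambda>x. u x - w x) \<in> L2 a b"
  using L2_add[of u a b "\<lambda>x. - w x"] L2_uminus[of w a b] by simp

lemma L2_divide: "u \<in> L2 a b \<Longrightarrow> (\<lambda>x. u x / c) \<in> L2 a b"
  using L2_cmult[of u a b "1/c"] by simp

lemma power2_le_of_abs_le: "\<bar>x\<bar> \<le> B \<Longrightarrow> x\<^sup>2 \<le> B\<^sup>2" for x B :: real
  by (metis abs_ge_zero power2_abs power_mono)

lemma L2_bounded:
  assumes "u \<in> borel_measurable (leb a b)" "\<And>x. x \<in> {a<..<b} \<Longrightarrow> \<bar>u x\<bar> \<le> B"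
  shows "u \<in> L2 a b"
proof -
  interpret finite_measure "leb a b" by (rule finite_measure_leb)
  note [measurable] = assms(1)
  have "integrable (leb a b) (\<lambda>x. (u x)\<^sup>2)"
  proof (rule integrable_const_bound[where B="B\<^sup>2"])
    have "(u x)\<^sup>2 \<le> B\<^sup>2" if "x \<in> {a<..<b}" for x
      using assms(2)[OF that] by (rule power2_le_of_abs_le)
    then show "AE x in leb a b. norm ((u x)\<^sup>2) \<le> B\<^sup>2" by (intro AE_I2) simp
  qed simp
  then show ?thesis using assms by (auto simp: L2_def)
qed

lemma L2_bounded_mult:
  assumes "u \<in> borel_measurable (leb a b)" "\<And>x. x \<in> {a<..<b} \<Longrightarrow> \<bar>u x\<bar> \<le> B" "w \<in> L2 a b"
  shows "(\<lambda>x. u x * w x) \<in> L2 a b"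
proof -
  note [measurable] = assms(1) assms(3)[THEN L2_measurable]
  have "integrable (leb a b) (\<lambda>x. B\<^sup>2 * (w x)\<^sup>2)" using assms by (auto simp: L2_def)
  then have "integrable (leb a b) (\<lambda>x. (u x * w x)\<^sup>2)"
  proof (rule Bochner_Integration.integrable_bound)
    have "(u x * w x)\<^sup>2 \<le> B\<^sup>2 * (w x)\<^sup>2" if "x \<in> {a<..<b}" for x
      unfolding power_mult_distrib using assms(2)[OF that] by (intro mult_right_mono power2_le_of_abs_le) auto
    then show "AE x in leb a b. norm ((u x * w x)\<^sup>2) \<le> norm (B\<^sup>2 * (w x)\<^sup>2)" by (intro AE_I2) simp
  qed measurable
  then show ?thesis by (simp add: L2_def)
qed

lemma L2_continuous:
  assumes "continuous_on {a..b} u" shows "u \<in> L2 a b"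
proof -
  have "bounded (u ` {a..b})" using assms compact_continuous_image compact_imp_bounded by blast
  then obtain B where B: "\<And>x. x \<in> {a..b} \<Longrightarrow> \<bar>u x\<bar> \<le> B" unfolding bounded_iff by fastforce
  have "continuous_on {a<..<b} u" using assms continuous_on_subset greaterThanLessThan_subseteq_atLeastAtMost_iff by blast
  then show ?thesis
    by (intro L2_bounded[where B=B] continuous_imp_measurable_on_sets_lebesgue) (auto intro: B)
qed

lemma L2_const: "(\<lambda>_. c) \<in> L2 a b"
  by (rule L2_continuous) simp

lemma L2_integrable: "u \<in> L2 a b \<Longrightarrow> integrable (leb a b) u"
  using L2_integrable_mult[of u a b "\<lambda>_. 1"] L2_const by simp

lemma L2_inner_commute: "L2_inner a b u w = L2_inner a b w u"
  by (simp add: L2_inner_def mult.commute)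

lemma L2_inner_add_left:
  "u \<in> L2 a b \<Longrightarrow> u' \<in> L2 a b \<Longrightarrow> w \<in> L2 a b \<Longrightarrow>
   L2_inner a b (\<lambda>x. u x + u' x) w = L2_inner a b u w + L2_inner a b u' w"
  by (simp add: L2_inner_def distrib_right L2_integrable_mult)

lemma L2_inner_diff_left:
  "u \<in> L2 a b \<Longrightarrow> u' \<in> L2 a b \<Longrightarrow> w \<in> L2 a b \<Longrightarrow>
   L2_inner a b (\<lambda>x. u x - u' x) w = L2_inner a b u w - L2_inner a b u' w"
  by (simp add: L2_inner_def left_diff_distrib L2_integrable_mult)

lemma L2_inner_cmult_left: "L2_inner a b (\<lambda>x. c * u x) w = c * L2_inner a b u w"
  by (simp add: L2_inner_def mult.assoc)

lemma L2_inner_divide_left: "L2_inner a b (\<lambda>x. u x / c) w = L2_inner a b u w / c"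
  using L2_inner_cmult_left[of a b "1/c" u w] by simp

lemma L2_inner_add_right:
  "u \<in> L2 a b \<Longrightarrow> u' \<in> L2 a b \<Longrightarrow> w \<in> L2 a b \<Longrightarrow>
   L2_inner a b w (\<lambda>x. u x + u' x) = L2_inner a b w u + L2_inner a b w u'"
  by (simp add: L2_inner_commute[of a b w] L2_inner_add_left)

lemma L2_inner_diff_right:
  "u \<in> L2 a b \<Longrightarrow> u' \<in> L2 a b \<Longrightarrow> w \<in> L2 a b \<Longrightarrow>
   L2_inner a b w (\<lambda>x. u x - u' x) = L2_inner a b w u - L2_inner a b w u'"
  by (simp add: L2_inner_commute[of a b w] L2_inner_diff_left)

lemma L2_inner_cmult_right: "L2_inner a b w (\<lambda>x. c * u x) = c * L2_inner a b w u"
  by (simp add: L2_inner_commute[of a b w] L2_inner_cmult_left)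

lemma L2_inner_uminus_left: "L2_inner a b (\<lambda>x. - u x) w = - L2_inner a b u w"
  by (simp add: L2_inner_def)

lemma L2_inner_self_nonneg: "0 \<le> L2_inner a b u u"
  by (simp add: L2_inner_def)

lemma L2_norm_nonneg [simp]: "0 \<le> L2_norm a b u"
  by (simp add: L2_norm_def L2_inner_self_nonneg)

lemma L2_norm_sq: "(L2_norm a b u)\<^sup>2 = L2_inner a b u u"
  by (simp add: L2_norm_def L2_inner_self_nonneg)

text \<open>A quadratic polynomial in \<open>s\<close> that is nowhere negative has nonpositive
  discriminant.\<close>

lemma L2_Cauchy_Schwarz:
  assumes u: "u \<in> L2 a b" and w: "w \<in> L2 a b"
  shows "\<bar>L2_inner a b u w\<bar> \<le> L2_norm a b u * L2_norm a b w"
proof -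
  define A B C where "A = L2_inner a b u u" and "B = L2_inner a b u w" and "C = L2_inner a b w w"
  have AC: "0 \<le> A" "0 \<le> C" by (auto simp: A_def C_def L2_inner_self_nonneg)
  have quad: "0 \<le> A * s\<^sup>2 - 2 * s * B + C" for s
  proof -
    have su: "(\<lambda>x. s * u x) \<in> L2 a b" by (rule L2_cmult[OF u])
    have "0 \<le> L2_inner a b (\<lambda>x. s * u x - w x) (\<lambda>x. s * u x - w x)" by (rule L2_inner_self_nonneg)
    also have "\<dots> = A * s\<^sup>2 - 2 * s * B + C"
      by (simp add: L2_inner_diff_left L2_inner_diff_right L2_diff su u w L2_inner_cmult_left
            L2_inner_cmult_right A_def B_def C_def power2_eq_square L2_inner_commute[of a b w u] algebra_simps)
    finally show ?thesis .
  qed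
  have "B\<^sup>2 \<le> A * C"
  proof (cases "A = 0")
    case True
    have "B = 0"
    proof (rule ccontr)
      assume "B \<noteq> 0"
      \<comment> \<open>For \<open>A = 0\<close> the polynomial is linear; this \<open>s\<close>
        would give it the value -1.\<close>
      with quad[of "(C + 1) / (2 * B)"] True AC show False by (simp add: field_simps)
    qed
    then show ?thesis using True by simp
  next
    case False
    then show ?thesis using quad[of "B / A"] AC by (simp add: field_simps power2_eq_square)
  qed
  then have "sqrt (B\<^sup>2) \<le> sqrt (A * C)" by (rule real_sqrt_le_mono)
  then show ?thesis by (simp add: L2_norm_def A_def B_def C_def real_sqrt_mult)
qed

lemma L2_norm_triangle:
  assumes u: "u \<in> L2 a b" and w: "w \<in> L2 a b"
  shows "L2_norm a b (\<lambda>x. u x + w x) \<le> L2_norm a b u + L2_norm a b w"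
proof (rule power2_le_imp_le)
  have "(L2_norm a b (\<lambda>x. u x + w x))\<^sup>2 = L2_inner a b u u + 2 * L2_inner a b u w + L2_inner a b w w"
    by (simp add: L2_norm_sq L2_inner_add_left L2_inner_add_right L2_add u w L2_inner_commute[of a b w u])
  also have "\<dots> \<le> (L2_norm a b u + L2_norm a b w)\<^sup>2"
    using L2_Cauchy_Schwarz[OF u w] by (simp add: power2_sum L2_norm_sq)
  finally show "(L2_norm a b (\<lambda>x. u x + w x))\<^sup>2 \<le> (L2_norm a b u + L2_norm a b w)\<^sup>2" .
qed simp

lemma L2_norm_cmult: "L2_norm a b (\<lambda>x. c * u x) = \<bar>c\<bar> * L2_norm a b u"
  by (simp add: L2_norm_def L2_inner_cmult_left L2_inner_cmult_right real_sqrt_mult flip: mult.assoc)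

lemma L2_norm_uminus: "L2_norm a b (\<lambda>x. - u x) = L2_norm a b u"
  using L2_norm_cmult[of a b "-1" u] by simp

lemma L2_norm_minus_commute: "L2_norm a b (\<lambda>x. u x - w x) = L2_norm a b (\<lambda>x. w x - u x)"
  using L2_norm_uminus[of a b "\<lambda>x. u x - w x"] by simp

lemma L2_norm_triangle_diff:
  assumes u: "u \<in> L2 a b" and w: "w \<in> L2 a b"
  shows "L2_norm a b (\<lambda>x. u x - w x) \<le> L2_norm a b u + L2_norm a b w"
  using L2_norm_triangle[OF u L2_uminus[OF w]] by (simp add: L2_norm_uminus)

lemma L2_norm_triangle_mid:
  assumes "u \<in> L2 a b" "w \<in> L2 a b" "z \<in> L2 a b"
  shows "L2_norm a b (\<lambda>x. u x - z x) \<le> L2_norm a b (\<lambda>x. u x - w x) + L2_norm a b (\<lambda>x. w x - z x)"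
  using L2_norm_triangle[OF L2_diff[OF assms(1,2)] L2_diff[OF assms(2,3)]] by simp

lemma L2_inner_cong_AE:
  assumes "u \<in> L2 a b" "u' \<in> L2 a b" "w \<in> L2 a b" "w' \<in> L2 a b"
    and "AE x in leb a b. u x = u' x" "AE x in leb a b. w x = w' x"
  shows "L2_inner a b u w = L2_inner a b u' w'"
proof -
  note [measurable] = assms(1-4)[THEN L2_measurable]
  show ?thesis unfolding L2_inner_def
    by (rule integral_cong_AE) (use assms(5,6) in auto)
qed

lemma L2_norm_cong_AE:
  assumes "u \<in> L2 a b" "u' \<in> L2 a b" "AE x in leb a b. u x = u' x"
  shows "L2_norm a b u = L2_norm a b u'"
  using L2_inner_cong_AE[OF assms(1,2) assms(1,2) assms(3) assms(3)] by (simp add: L2_norm_def)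

lemma L2_cong: "(\<And>x. x \<in> {a<..<b} \<Longrightarrow> u x = u' x) \<Longrightarrow> u \<in> L2 a b \<longleftrightarrow> u' \<in> L2 a b"
proof -
  assume *: "\<And>x. x \<in> {a<..<b} \<Longrightarrow> u x = u' x"
  have "u \<in> borel_measurable (leb a b) \<longleftrightarrow> u' \<in> borel_measurable (leb a b)"
    by (rule measurable_cong) (use * in auto)
  moreover have "integrable (leb a b) (\<lambda>x. (u x)\<^sup>2) \<longleftrightarrow> integrable (leb a b) (\<lambda>x. (u' x)\<^sup>2)"
    by (rule Bochner_Integration.integrable_cong) (use * in auto)
  ultimately show ?thesis by (simp add: L2_def)
qed

lemma L2_inner_cong:
  "(\<And>x. x \<in> {a<..<b} \<Longrightarrow> u x = u' x) \<Longrightarrow> (\<And>x. x \<in> {a<..<b} \<Longrightarrow> w x = w' x) \<Longrightarrow>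
    L2_inner a b u w = L2_inner a b u' w'"
  unfolding L2_inner_def by (rule Bochner_Integration.integral_cong) auto

lemma L2_norm_cong:
  "(\<And>x. x \<in> {a<..<b} \<Longrightarrow> u x = u' x) \<Longrightarrow> L2_norm a b u = L2_norm a b u'"
  unfolding L2_norm_def by (subst L2_inner_cong) auto

section \<open>Integrals and norms on subintervals\<close>

lemma integral_leb_combine:
  fixes f :: "real \<Rightarrow> real"
  assumes "a \<le> c" "c \<le> b" "integrable (leb a b) f"
  shows "integrable (leb a c) f" "integrable (leb c b) f"
    "(LINT x|leb a b. f x) = (LINT x|leb a c. f x) + (LINT x|leb c b. f x)"
proof -
  have abs: "f absolutely_integrable_on {a<..<b}"
    using assms(3) unfolding set_integrable_def by (subst (asm) integrable_restrict_space) auto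
  \<comment> \<open>The open intervals omit the point \<open>c\<close>; gauge integrals over closed
    intervals can be added directly.\<close>
  then have abs': "f absolutely_integrable_on {a..b}" by (rule absolutely_integrable_on_Icc_iff_Ioo[THEN iffD2])
  have 1: "f absolutely_integrable_on {a<..<c}" "f absolutely_integrable_on {c<..<b}"
    using assms by (auto intro: set_integrable_subset[OF abs])
  then show i: "integrable (leb a c) f" "integrable (leb c b) f"
    by (auto intro: absolutely_integrable_imp_integrable)
  have "integral {a..b} f = integral {a..c} f + integral {c..b} f"
    using set_lebesgue_integral_eq_integral(1)[OF abs'] assms by (intro Henstock_Kurzweil_Integration.integral_combine[symmetric]) auto
  then show "(LINT x|leb a b. f x) = (LINT x|leb a c. f x) + (LINT x|leb c b. f x)"
    using assms i by (simp add: lebesgue_integral_eq_integral integral_open_interval_real)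
qed

lemma integrable_leb_sub:
  fixes f :: "real \<Rightarrow> real"
  assumes "a \<le> c" "c \<le> d" "d \<le> b" "integrable (leb a b) f"
  shows "integrable (leb c d) f"
proof -
  have "integrable (leb c b) f" using integral_leb_combine(2)[of a c b f] assms by simp
  then show ?thesis using integral_leb_combine(1)[of c d b f] assms by simp
qed

lemma measurable_leb_sub:
  fixes f :: "real \<Rightarrow> real"
  assumes "a \<le> c" "d \<le> b" "f \<in> borel_measurable (leb a b)"
  shows "f \<in> borel_measurable (leb c d)"
  using assms by (auto intro: measurable_restrict_mono)

lemma L2_sub:
  assumes "a \<le> c" "c \<le> d" "d \<le> b" "u \<in> L2 a b"
  shows "u \<in> L2 c d"
proof -
  have "u \<in> borel_measurable (leb a b)" "integrable (leb a b) (\<lambda>x. (u x)\<^sup>2)"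
    using assms(4) unfolding L2_def by blast+
  note * = measurable_leb_sub[OF assms(1,3) this(1)] integrable_leb_sub[OF assms(1-3) this(2)]
  show ?thesis unfolding L2_def using * by blast
qed

lemma AE_leb_sub:
  assumes "a \<le> c" "d \<le> b" "AE x in leb a b. P x"
  shows "AE x in leb c d. P x"
  using assms by (auto simp: AE_restrict_space_iff elim: eventually_mono)

lemma L2_inner_combine:
  assumes "a \<le> c" "c \<le> b" "u \<in> L2 a b" "w \<in> L2 a b"
  shows "L2_inner a b u w = L2_inner a c u w + L2_inner c b u w"
  using integral_leb_combine(3)[OF assms(1,2) L2_integrable_mult[OF assms(3,4)]]
  by (simp add: L2_inner_def)

lemma LINT_leb_const: "a \<le> b \<Longrightarrow> (LINT x|leb a b. c) = c * (b - a)"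
  by (simp add: measure_restrict_space)

lemma L2_norm_const: "a \<le> b \<Longrightarrow> L2_norm a b (\<lambda>_. c) = \<bar>c\<bar> * sqrt (b - a)"
  by (simp only: L2_norm_def L2_inner_def LINT_leb_const real_sqrt_mult) simp

lemma abs_LINT_le_L2:
  assumes "a \<le> b" "u \<in> L2 a b"
  shows "\<bar>LINT x|leb a b. u x\<bar> \<le> sqrt (b - a) * L2_norm a b u"
  using L2_Cauchy_Schwarz[OF assms(2) L2_const[of 1]] assms(1) by (simp add: L2_norm_const L2_inner_def mult.commute)

lemma L2_norm_le_sup:
  assumes "a \<le> b" "u \<in> L2 a b" "\<And>x. x \<in> {a<..<b} \<Longrightarrow> \<bar>u x\<bar> \<le> B" "0 \<le> B"
  shows "L2_norm a b u \<le> B * sqrt (b - a)"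
proof -
  have "L2_inner a b u u \<le> (LINT x|leb a b. B\<^sup>2)" unfolding L2_inner_def
  proof (rule integral_mono)
    show "integrable (leb a b) (\<lambda>x. B\<^sup>2)" using L2_integrable[OF L2_const] .
    show "u x * u x \<le> B\<^sup>2" if "x \<in> space (leb a b)" for x
      using assms(3)[of x] that power2_le_of_abs_le[of "u x" B] by (simp add: power2_eq_square)
  qed (rule L2_integrable_mult[OF assms(2,2)])
  then have "L2_inner a b u u \<le> B\<^sup>2 * (b - a)" using assms by (simp only: LINT_leb_const)
  then have "L2_norm a b u \<le> sqrt (B\<^sup>2 * (b - a))" unfolding L2_norm_def by (rule real_sqrt_le_mono)
  then show ?thesis using assms by (simp add: real_sqrt_mult)
qed

lemma L2_norm_bounded_mult:
  assumes "u \<in> borel_measurable (leb a b)" "\<And>x. x \<in> {a<..<b} \<Longrightarrow> \<bar>u x\<bar> \<le> B" "w \<in> L2 a b" "0 \<le> B"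
  shows "L2_norm a b (\<lambda>x. u x * w x) \<le> B * L2_norm a b w"
proof -
  have "L2_inner a b (\<lambda>x. u x * w x) (\<lambda>x. u x * w x) \<le> (LINT x|leb a b. B\<^sup>2 * (w x * w x))"
    unfolding L2_inner_def
  proof (rule integral_mono)
    show "integrable (leb a b) (\<lambda>x. u x * w x * (u x * w x))"
      using L2_bounded_mult[OF assms(1-3)] by (intro L2_integrable_mult)
    show "integrable (leb a b) (\<lambda>x. B\<^sup>2 * (w x * w x))" using L2_integrable_mult[OF assms(3,3)] by simp
    show "u x * w x * (u x * w x) \<le> B\<^sup>2 * (w x * w x)" if "x \<in> space (leb a b)" for x
    proof -
      have "(u x)\<^sup>2 \<le> B\<^sup>2" using assms(2)[of x] that by (intro power2_le_of_abs_le) simp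
      then have "(u x)\<^sup>2 * (w x * w x) \<le> B\<^sup>2 * (w x * w x)" by (intro mult_right_mono) auto
      then show ?thesis by (simp add: power2_eq_square mult_ac)
    qed
  qed
  then have "L2_inner a b (\<lambda>x. u x * w x) (\<lambda>x. u x * w x) \<le> B\<^sup>2 * L2_inner a b w w"
    by (simp add: L2_inner_def)
  then have "L2_norm a b (\<lambda>x. u x * w x) \<le> sqrt (B\<^sup>2 * L2_inner a b w w)" unfolding L2_norm_def by (rule real_sqrt_le_mono)
  then show ?thesis using assms by (simp add: real_sqrt_mult L2_norm_def)
qed

section \<open>Smooth functions and test functions\<close>

text \<open>The regularity clause of \<open>test_functions\<close>, separated from the support
  condition.\<close>

definition smooth :: "(real \<Rightarrow> real) \<Rightarrow> bool" where
  "smooth g \<longleftrightarrow> (\<forall>n x. ((deriv ^^ n) g) field_differentiable (at x))"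

text \<open>Smoothness is a greatest fixed point: exhibiting a set closed under differentiation
  replaces formulas for the higher derivatives in all constructions below.\<close>

lemma smooth_coinduct:
  assumes "g \<in> S" "\<And>g. g \<in> S \<Longrightarrow> \<exists>g'\<in>S. \<forall>x. (g has_real_derivative g' x) (at x)"
  shows "smooth g"
proof -
  have *: "deriv f \<in> S \<and> (\<forall>x. f field_differentiable at x)" if f: "f \<in> S" for f
  proof -
    obtain g' where g': "g' \<in> S" "\<And>x. (f has_real_derivative g' x) (at x)"
      using assms(2)[OF f] by blast
    have "deriv f = g'" using g'(2) by (intro ext DERIV_imp_deriv)
    then show ?thesis using g' by (auto simp: field_differentiable_def)
  qed
  have "(deriv ^^ n) g \<in> S" for n
    by (induction n) (use assms(1) * in auto)
  then show ?thesis using * by (auto simp: smooth_def)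
qed

lemma smooth_DERIV: "smooth g \<Longrightarrow> (g has_real_derivative deriv g x) (at x)"
  unfolding smooth_def DERIV_deriv_iff_field_differentiable by (metis funpow_0)

lemma smooth_deriv: "smooth g \<Longrightarrow> smooth (deriv g)"
  unfolding smooth_def by (metis comp_apply funpow_Suc_right)

lemma smooth_deriv_iter: "smooth g \<Longrightarrow> smooth ((deriv ^^ n) g)"
  by (induction n) (auto intro: smooth_deriv)

lemma smooth_continuous_on: "smooth g \<Longrightarrow> continuous_on S g"
  using smooth_DERIV by (intro DERIV_continuous_on[where D="deriv g"]) (blast intro: has_field_derivative_at_within)

lemma smooth_antideriv:
  assumes "smooth g" "\<And>x. (G has_real_derivative g x) (at x)" shows "smooth G"
proof (rule smooth_coinduct[where S="insert G (Collect smooth)"])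
  fix f assume "f \<in> insert G (Collect smooth)"
  then show "\<exists>g'\<in>insert G (Collect smooth). \<forall>x. (f has_real_derivative g' x) (at x)"
    using assms smooth_deriv smooth_DERIV by (metis insert_iff mem_Collect_eq)
qed simp

text \<open>Products alone are not closed under differentiation, since the product rule yields sums;
  this is the closure that \<open>smooth_coinduct\<close> asks for.\<close>

inductive_set smooth_ring :: "(real \<Rightarrow> real) set" where
  "smooth f \<Longrightarrow> smooth g \<Longrightarrow> (\<lambda>x. f x * g x) \<in> smooth_ring"
| "f \<in> smooth_ring \<Longrightarrow> g \<in> smooth_ring \<Longrightarrow> (\<lambda>x. f x + g x) \<in> smooth_ring"

lemma smooth_ring_smooth:
  assumes "f \<in> smooth_ring" shows "smooth f"
proof (rule smooth_coinduct[OF assms])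
  fix f assume "f \<in> smooth_ring"
  then show "\<exists>f'\<in>smooth_ring. \<forall>x. (f has_real_derivative f' x) (at x)"
  proof induction
    case (1 f g)
    have "((\<lambda>x. f x * g x) has_real_derivative deriv f x * g x + f x * deriv g x) (at x)" for x
      using DERIV_mult[OF smooth_DERIV[OF 1(1)] smooth_DERIV[OF 1(2)]] by (simp add: algebra_simps)
    moreover have "(\<lambda>x. deriv f x * g x + f x * deriv g x) \<in> smooth_ring"
      by (intro smooth_ring.intros smooth_deriv 1)
    ultimately show ?case by (intro bexI[where x="\<lambda>x. deriv f x * g x + f x * deriv g x"]) auto
  next
    case (2 f g)
    then obtain f' g' where "f' \<in> smooth_ring" "g' \<in> smooth_ring"
      "\<And>x. (f has_real_derivative f' x) (at x)" "\<And>x. (g has_real_derivative g' x) (at x)" by blast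
    then show ?case
      by (intro bexI[where x="\<lambda>x. f' x + g' x"]) (auto intro: smooth_ring.intros DERIV_add)
  qed
qed

lemma smooth_mult: "smooth f \<Longrightarrow> smooth g \<Longrightarrow> smooth (\<lambda>x. f x * g x)"
  using smooth_ring_smooth[OF smooth_ring.intros(1)] .

lemma smooth_const: "smooth (\<lambda>_. c)"
proof (rule smooth_coinduct[where S="range (\<lambda>c _. c)"])
  fix g :: "real \<Rightarrow> real" assume "g \<in> range (\<lambda>c _. c)"
  then show "\<exists>g'\<in>range (\<lambda>c _. c). \<forall>x. (g has_real_derivative g' x) (at x)"
    by (intro bexI[where x="\<lambda>_. 0"]) auto
qed simp

lemma smooth_cmult: "smooth f \<Longrightarrow> smooth (\<lambda>x. c * f x)"
  using smooth_mult[OF smooth_const] .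

lemma smooth_add:
  assumes "smooth f" "smooth g" shows "smooth (\<lambda>x. f x + g x)"
proof -
  have "(\<lambda>x. 1 * f x + 1 * g x) \<in> smooth_ring" by (intro smooth_ring.intros smooth_const assms)
  then show ?thesis using smooth_ring_smooth by simp
qed

lemma smooth_diff: "smooth f \<Longrightarrow> smooth g \<Longrightarrow> smooth (\<lambda>x. f x - g x)"
  using smooth_add[of f "\<lambda>x. (-1) * g x"] smooth_cmult[of g "-1"] by simp

text \<open>The invariant set carries a scalar factor \<open>c\<close>, which collects the powers of
  \<open>p\<close> produced by the chain rule.\<close>

lemma smooth_affine:
  assumes "smooth f" shows "smooth (\<lambda>x. f (p * x + q))"
proof (rule smooth_coinduct[where S="{\<lambda>x. c * h (p * x + q) |c h. smooth h}"])
  show "(\<lambda>x. f (p * x + q)) \<in> {\<lambda>x. c * h (p * x + q) |c h. smooth h}"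
    using assms by (intro CollectI exI[where x=1] exI[where x=f]) auto
  fix g assume "g \<in> {\<lambda>x. c * h (p * x + q) |c h. smooth h}"
  then obtain c h where g: "g = (\<lambda>x. c * h (p * x + q))" "smooth h" by blast
  have "(g has_real_derivative (c * p) * deriv h (p * x + q)) (at x)" for x
    unfolding g by (rule derivative_eq_intros DERIV_chain2[OF smooth_DERIV[OF g(2)]] refl | simp)+
  then show "\<exists>g'\<in>{\<lambda>x. c * h (p * x + q) |c h. smooth h}. \<forall>x. (g has_real_derivative g' x) (at x)"
    using smooth_deriv[OF g(2)] by (intro bexI[where x="\<lambda>x. (c * p) * deriv h (p * x + q)"]) auto
qed

section \<open>A smooth step function\<close>

lemma poly_over_exp_tendsto_0:
  "((\<lambda>x. poly p x / exp x) \<longlongrightarrow> (0::real)) at_top"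
proof -
  have "((\<lambda>x. \<Sum>i\<le>degree p. coeff p i * (x ^ i / exp x)) \<longlongrightarrow> (\<Sum>i\<le>degree p. coeff p i * 0)) at_top"
    by (intro tendsto_intros tendsto_power_div_exp_0)
  then show ?thesis by (simp add: poly_altdef sum_divide_distrib)
qed

text \<open>The functions equal to a polynomial in \<open>1 / x\<close> times
  \<open>exp (- (1 / x))\<close> on the right half-line, and to 0 elsewhere, form a set closed under
  differentiation.\<close>

lemma smooth_exp_inverse: "smooth (\<lambda>x. if x > 0 then exp (- (1 / x)) else 0)"
proof -
  define F where "F p = (\<lambda>x::real. if x > 0 then poly p (1 / x) * exp (- (1 / x)) else 0)" for p
  have right0: "(F p \<longlongrightarrow> 0) (at_right 0)" for p
  proof -
    have "((\<lambda>x. poly p (inverse x) / exp (inverse x)) \<longlongrightarrow> 0) (at_right 0)"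
      by (rule filterlim_compose[OF poly_over_exp_tendsto_0 filterlim_inverse_at_top_right])
    moreover have "\<forall>\<^sub>F x in at_right 0. poly p (inverse x) / exp (inverse x) = F p x"
      by (auto simp: F_def eventually_at_filter exp_minus field_simps)
    ultimately show ?thesis by (rule Lim_transform_eventually)
  qed
  have "smooth (F [:1:])"
  proof (rule smooth_coinduct[where S="range F"])
    fix g assume "g \<in> range F"
    then obtain p where g: "g = F p" by blast
    \<comment> \<open>With \<open>u = 1 / x\<close>, the derivative in \<open>x\<close> of
      \<open>p(u) exp(-u)\<close> is \<open>u\<^sup>2 (p(u) - p'(u)) exp(-u)\<close>.\<close>
    define q where "q = [:0, 0, 1:] * p - [:0, 0, 1:] * pderiv p"
    have "(F p has_real_derivative F q x) (at x)" for x
    proof (cases x "0::real" rule: linorder_cases)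
      case less
      have "\<forall>\<^sub>F y in nhds x. F p y = 0"
        by (rule eventually_mono[OF eventually_nhds_in_open[of "{..<0}" x]]) (use less in \<open>auto simp: F_def\<close>)
      then show ?thesis using less DERIV_cong_ev[of x x "F p" "\<lambda>_. 0" "F q x" 0] by (simp add: F_def)
    next
      case greater
      have "((\<lambda>x. poly p (1 / x) * exp (- (1 / x))) has_real_derivative F q x) (at x)"
        using greater by (auto intro!: derivative_eq_intros simp: F_def q_def field_simps power2_eq_square)
      moreover have "\<forall>\<^sub>F y in nhds x. F p y = poly p (1 / y) * exp (- (1 / y))"
        by (rule eventually_mono[OF eventually_nhds_in_open[of "{0<..}" x]]) (use greater in \<open>auto simp: F_def\<close>)
      ultimately show ?thesis using DERIV_cong_ev[of x x "F p" "\<lambda>x. poly p (1 / x) * exp (- (1 / x))" "F q x" "F q x"] by simp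
    next
      case equal
      have "((\<lambda>y. F p y / y) \<longlongrightarrow> 0) (at 0)"
      proof (rule filterlim_split_at)
        have "\<forall>\<^sub>F y in at_left 0. 0 = F p y / y" by (auto simp: F_def eventually_at_filter)
        then show "((\<lambda>y. F p y / y) \<longlongrightarrow> 0) (at_left 0)" by (rule Lim_transform_eventually[OF tendsto_const])
        \<comment> \<open>Dividing by \<open>y\<close> multiplies the polynomial by its variable, so
          the difference quotient at 0 stays in the family and tends to 0.\<close>
        have "\<forall>\<^sub>F y in at_right 0. F (pCons 0 p) y = F p y / y" by (auto simp: F_def eventually_at_filter)
        then show "((\<lambda>y. F p y / y) \<longlongrightarrow> 0) (at_right 0)" by (rule Lim_transform_eventually[OF right0])
      qed
      then show ?thesis by (simp add: equal has_field_derivative_iff F_def)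
    qed
    then show "\<exists>g'\<in>range F. \<forall>x. (g has_real_derivative g' x) (at x)" using g by blast
  qed simp
  then show ?thesis by (simp add: F_def cong: if_cong)
qed

lemma smooth_antideriv_exists:
  assumes "smooth g" shows "\<exists>G. smooth G \<and> (\<forall>x. (G has_real_derivative g x) (at x))"
proof -
  have "isCont g x" for x using smooth_DERIV[OF assms] DERIV_isCont by blast
  then have "\<exists>G. \<forall>x::real. - \<infinity> < ereal x \<longrightarrow> ereal x < \<infinity> \<longrightarrow> (G has_vector_derivative g x) (at x)"
    by (intro einterval_antiderivative) auto
  then show ?thesis using smooth_antideriv[OF assms] by (auto simp: has_real_derivative_iff_has_vector_derivative)
qed

text \<open>A primitive of the bump \<open>e x * e (1 - x)\<close>, which vanishes outside the unit
  interval, shifted and scaled to run from 0 to 1.\<close>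

lemma smooth_step_exists:
  "\<exists>\<Psi>. smooth \<Psi> \<and> mono \<Psi> \<and> (\<forall>x\<le>0. \<Psi> x = 0) \<and> (\<forall>x\<ge>1. \<Psi> x = 1)"
proof -
  define e where "e x = (if x > 0 then exp (- (1 / x)) else 0)" for x :: real
  define B where "B x = e x * e (1 - x)" for x
  have e: "smooth e" unfolding e_def by (rule smooth_exp_inverse)
  have "smooth (\<lambda>x. e ((-1) * x + 1))" by (rule smooth_affine[OF e])
  then have "smooth B" unfolding B_def by (intro smooth_mult[OF e]) (simp add: add.commute)
  then obtain F where F: "smooth F" "\<And>x. (F has_real_derivative B x) (at x)"
    using smooth_antideriv_exists by blast
  have B: "0 \<le> B x" "x \<le> 0 \<or> 1 \<le> x \<Longrightarrow> B x = 0" "0 < x \<Longrightarrow> x < 1 \<Longrightarrow> 0 < B x" for x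
    by (auto simp: B_def e_def)
  have mono: "F x \<le> F y" if "x \<le> y" for x y
    using DERIV_nonneg_imp_nondecreasing[OF that, of F] F(2) B(1) by blast
  have cont: "continuous_on S F" for S by (rule smooth_continuous_on[OF F(1)])
  have lt: "F 0 < F 1"
    using F(2) B(3) by (intro DERIV_pos_imp_increasing_open[of 0 1 F]) (auto intro: cont)
  have L: "F x = F 0" if "x \<le> 0" for x
  proof (cases "x = 0")
    case False
    show ?thesis

    proof (rule DERIV_isconst2[of x 0 F 0, symmetric])
      show "(F has_real_derivative 0) (at y)" if "x < y" "y < 0" for y
        using F(2)[of y] B(2)[of y] that by simp
    qed (use that False cont in simp_all)
  qed simp
  have R: "F x = F 1" if "1 \<le> x" for x
  proof (cases "x = 1")
    case False
    show ?thesis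

    proof (rule DERIV_isconst2[of 1 x F x])
      show "(F has_real_derivative 0) (at y)" if "1 < y" "y < x" for y
        using F(2)[of y] B(2)[of y] that by simp
    qed (use that False cont in simp_all)
  qed simp
  define \<Psi> where "\<Psi> x = (1 / (F 1 - F 0)) * (F x - F 0)" for x
  have "smooth \<Psi>" unfolding \<Psi>_def by (intro smooth_cmult smooth_diff smooth_const F)
  moreover have "mono \<Psi>"
  proof (rule monoI)
    fix x y :: real assume "x \<le> y"
    from mono[OF this] have "F x - F 0 \<le> F y - F 0" by linarith
    then show "\<Psi> x \<le> \<Psi> y" unfolding \<Psi>_def using lt by (intro mult_left_mono) auto
  qed
  moreover have "\<forall>x\<le>0. \<Psi> x = 0" "\<forall>x\<ge>1. \<Psi> x = 1"
  proof -
    have "\<Psi> x = 0" if "x \<le> 0" for x unfolding \<Psi>_def L[OF that] by simp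
    then show "\<forall>x\<le>0. \<Psi> x = 0" by blast
    have "\<Psi> x = 1" if "1 \<le> x" for x unfolding \<Psi>_def R[OF that] using lt by simp
    then show "\<forall>x\<ge>1. \<Psi> x = 1" by blast
  qed
  ultimately show ?thesis by blast
qed

section \<open>Calculus of test functions\<close>

lemma test_functions_iff:
  "\<phi> \<in> test_functions a b \<longleftrightarrow> smooth \<phi> \<and> (\<exists>c d. a < c \<and> d < b \<and> (\<forall>x. x \<notin> {c..d} \<longrightarrow> \<phi> x = 0))"
  by (simp add: test_functions_def smooth_def)

lemma test_functionsI:
  "smooth \<phi> \<Longrightarrow> a < c \<Longrightarrow> d < b \<Longrightarrow> (\<And>x. x \<notin> {c..d} \<Longrightarrow> \<phi> x = 0) \<Longrightarrow> \<phi> \<in> test_functions a b"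
  unfolding test_functions_iff by blast

lemma test_functionsE:
  assumes "\<phi> \<in> test_functions a b"
  obtains c d where "a < c" "d < b" "\<And>x. x \<notin> {c..d} \<Longrightarrow> \<phi> x = 0"
  using assms unfolding test_functions_iff by blast

lemma test_smooth: "\<phi> \<in> test_functions a b \<Longrightarrow> smooth \<phi>"
  by (simp add: test_functions_iff)

lemma test_outside: "\<phi> \<in> test_functions a b \<Longrightarrow> x \<le> a \<or> b \<le> x \<Longrightarrow> \<phi> x = 0"
  by (erule test_functionsE) (metis atLeastAtMost_iff dual_order.strict_trans2 leD)

lemma test_add:
  assumes "\<phi> \<in> test_functions a b" "\<psi> \<in> test_functions a b" shows "(\<lambda>x. \<phi> x + \<psi> x) \<in> test_functions a b"
proof -
  obtain c d where 1: "a < c" "d < b" "\<And>x. x \<notin> {c..d} \<Longrightarrow> \<phi> x = 0"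
    using assms(1) unfolding test_functions_iff by blast
  obtain c' d' where 2: "a < c'" "d' < b" "\<And>x. x \<notin> {c'..d'} \<Longrightarrow> \<psi> x = 0"
    using assms(2) unfolding test_functions_iff by blast
  show ?thesis
  proof (rule test_functionsI)
    show "smooth (\<lambda>x. \<phi> x + \<psi> x)" by (intro smooth_add test_smooth[OF assms(1)] test_smooth[OF assms(2)])
    show "a < min c c'" "max d d' < b" using 1 2 by simp_all
    show "\<phi> x + \<psi> x = 0" if "x \<notin> {min c c'..max d d'}" for x
    proof -
      have "x \<notin> {c..d}" "x \<notin> {c'..d'}" using that by auto
      then show ?thesis by (simp add: 1(3) 2(3))
    qed
  qed
qed

lemma test_cmult: "\<phi> \<in> test_functions a b \<Longrightarrow> (\<lambda>x. c * \<phi> x) \<in> test_functions a b"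
  unfolding test_functions_iff by (auto intro: smooth_cmult)

lemma test_diff:
  assumes "\<phi> \<in> test_functions a b" "\<psi> \<in> test_functions a b" shows "(\<lambda>x. \<phi> x - \<psi> x) \<in> test_functions a b"
  using test_add[OF assms(1) test_cmult[OF assms(2), of "-1"]] by simp

lemma test_zero: "(\<lambda>_. 0) \<in> test_functions a b"
  by (rule test_functionsI[where c="a+1" and d="b-1"]) (auto intro: smooth_const)

lemma test_deriv:
  assumes "\<phi> \<in> test_functions a b" shows "deriv \<phi> \<in> test_functions a b"
proof -
  obtain c d where cd: "a < c" "d < b" "\<And>x. x \<notin> {c..d} \<Longrightarrow> \<phi> x = 0"
    using assms unfolding test_functions_iff by blast
  have "deriv \<phi> x = 0" if "x \<notin> {c..d}" for x
  proof -
    have "\<forall>\<^sub>F y in nhds x. \<phi> y = 0"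
    proof -
      have "\<forall>\<^sub>F y in nhds x. y \<in> - {c..d}" using that by (intro eventually_nhds_in_open) auto
      then show ?thesis by (rule eventually_mono) (use cd(3) in blast)
    qed
    then have "(\<phi> has_real_derivative 0) (at x) \<longleftrightarrow> ((\<lambda>_. 0) has_real_derivative 0) (at x)"
      by (intro DERIV_cong_ev) auto
    then show ?thesis by (simp add: DERIV_imp_deriv)
  qed
  then show ?thesis by (rule test_functionsI[OF smooth_deriv[OF test_smooth[OF assms]] cd(1,2)])
qed

lemma test_deriv_iter: "\<phi> \<in> test_functions a b \<Longrightarrow> (deriv ^^ n) \<phi> \<in> test_functions a b"
  by (induction n) (auto intro: test_deriv)

lemma test_L2: "\<phi> \<in> test_functions a b \<Longrightarrow> \<phi> \<in> L2 a' b'"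
  by (intro L2_continuous smooth_continuous_on test_smooth)

lemma deriv_iter_add:
  assumes "smooth f" "smooth g"
  shows "(deriv ^^ n) (\<lambda>x. f x + g x) = (\<lambda>x. (deriv ^^ n) f x + (deriv ^^ n) g x)"
proof (induction n)
  case (Suc n)
  show ?case using DERIV_add[OF smooth_DERIV[OF smooth_deriv_iter[OF assms(1)]] smooth_DERIV[OF smooth_deriv_iter[OF assms(2)]]]
    by (simp add: Suc fun_eq_iff DERIV_imp_deriv)
qed simp

lemma deriv_iter_cmult:
  assumes "smooth f"
  shows "(deriv ^^ n) (\<lambda>x. c * f x) = (\<lambda>x. c * (deriv ^^ n) f x)"
proof (induction n)
  case (Suc n)
  show ?case using DERIV_cmult[OF smooth_DERIV[OF smooth_deriv_iter[OF assms(1)]]]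
    by (simp add: Suc fun_eq_iff DERIV_imp_deriv)
qed simp

lemma deriv_iter_diff:
  assumes "smooth f" "smooth g"
  shows "(deriv ^^ n) (\<lambda>x. f x - g x) = (\<lambda>x. (deriv ^^ n) f x - (deriv ^^ n) g x)"
  using deriv_iter_add[OF assms(1) smooth_cmult[OF assms(2), of "-1"]] deriv_iter_cmult[OF assms(2), of _ "-1"] by simp

lemma LINT_leb_DERIV:
  assumes "a \<le> b" "\<And>x. x \<in> {a..b} \<Longrightarrow> (F has_real_derivative f x) (at x within {a..b})" "continuous_on {a..b} f"
  shows "(LINT x|leb a b. f x) = F b - F a"
proof -
  have "(f has_integral F b - F a) {a..b}"
    using assms by (intro fundamental_theorem_of_calculus) (auto simp: has_real_derivative_iff_has_vector_derivative)
  then show ?thesis using L2_integrable[OF L2_continuous[OF assms(3)]]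
    by (simp add: lebesgue_integral_eq_integral integral_unique integral_open_interval_real[symmetric])
qed

text \<open>A primitive is constant on either side of the support of \<open>\<eta>\<close>; the
  vanishing integral makes the two constants equal, so subtracting \<open>F a\<close> leaves compact
  support.\<close>

lemma test_antideriv:
  assumes "\<eta> \<in> test_functions a b" "a < b" "(LINT x|leb a b. \<eta> x) = 0"
  shows "\<exists>\<phi>\<in>test_functions a b. deriv \<phi> = \<eta>"
proof -
  obtain c d where cd: "a < c" "d < b" "\<And>x. x \<notin> {c..d} \<Longrightarrow> \<eta> x = 0"
    using assms(1) unfolding test_functions_iff by blast
  obtain F where F: "smooth F" "\<And>x. (F has_real_derivative \<eta> x) (at x)"
    using smooth_antideriv_exists test_smooth assms(1) by blast
  have cont: "continuous_on S F" for S by (rule smooth_continuous_on[OF F(1)])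
  have L: "F x = F a" if "x < c" for x
  proof -
    have *: "F y = F z" if "y < z" "z < c" for y z
    proof (rule DERIV_isconst2[of y z F z, symmetric])
      show "(F has_real_derivative 0) (at x)" if "y < x" "x < z" for x
        using F(2)[of x] cd(3)[of x] that \<open>z < c\<close> by simp
    qed (use that cont in simp_all)
    show ?thesis
    proof (cases x a rule: linorder_cases)
      case less then show ?thesis by (rule *) (rule cd(1))
    next
      case greater then show ?thesis by (rule *[symmetric]) (rule that)
    qed simp
  qed
  have "F b - F a = 0"
    using assms(2,3) F(2) test_smooth[OF assms(1)]
    by (subst LINT_leb_DERIV[symmetric]) (auto intro: has_field_derivative_at_within smooth_continuous_on)
  have R: "F x = F a" if "d < x" for x
  proof -
    have *: "F y = F z" if "y < z" "d < y" for y z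
    proof (rule DERIV_isconst2[of y z F z, symmetric])
      show "(F has_real_derivative 0) (at x)" if "y < x" "x < z" for x
        using F(2)[of x] cd(3)[of x] that \<open>d < y\<close> by simp
    qed (use that cont in simp_all)
    show ?thesis
    proof (cases x b rule: linorder_cases)
      case less then show ?thesis using *[of x b] that \<open>F b - F a = 0\<close> by linarith
    next
      case greater then show ?thesis using *[of b x] cd(2) \<open>F b - F a = 0\<close> by linarith
    qed (use \<open>F b - F a = 0\<close> in simp)
  qed
  define \<phi> where "\<phi> x = F x - F a" for x
  have "\<phi> \<in> test_functions a b"
  proof (rule test_functionsI)
    show "smooth \<phi>" unfolding \<phi>_def by (intro smooth_diff smooth_const F)
    show "a < c" "d < b" by (rule cd)+
    show "\<phi> x = 0" if "x \<notin> {c..d}" for x using L[of x] R[of x] that by (cases "x < c") (simp_all add: \<phi>_def)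
  qed
  moreover have "deriv \<phi> = \<eta>"
    unfolding \<phi>_def using F(2) by (intro ext DERIV_imp_deriv) (auto intro!: derivative_eq_intros)
  ultimately show ?thesis by blast
qed

section \<open>Indicators as limits of test functions, and the fundamental lemma\<close>

lemma test_approx_indicator:
  assumes "a < s" "s \<le> t" "t < b"
  shows "\<exists>\<phi>::nat \<Rightarrow> real \<Rightarrow> real. (\<forall>n. \<phi> n \<in> test_functions a b) \<and> (\<forall>n x. 0 \<le> \<phi> n x \<and> \<phi> n x \<le> 1) \<and>
    (\<forall>x. (\<lambda>n. \<phi> n x) \<longlonglongrightarrow> indicator {s<..t} x)"
proof -
  obtain \<Psi> where \<Psi>: "smooth \<Psi>" "mono \<Psi>" "\<And>x. x \<le> 0 \<Longrightarrow> \<Psi> x = 0" "\<And>x. x \<ge> 1 \<Longrightarrow> \<Psi> x = 1"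
    using smooth_step_exists by auto
  have \<Psi>01: "0 \<le> \<Psi> x" "\<Psi> x \<le> 1" for x
    using monoD[OF \<Psi>(2), of "min x 0" x] monoD[OF \<Psi>(2), of x "max x 1"] \<Psi>(3)[of "min x 0"] \<Psi>(4)[of "max x 1"] by auto
  \<comment> \<open>The transition to the right of \<open>t\<close> will have width at most
    \<open>1 / real N\<close>, so the support ends before \<open>b\<close>.\<close>
  obtain N where N: "0 < N" "1 / real N < b - t"
  proof -
    obtain N where N: "1 / (b - t) < real N" using reals_Archimedean2 by blast
    moreover have "0 < 1 / (b - t)" using assms(3) by simp
    ultimately have "0 < real N" by linarith
    then show ?thesis using N assms(3) by (intro that[of N]) (auto simp: field_simps)
  qed
  define m where "m n = real (N + n)" for n
  have m: "0 < m n" "real n \<le> m n" "1 / m n \<le> 1 / real N" for n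
    using N(1) by (auto simp: m_def intro!: divide_left_mono)
  \<comment> \<open>A steepened step rising at \<open>s\<close> minus one rising at
    \<open>t\<close>. As \<open>\<Psi> 0 = 0\<close>, each step is 0 at its own jump point, whence
    the half-open interval in the limit.\<close>
  define \<phi> where "\<phi> n x = \<Psi> (m n * x + - (m n * s)) - \<Psi> (m n * x + - (m n * t))" for n x
  have neg: "m n * x + - (m n * z) \<le> 0" if "x \<le> z" for n x z
    using mult_left_mono[OF that less_imp_le[OF m(1)[of n]]] by linarith
  have lim: "(\<lambda>n. \<Psi> (m n * x + - (m n * z))) \<longlonglongrightarrow> indicator {z<..} x" for x z
  proof (cases "x \<le> z")
    case True
    have "\<Psi> (m n * x + - (m n * z)) = 0" for n
      by (rule \<Psi>(3)[OF neg[OF True]])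
    then show ?thesis using True by simp
  next
    case False
    obtain M where M: "1 / (x - z) < real M" using reals_Archimedean2 by blast
    have "1 = \<Psi> (m n * x + - (m n * z))" if "M \<le> n" for n
    proof -
      have "1 < real M * (x - z)" using M False by (simp add: field_simps)
      also have "\<dots> \<le> m n * (x - z)"
        using that False m(2)[of n] by (intro mult_right_mono) auto
      also have "\<dots> = m n * x + - (m n * z)" by (simp add: algebra_simps)
      finally show ?thesis by (intro \<Psi>(4)[symmetric] less_imp_le)
    qed
    then have "\<forall>\<^sub>F n in sequentially. 1 = \<Psi> (m n * x + - (m n * z))"
      unfolding eventually_sequentially by blast
    from Lim_transform_eventually[OF tendsto_const this] show ?thesis using False by simp
  qed
  have "(\<lambda>n. \<phi> n x) \<longlonglongrightarrow> indicator {s<..} x - indicator {t<..} x" for x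
    unfolding \<phi>_def by (intro tendsto_diff lim)
  moreover have "indicator {s<..} x - indicator {t<..} x = (indicator {s<..t} x :: real)" for x
    using assms by (auto simp: indicator_def)
  ultimately have 1: "(\<lambda>n. \<phi> n x) \<longlonglongrightarrow> indicator {s<..t} x" for x by simp
  have 2: "0 \<le> \<phi> n x \<and> \<phi> n x \<le> 1" for n x
  proof -
    have "m n * s \<le> m n * t" using assms(2) m(1)[of n] by (intro mult_left_mono) auto
    then have "\<Psi> (m n * x + - (m n * t)) \<le> \<Psi> (m n * x + - (m n * s))"
      by (intro monoD[OF \<Psi>(2)]) linarith
    then show ?thesis using \<Psi>01[of "m n * x + - (m n * t)"] \<Psi>01[of "m n * x + - (m n * s)"]
      unfolding \<phi>_def by linarith
  qed
  have 3: "\<phi> n \<in> test_functions a b" for n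
  proof (rule test_functionsI)
    show "smooth (\<phi> n)" unfolding \<phi>_def by (intro smooth_diff smooth_affine \<Psi>)
    show "a < s" by fact
    show "t + 1 / m n < b" using N(2) m(3)[of n] by linarith
    show "\<phi> n x = 0" if "x \<notin> {s..t + 1 / m n}" for x
    proof (cases "x < s")
      case True
      then have "x \<le> s" "x \<le> t" using assms by auto
      then show ?thesis unfolding \<phi>_def by (simp only: \<Psi>(3) neg)
    next
      case False
      then have "1 / m n < x - t" using that by auto
      then have "1 < m n * (x - t)" using m(1)[of n] by (simp add: field_simps)
      moreover have "m n * (x - t) \<le> m n * (x - s)" using assms m(1)[of n] by (intro mult_left_mono) auto
      ultimately have "1 \<le> m n * x + - (m n * t)" "1 \<le> m n * x + - (m n * s)"
        unfolding right_diff_distrib by linarith+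
      then show ?thesis unfolding \<phi>_def by (simp only: \<Psi>(4))
    qed
  qed
  show ?thesis using 1 2 3 by blast
qed

lemma LINT_leb_indicator:
  fixes u :: "real \<Rightarrow> real"
  assumes "a \<le> s" "s \<le> t" "t \<le> b" "integrable (leb a b) u"
  shows "(LINT x|leb a b. u x * indicator {s<..t} x) = (LINT x|leb s t. u x)"
proof -
  have "integrable (leb a b) (\<lambda>x. u x * indicator {s<..t} x)"
  proof (rule Bochner_Integration.integrable_bound[OF assms(4)])
    have [measurable]: "(indicator {s<..t} :: real \<Rightarrow> real) \<in> borel_measurable (leb a b)" "u \<in> borel_measurable (leb a b)"
      using assms(4) by (intro measurable_restrict_space1 borel_measurable_indicator, simp, simp)
    show "(\<lambda>x. u x * indicat_real {s<..t} x) \<in> borel_measurable (leb a b)" by measurable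
  qed (auto simp: indicator_def)
  note i1 = this integral_leb_combine[of a s b, OF _ _ this]
  note i2 = integral_leb_combine[of s t b, OF _ _ i1(3)]
  have "(LINT x|leb a b. u x * indicator {s<..t} x) = (LINT x|leb a s. u x * indicator {s<..t} x) +
    ((LINT x|leb s t. u x * indicator {s<..t} x) + (LINT x|leb t b. u x * indicator {s<..t} x))"
    using i1(4) i2(3) assms by simp
  also have "(LINT x|leb a s. u x * indicator {s<..t} x) = (LINT x|leb a s. 0)"
    by (rule Bochner_Integration.integral_cong) auto
  also have "(LINT x|leb t b. u x * indicator {s<..t} x) = (LINT x|leb t b. 0)"
    by (rule Bochner_Integration.integral_cong) auto
  also have "(LINT x|leb s t. u x * indicator {s<..t} x) = (LINT x|leb s t. u x)"
    by (rule Bochner_Integration.integral_cong) auto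
  finally show ?thesis by simp
qed

lemma test_approx_LINT:
  fixes u :: "real \<Rightarrow> real"
  assumes "a < s" "s \<le> t" "t < b" "integrable (leb a b) u"
   and "\<And>n. \<phi> n \<in> test_functions a b" "\<And>n x. 0 \<le> \<phi> n x \<and> \<phi> n x \<le> 1"
    "\<And>x. (\<lambda>n. \<phi> n x) \<longlonglongrightarrow> indicator {s<..t} x"
  shows "(\<lambda>n::nat. LINT x|leb a b. u x * \<phi> n x) \<longlonglongrightarrow> (LINT x|leb s t. u x)"
proof -
  note [measurable] = borel_measurable_integrable[OF assms(4)] L2_measurable[OF test_L2[OF assms(5)]]
  have 1: "(\<lambda>n. LINT x|leb a b. u x * \<phi> n x) \<longlonglongrightarrow> (LINT x|leb a b. u x * indicator {s<..t} x)"
  proof (rule integral_dominated_convergence[where w="\<lambda>x. \<bar>u x\<bar>"])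
    show "(\<lambda>x. u x * indicat_real {s<..t} x) \<in> borel_measurable (leb a b)"
      using assms by (intro borel_measurable_integrable integrable_real_mult_indicator) (auto simp: sets_restrict_space_iff)
    show "integrable (leb a b) (\<lambda>x. \<bar>u x\<bar>)" using assms(4) by simp
    show "AE x in leb a b. (\<lambda>n. u x * \<phi> n x) \<longlonglongrightarrow> u x * indicat_real {s<..t} x"
      by (intro AE_I2 tendsto_mult tendsto_const assms(7))
    show "AE x in leb a b. norm (u x * \<phi> n x) \<le> \<bar>u x\<bar>" for n
      using assms(6) by (intro AE_I2) (auto simp: abs_mult intro: mult_left_le)
  qed measurable
  then show ?thesis using assms by (subst (asm) LINT_leb_indicator) auto
qed

text \<open>By Lebesgue differentiation almost every value is a limit of averages over
  \<open>{x..x+h}\<close>, and these averages vanish.\<close>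

lemma AE_zero_of_integrals_zero:
  fixes u :: "real \<Rightarrow> real"
  assumes "integrable (leb a b) u" "\<And>s t. a < s \<Longrightarrow> s \<le> t \<Longrightarrow> t < b \<Longrightarrow> (LINT x|leb s t. u x) = 0"
  shows "AE x in leb a b. u x = 0"
proof -
  define g where "g x = indicator {a<..<b} x *\<^sub>R u x" for x
  have "integrable lebesgue g"
    using assms(1) unfolding g_def by (subst (asm) integrable_restrict_space) auto
  then have "g absolutely_integrable_on UNIV"
    by (simp add: set_integrable_def)
  then have "g absolutely_integrable_on cbox c d" for c d
    using set_integrable_subset[of lebesgue UNIV g "cbox c d"] by auto
  then have gi: "g integrable_on cbox c d" for c d
    using set_lebesgue_integral_eq_integral(1) by blast
  obtain N where N: "negligible N" "\<And>x e. \<lbrakk>x \<notin> N; 0 < e\<rbrakk> \<Longrightarrow>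
       \<exists>d>0. \<forall>h. 0 < h \<and> h < d \<longrightarrow> norm(integral (cbox x (x + h *\<^sub>R One)) g /\<^sub>R h ^ DIM(real) - g x) < e"
    by (rule integrable_ccontinuous_explicit[of g, OF gi]) (rule that)
  have "u x = 0" if x: "x \<in> {a<..<b}" "x \<notin> N" for x
  proof (rule ccontr)
    assume u: "u x \<noteq> 0"
    then obtain d where d: "d > 0" "\<And>h. 0 < h \<Longrightarrow> h < d \<Longrightarrow> \<bar>integral {x..x+h} g / h - g x\<bar> < \<bar>u x\<bar>"
      using N(2)[OF x(2), of "\<bar>u x\<bar>"] by (auto simp: divide_inverse mult.commute)
    define h where "h = min d (b - x) / 2"
    have h: "0 < h" "h < d" "x + h < b" using d(1) x by (auto simp: h_def min_def field_simps)
    have "integral {x..x+h} g = integral {x<..<x+h} u"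
      unfolding integral_open_interval_real using h x by (intro Henstock_Kurzweil_Integration.integral_cong) (auto simp: g_def)
    also have "\<dots> = (LINT y|leb x (x+h). u y)"
      using h x integrable_leb_sub[of a x "x+h" b u] assms(1) by (simp add: lebesgue_integral_eq_integral)
    also have "\<dots> = 0" using h x by (intro assms(2)) auto
    finally show False using d(2)[OF h(1,2)] x by (simp add: g_def)
  qed
  then have "AE x in lebesgue. x \<in> {a<..<b} \<longrightarrow> u x = 0"
    using N(1) unfolding negligible_iff_null_sets by (intro AE_I'[of N]) auto
  then show ?thesis by (subst AE_restrict_space_iff) auto
qed

text \<open>Test functions approximating the indicator of an interval turn the hypothesis into
  vanishing integrals over intervals.\<close>

lemma fundamental_lemma:
  assumes u: "integrable (leb a b) u" and z: "\<And>\<phi>. \<phi> \<in> test_functions a b \<Longrightarrow> L2_inner a b u \<phi> = 0"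
  shows "AE x in leb a b. u x = 0"
proof (rule AE_zero_of_integrals_zero[OF u])
  fix s t assume st: "a < s" "s \<le> t" "t < b"
  obtain \<phi> where \<phi>: "\<And>n::nat. \<phi> n \<in> test_functions a b" "\<And>n x. 0 \<le> \<phi> n x \<and> \<phi> n x \<le> 1"
    "\<And>x. (\<lambda>n. \<phi> n x) \<longlonglongrightarrow> indicator {s<..t} x"
    using test_approx_indicator[OF st] by blast
  have "(\<lambda>n::nat. LINT x|leb a b. u x * \<phi> n x) \<longlonglongrightarrow> (LINT x|leb s t. u x)"
    by (rule test_approx_LINT[OF st u \<phi>])
  moreover have "(LINT x|leb a b. u x * \<phi> n x) = 0" for n using z[OF \<phi>(1)] by (simp add: L2_inner_def)
  ultimately show "(LINT x|leb s t. u x) = 0" by (simp add: LIMSEQ_const_iff)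
qed

lemma weak_deriv_unique:
  assumes "is_weak_deriv a b j u w" "is_weak_deriv a b j u w'" "w \<in> L2 a b" "w' \<in> L2 a b"
  shows "AE x in leb a b. w x = w' x"
proof -
  have "AE x in leb a b. w x - w' x = 0"
  proof (rule fundamental_lemma)
    show "integrable (leb a b) (\<lambda>x. w x - w' x)" by (intro L2_integrable L2_diff assms)
    fix \<phi> assume \<phi>: "\<phi> \<in> test_functions a b"
    then have "(-1) ^ j * L2_inner a b w \<phi> = (-1) ^ j * L2_inner a b w' \<phi>"
      using assms(1,2) unfolding is_weak_deriv_def by metis
    then show "L2_inner a b (\<lambda>x. w x - w' x) \<phi> = 0"
      using assms \<phi> by (simp add: L2_inner_diff_left test_L2)
  qed
  then show ?thesis by simp
qed

text \<open>Lets later arguments replace the chosen representative by an explicit one, up to a null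
  set.\<close>

lemma weak_deriv_spec:
  assumes "is_weak_deriv a b j u w" "w \<in> L2 a b"
  shows "weak_deriv a b j u \<in> L2 a b" "is_weak_deriv a b j u (weak_deriv a b j u)"
    "AE x in leb a b. weak_deriv a b j u x = w x"
proof -
  have "weak_deriv a b j u \<in> L2 a b \<and> is_weak_deriv a b j u (weak_deriv a b j u)"
    unfolding weak_deriv_def by (rule someI[where x=w]) (use assms in auto)
  then show "weak_deriv a b j u \<in> L2 a b" "is_weak_deriv a b j u (weak_deriv a b j u)" by auto
  then show "AE x in leb a b. weak_deriv a b j u x = w x" using weak_deriv_unique assms by blast
qed

section \<open>Absolutely continuous functions with square integrable derivative\<close>

text \<open>Differs from the half-open version at a single point; the closed form matches the
  sections of the triangle in \<open>LINT_triangle\<close>.\<close>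

lemma LINT_leb_indicator_Icc:
  fixes u :: "real \<Rightarrow> real"
  assumes "a \<le> s" "s \<le> t" "t \<le> b" "integrable (leb a b) u"
  shows "(LINT x|leb a b. u x * indicator {s..t} x) = (LINT x|leb s t. u x)"
proof -
  have [measurable]: "u \<in> borel_measurable (leb a b)"
    "(indicator {s..t} :: real \<Rightarrow> real) \<in> borel_measurable (leb a b)" "(indicator {s<..t} :: real \<Rightarrow> real) \<in> borel_measurable (leb a b)"
    using assms(4) by (simp, (intro measurable_restrict_space1 borel_measurable_indicator, simp)+)
  have "AE x in lebesgue. x \<noteq> s" using AE_completion[OF AE_lborel_singleton[of s]] by simp
  then have "AE x in leb a b. x \<noteq> s" by (subst AE_restrict_space_iff) auto
  then have "AE x in leb a b. u x * indicator {s..t} x = u x * indicator {s<..t} x"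
    by eventually_elim (auto simp: indicator_def)
  then have "(LINT x|leb a b. u x * indicator {s..t} x) = (LINT x|leb a b. u x * indicator {s<..t} x)"
    by (intro integral_cong_AE) auto
  then show ?thesis using LINT_leb_indicator[OF assms] by simp
qed

text \<open>\<open>F\<close> is the absolutely continuous representative of an
  \<open>H\<^sup>1\<close> function and \<open>f\<close> a square integrable derivative of it.
  Carrying \<open>f\<close> as an argument avoids the choice in \<open>weak_deriv\<close>, and
  \<open>F\<close> has values at the end points; \<open>f\<close> is determined up to a null
  set.\<close>

definition acd :: "real \<Rightarrow> real \<Rightarrow> (real \<Rightarrow> real) \<Rightarrow> (real \<Rightarrow> real) \<Rightarrow> bool" where
  "acd a b F f \<longleftrightarrow> f \<in> L2 a b \<and> (\<forall>y\<in>{a..b}. F y = F a + (LINT s|leb a y. f s))"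

lemma acd_L2: "acd a b F f \<Longrightarrow> f \<in> L2 a b"
  by (simp only: acd_def)

lemma acd_eq:
  assumes "acd a b F f" "a \<le> y" "y \<le> b" shows "F y = F a + (LINT s|leb a y. f s)"
proof -
  have "\<forall>y\<in>{a..b}. F y = F a + (LINT s|leb a y. f s)" using assms(1) unfolding acd_def by (rule conjunct2)
  then show ?thesis by (rule bspec) (use assms(2,3) in simp)
qed

lemma acd_diff_eq:
  assumes "acd a b F f" "a \<le> x" "x \<le> y" "y \<le> b"
  shows "F y - F x = (LINT s|leb x y. f s)"
proof -
  have "integrable (leb a y) f"
    by (rule integrable_leb_sub[of a a y b, OF _ _ _ L2_integrable[OF acd_L2[OF assms(1)]]]) (use assms(2-4) in simp_all)
  then have "(LINT s|leb a y. f s) = (LINT s|leb a x. f s) + (LINT s|leb x y. f s)"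
    by (intro integral_leb_combine(3) assms)
  moreover have "F y = F a + (LINT s|leb a y. f s)" "F x = F a + (LINT s|leb a x. f s)"
    by (rule acd_eq[OF assms(1)]; use assms(2-4) in simp)+
  ultimately show ?thesis by linarith
qed

lemma acdI: "f \<in> L2 a b \<Longrightarrow> (\<And>y. a \<le> y \<Longrightarrow> y \<le> b \<Longrightarrow> F y = F a + (LINT s|leb a y. f s)) \<Longrightarrow> acd a b F f"
  unfolding acd_def by (intro conjI ballI) (simp_all only: atLeastAtMost_iff)

lemma acd_integral:
  assumes "f \<in> L2 a b" shows "acd a b (\<lambda>y. c + (LINT s|leb a y. f s)) f"
  by (rule acdI[OF assms]) simp

lemma acd_cong:
  assumes "acd a b F f" "\<And>y. y \<in> {a..b} \<Longrightarrow> F y = G y" "\<And>y. y \<in> {a<..<b} \<Longrightarrow> f y = g y"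
  shows "acd a b G g"
proof (rule acdI)
  show "g \<in> L2 a b" using acd_L2[OF assms(1)] L2_cong[of a b f g] assms(3) by simp
  fix y assume y: "a \<le> y" "y \<le> b"
  have "(LINT s|leb a y. f s) = (LINT s|leb a y. g s)"
    using y assms(3) by (intro Bochner_Integration.integral_cong) auto
  then show "G y = G a + (LINT s|leb a y. g s)"
    using acd_diff_eq[OF assms(1), of a y] assms(2)[of y] assms(2)[of a] y by simp
qed

lemma acd_sub:
  assumes "acd a b F f" "a \<le> c" "c \<le> d" "d \<le> b" shows "acd c d F f"
proof (rule acdI)
  show "f \<in> L2 c d" using L2_sub[OF assms(2-4) acd_L2[OF assms(1)]] .
  fix y assume "c \<le> y" "y \<le> d"
  then show "F y = F c + (LINT s|leb c y. f s)" using acd_diff_eq[OF assms(1), of c y] assms by simp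
qed

lemma acd_add:
  assumes "acd a b F f" "acd a b G g" shows "acd a b (\<lambda>y. F y + G y) (\<lambda>y. f y + g y)"
proof (rule acdI)
  show "(\<lambda>y. f y + g y) \<in> L2 a b" by (intro L2_add assms[THEN acd_L2])
  fix y assume y: "a \<le> y" "y \<le> b"
  then have "integrable (leb a y) f" "integrable (leb a y) g"
    using assms[THEN acd_L2, THEN L2_integrable] by (auto intro: integrable_leb_sub[of a a y b])
  then show "F y + G y = F a + G a + (LINT s|leb a y. f s + g s)"
    using acd_diff_eq[OF assms(1), of a y] acd_diff_eq[OF assms(2), of a y] y by simp
qed

lemma acd_cmult:
  assumes "acd a b F f" shows "acd a b (\<lambda>y. c * F y) (\<lambda>y. c * f y)"
proof (rule acdI)
  show "(\<lambda>y. c * f y) \<in> L2 a b" by (intro L2_cmult assms[THEN acd_L2])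
  fix y assume y: "a \<le> y" "y \<le> b"
  show "c * F y = c * F a + (LINT s|leb a y. c * f s)" unfolding acd_eq[OF assms y] by (simp add: distrib_left)
qed

lemma acd_diff:
  assumes "acd a b F f" "acd a b G g" shows "acd a b (\<lambda>y. F y - G y) (\<lambda>y. f y - g y)"
  using acd_add[OF assms(1) acd_cmult[OF assms(2), of "-1"]] by simp

lemma acd_const: "acd a b (\<lambda>_. c) (\<lambda>_. 0)"
  by (rule acdI[OF L2_const]) simp

lemma acd_DERIV:
  assumes "\<And>x. x \<in> {a..b} \<Longrightarrow> (F has_real_derivative f x) (at x within {a..b})" "continuous_on {a..b} f"
  shows "acd a b F f"
proof (rule acdI)
  show "f \<in> L2 a b" by (rule L2_continuous[OF assms(2)])
  fix y assume y: "a \<le> y" "y \<le> b"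
  have "(LINT s|leb a y. f s) = F y - F a"
  proof (rule LINT_leb_DERIV[OF y(1)])
    show "(F has_real_derivative f x) (at x within {a..y})" if "x \<in> {a..y}" for x
      using DERIV_subset[OF assms(1)[of x], of "{a..y}"] that y by auto
    show "continuous_on {a..y} f" using continuous_on_subset[OF assms(2)] y by auto
  qed
  then show "F y = F a + (LINT s|leb a y. f s)" by simp
qed

lemma acd_integral_Icc:
  assumes "acd a b F f" "y \<in> {a..b}"
  shows "F y = F a + integral {a..y} f"
proof -
  have "integrable (leb a y) f" using L2_integrable[OF acd_L2[OF assms(1)]] assms(2) by (intro integrable_leb_sub[of a a y b]) auto
  then have "(LINT s|leb a y. f s) = integral {a..y} f"
    by (simp add: lebesgue_integral_eq_integral integral_open_interval_real[symmetric])
  then show ?thesis using acd_diff_eq[OF assms(1), of a y] assms(2) by simp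
qed

lemma L2_integrable_on: "f \<in> L2 a b \<Longrightarrow> f integrable_on {a..b}"
proof -
  assume "f \<in> L2 a b"
  from L2_integrable[OF this] have "f absolutely_integrable_on {a<..<b}"
    unfolding set_integrable_def by (subst (asm) integrable_restrict_space) auto
  then have "f absolutely_integrable_on {a..b}" by (rule absolutely_integrable_on_Icc_iff_Ioo[THEN iffD2])
  then show ?thesis by (rule set_lebesgue_integral_eq_integral(1))
qed

lemma acd_continuous:
  assumes "acd a b F f" shows "continuous_on {a..b} F"
proof -
  have "continuous_on {a..b} (\<lambda>y. F a + integral {a..y} f)"
    by (intro continuous_intros indefinite_integral_continuous_1 L2_integrable_on acd_L2[OF assms])
  then show ?thesis
    by (rule continuous_on_cong[THEN iffD1, OF refl, rotated]) (rule acd_integral_Icc[OF assms, symmetric])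
qed

lemma acd_L2_fun: "acd a b F f \<Longrightarrow> F \<in> L2 a b"
  by (intro L2_continuous acd_continuous)

lemma acd_has_derivative:
  assumes "acd a b F f" "continuous_on {a..b} f" "x \<in> {a..b}"
  shows "(F has_real_derivative f x) (at x within {a..b})"
proof -
  have "((\<lambda>y. F a + integral {a..y} f) has_real_derivative f x) (at x within {a..b})"
    using integral_has_real_derivative[OF assms(2,3)] by (auto intro!: derivative_eq_intros)
  then show ?thesis
    by (rule has_field_derivative_transform_within[OF _ zero_less_one assms(3)]) (rule acd_integral_Icc[OF assms(1), symmetric])
qed

lemma acd_test: "\<phi> \<in> test_functions a b \<Longrightarrow> acd c d \<phi> (deriv \<phi>)"
  by (rule acd_DERIV[OF has_field_derivative_at_within[OF smooth_DERIV] smooth_continuous_on[OF smooth_deriv]]; erule test_smooth)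

section \<open>Fubini and integration by parts\<close>

lemma integrable_leb_prod:
  assumes f: "integrable (leb a b) f" and g: "integrable (leb a b) g"
  shows "integrable (leb a b \<Otimes>\<^sub>M leb a b) (\<lambda>p. f (fst p) * g (snd p) * of_bool (fst p \<le> snd p) :: real)"
proof -
  interpret finite_measure "leb a b" by (rule finite_measure_leb)
  interpret P: pair_sigma_finite "leb a b" "leb a b" ..
  note [measurable] = borel_measurable_integrable[OF f] borel_measurable_integrable[OF g]
  have id: "(\<lambda>x. x) \<in> borel_measurable (leb a b)" by (rule L2_measurable[OF L2_continuous]) simp
  have [measurable]: "fst \<in> borel_measurable (leb a b \<Otimes>\<^sub>M leb a b)" "snd \<in> borel_measurable (leb a b \<Otimes>\<^sub>M leb a b)"
    by (rule measurable_compose[OF measurable_fst id], rule measurable_compose[OF measurable_snd id])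
  have "integrable (leb a b \<Otimes>\<^sub>M leb a b) (\<lambda>p. f (fst p) * g (snd p))"
  proof (rule P.Fubini_integrable)
    show "integrable (leb a b) (\<lambda>x. LINT y|leb a b. norm (f (fst (x, y)) * g (snd (x, y))))"
      using f by (simp add: abs_mult)
    show "AE x in leb a b. integrable (leb a b) (\<lambda>y. f (fst (x, y)) * g (snd (x, y)))"
      using g by simp
  qed measurable
  then show ?thesis
    by (rule Bochner_Integration.integrable_bound) (auto simp: of_bool_def)
qed

text \<open>Fubini for \<open>f s * g y\<close> on the triangle \<open>s \<le> y\<close>.\<close>

lemma LINT_triangle:
  fixes f g :: "real \<Rightarrow> real"
  assumes "a \<le> b" and f: "integrable (leb a b) f" and g: "integrable (leb a b) g"
  shows "(LINT y|leb a b. (LINT s|leb a y. f s) * g y) = (LINT s|leb a b. f s * (LINT y|leb s b. g y))"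
proof -
  interpret finite_measure "leb a b" by (rule finite_measure_leb)
  interpret P: pair_sigma_finite "leb a b" "leb a b" ..
  have "(LINT y|leb a b. (LINT s|leb a y. f s) * g y) = (LINT y|leb a b. (LINT s|leb a b. f s * g y * of_bool (s \<le> y)))"
  proof (rule Bochner_Integration.integral_cong[OF refl])
    fix y assume "y \<in> space (leb a b)" then have y: "a < y" "y < b" by auto
    have "(LINT s|leb a b. f s * g y * of_bool (s \<le> y)) = (LINT s|leb a b. f s * indicator {a..y} s) * g y"
      by (subst integral_mult_left_zero[symmetric], rule Bochner_Integration.integral_cong) (auto simp: indicator_def)
    also have "(LINT s|leb a b. f s * indicator {a..y} s) = (LINT s|leb a y. f s)"
      using y by (intro LINT_leb_indicator_Icc f) auto
    finally show "(LINT s|leb a y. f s) * g y = (LINT s|leb a b. f s * g y * of_bool (s \<le> y))" by simp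
  qed
  also have "\<dots> = (LINT s|leb a b. (LINT y|leb a b. f s * g y * of_bool (s \<le> y)))"
    using integrable_leb_prod[OF f g] by (intro P.Fubini_integral) (simp add: case_prod_unfold)
  also have "\<dots> = (LINT s|leb a b. f s * (LINT y|leb s b. g y))"
  proof (rule Bochner_Integration.integral_cong[OF refl])
    fix s assume "s \<in> space (leb a b)" then have s: "a < s" "s < b" by auto
    have "(LINT y|leb a b. f s * g y * of_bool (s \<le> y)) = f s * (LINT y|leb a b. g y * indicator {s..b} y)"
      by (subst integral_mult_right_zero[symmetric], rule Bochner_Integration.integral_cong) (auto simp: indicator_def)
    also have "(LINT y|leb a b. g y * indicator {s..b} y) = (LINT y|leb s b. g y)"
      using s by (intro LINT_leb_indicator_Icc g) auto
    finally show "(LINT y|leb a b. f s * g y * of_bool (s \<le> y)) = f s * (LINT y|leb s b. g y)" .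
  qed
  finally show ?thesis .
qed

text \<open>Expressing \<open>F\<close> from its left end value and \<open>G\<close> from its right
  end value turns both inner products into boundary terms and the integral of
  \<open>f s * g y\<close> over the triangle \<open>s \<le> y\<close>, with opposite signs.\<close>

lemma acd_parts:
  assumes "a \<le> b" "acd a b F f" "acd a b G g"
  shows "L2_inner a b F g + L2_inner a b f G = F b * G b - F a * G a"
proof -
  note L2 = acd_L2[OF assms(2)] acd_L2[OF assms(3)] acd_L2_fun[OF assms(2)] acd_L2_fun[OF assms(3)]
  have F: "L2_inner a b F g = F a * (G b - G a) + (LINT y|leb a b. (LINT s|leb a y. f s) * g y)"
  proof -
    have "L2_inner a b F g = L2_inner a b (\<lambda>y. F a + (LINT s|leb a y. f s)) g"
      by (intro L2_inner_cong acd_eq[OF assms(2)]) simp_all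
    also have "\<dots> = L2_inner a b (\<lambda>_. F a) g + L2_inner a b (\<lambda>y. (LINT s|leb a y. f s)) g"
      using acd_L2_fun[OF acd_integral[OF L2(1), of 0]] by (intro L2_inner_add_left L2_const L2) simp
    finally show ?thesis using acd_diff_eq[OF assms(3), of a b] assms(1) by (simp add: L2_inner_def)
  qed
  have G: "L2_inner a b f G = (F b - F a) * G b - (LINT s|leb a b. f s * (LINT y|leb s b. g y))"
  proof -
    have "L2_inner a b f G = L2_inner a b f (\<lambda>s. G b - (LINT y|leb s b. g y))"
    proof (intro L2_inner_cong refl)
      fix s assume "s \<in> {a<..<b}"
      then show "G s = G b - (LINT y|leb s b. g y)" using acd_diff_eq[OF assms(3), of s b] by simp
    qed
    also have "\<dots> = L2_inner a b f (\<lambda>s. G b) - L2_inner a b f (\<lambda>s. (LINT y|leb s b. g y))"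
    proof (intro L2_inner_diff_right L2_const L2)
      have "(\<lambda>s. G b - G s) \<in> L2 a b" by (intro L2_diff L2_const L2)
      then show "(\<lambda>s. LINT y|leb s b. g y) \<in> L2 a b"
        using acd_diff_eq[OF assms(3), of _ b] by (subst L2_cong[where u'="\<lambda>s. G b - G s"]) auto
    qed
    finally show ?thesis using acd_diff_eq[OF assms(2), of a b] assms(1) by (simp add: L2_inner_def)
  qed
  show ?thesis
    using LINT_triangle[OF assms(1) L2_integrable[OF L2(1)] L2_integrable[OF L2(2)]]
    by (simp add: F G algebra_simps)
qed

lemma continuous_bounded_measurable:
  fixes u :: "real \<Rightarrow> real"
  assumes "continuous_on {a..b} u"
  obtains B where "u \<in> borel_measurable (leb a b)" "\<And>x. x \<in> {a..b} \<Longrightarrow> \<bar>u x\<bar> \<le> B"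
proof -
  have "bounded (u ` {a..b})" using assms compact_continuous_image compact_imp_bounded by blast
  then obtain B where "\<And>x. x \<in> {a..b} \<Longrightarrow> \<bar>u x\<bar> \<le> B" unfolding bounded_iff by fastforce
  then show ?thesis using that L2_measurable[OF L2_continuous[OF assms]] by blast
qed

lemma L2_continuous_mult:
  assumes "continuous_on {a..b} u" "w \<in> L2 a b" shows "(\<lambda>x. u x * w x) \<in> L2 a b"
proof -
  obtain B where "u \<in> borel_measurable (leb a b)" "\<And>x. x \<in> {a..b} \<Longrightarrow> \<bar>u x\<bar> \<le> B"
    using continuous_bounded_measurable[OF assms(1)] by blast
  then show ?thesis by (intro L2_bounded_mult[where B=B] assms) auto
qed

text \<open>Integration by parts on every initial interval is the integral form of the product
  rule.\<close>

lemma acd_mult: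
  assumes "acd a b F f" "acd a b G g"
  shows "acd a b (\<lambda>y. F y * G y) (\<lambda>y. F y * g y + f y * G y)"
proof (rule acdI)
  note L2 = L2_continuous_mult[OF acd_continuous[OF assms(1)] acd_L2[OF assms(2)]]
    L2_continuous_mult[OF acd_continuous[OF assms(2)] acd_L2[OF assms(1)]]
  show "(\<lambda>y. F y * g y + f y * G y) \<in> L2 a b"
    using L2_add[OF L2] by (simp add: mult.commute)
  fix y assume y: "a \<le> y" "y \<le> b"
  note s = acd_sub[OF assms(1) order_refl y] acd_sub[OF assms(2) order_refl y]
  have "L2_inner a y F g + L2_inner a y f G = F y * G y - F a * G a"
    by (rule acd_parts[OF y(1) s])
  moreover have "L2_inner a y F g + L2_inner a y f G = (LINT s|leb a y. F s * g s + f s * G s)"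
    unfolding L2_inner_def
    by (intro Bochner_Integration.integral_add[symmetric] L2_integrable_mult acd_L2[OF s(1)] acd_L2[OF s(2)] acd_L2_fun[OF s(1)] acd_L2_fun[OF s(2)])
  ultimately show "F y * G y = F a * G a + (LINT s|leb a y. F s * g s + f s * G s)" by simp
qed

lemma acd_is_weak_deriv:
  assumes "a \<le> b" "acd a b F f" shows "is_weak_deriv a b 1 F f"
  unfolding is_weak_deriv_def
proof
  fix \<phi> assume \<phi>: "\<phi> \<in> test_functions a b"
  have "\<phi> a = 0" "\<phi> b = 0" using test_outside[OF \<phi>] by auto
  then show "L2_inner a b F ((deriv ^^ 1) \<phi>) = (- 1) ^ 1 * L2_inner a b f \<phi>"
    using acd_parts[OF assms acd_test[OF \<phi>]] by simp
qed

lemma acd_AE_cong: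
  assumes "acd a b F f" "g \<in> L2 a b" "AE x in leb a b. f x = g x" shows "acd a b F g"
proof (rule acdI[OF assms(2)])
  fix y assume y: "a \<le> y" "y \<le> b"
  have "L2_inner a y f (\<lambda>_. 1) = L2_inner a y g (\<lambda>_. 1)"
    using y assms acd_L2[OF assms(1)] by (intro L2_inner_cong_AE L2_const AE_leb_sub[of a a y b] L2_sub[of a a y b]) auto
  then show "F y = F a + (LINT s|leb a y. g s)"
    using acd_diff_eq[OF assms(1), of a y] y by (simp add: L2_inner_def)
qed

lemma acd_unique:
  assumes "a \<le> b" "acd a b F f" "acd a b F g" shows "AE x in leb a b. f x = g x"
  by (rule weak_deriv_unique[OF acd_is_weak_deriv[OF assms(1,2)] acd_is_weak_deriv[OF assms(1,3)]]) (intro assms(2,3)[THEN acd_L2])+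

lemma acd_weak_deriv:
  assumes "a \<le> b" "acd a b F f"
  shows "acd a b F (weak_deriv a b 1 F)" "AE x in leb a b. weak_deriv a b 1 F x = f x"
proof -
  note w = weak_deriv_spec[OF acd_is_weak_deriv[OF assms] acd_L2[OF assms(2)]]
  show "AE x in leb a b. weak_deriv a b 1 F x = f x" by (rule w)
  then have "AE x in leb a b. f x = weak_deriv a b 1 F x" by eventually_elim simp
  then show "acd a b F (weak_deriv a b 1 F)" by (rule acd_AE_cong[OF assms(2) w(1)])
qed

text \<open>The primitive of \<open>f - g\<close> vanishes identically; \<open>f - g\<close> being
  continuous, it is the derivative of this primitive at every point, end points included.\<close>

lemma continuous_AE_eq:
  fixes f g :: "real \<Rightarrow> real"
  assumes "a < b" "continuous_on {a..b} f" "continuous_on {a..b} g" "AE x in leb a b. f x = g x" "x \<in> {a..b}"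
  shows "f x = g x"
proof -
  have "continuous_on {a..b} (\<lambda>x. f x - g x)" by (intro continuous_intros assms)
  then have A: "acd a b (\<lambda>y. 0 + (LINT s|leb a y. f s - g s)) (\<lambda>x. f x - g x)"
    by (intro acd_integral L2_continuous)
  have z: "(LINT s|leb a y. f s - g s) = 0" if "y \<in> {a..b}" for y
  proof -
    have "L2_inner a y (\<lambda>s. f s - g s) (\<lambda>_. 1) = L2_inner a y (\<lambda>_. 0) (\<lambda>_. 1)"
    proof (intro L2_inner_cong_AE L2_const)
      have sub: "{a..y} \<subseteq> {a..b}" using that by auto
      show "(\<lambda>s. f s - g s) \<in> L2 a y"
        by (intro L2_continuous continuous_on_diff continuous_on_subset[OF assms(2) sub] continuous_on_subset[OF assms(3) sub])
      have "AE x in leb a y. f x = g x" by (rule AE_leb_sub[OF _ _ assms(4)]) (use that in auto)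
      then show "AE x in leb a y. f x - g x = 0" by eventually_elim simp
    qed auto
    then show ?thesis by (simp add: L2_inner_def)
  qed
  have *: "acd a b (\<lambda>_. 0) (\<lambda>x. f x - g x)" by (rule acd_cong[OF A]) (simp_all add: z)
  have "((\<lambda>_. 0) has_real_derivative f x - g x) (at x within {a..b})"
    by (rule acd_has_derivative[OF * _ assms(5)]) (intro continuous_on_diff assms)
  moreover have "((\<lambda>_. 0) has_real_derivative 0) (at x within {a..b})" by simp
  moreover have "at x within {a..b} \<noteq> bot" using assms(1,5) by (simp add: trivial_limit_within islimpt_Icc)
  ultimately have "f x - g x = 0"
    unfolding has_real_derivative_iff_has_vector_derivative by (rule vector_derivative_unique_within[rotated])
  then show ?thesis by simp
qed

section \<open>Completeness, weak derivatives and regularity\<close>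

text \<open>Fatou's lemma for the squares. It yields membership of the limit together with the
  bound, which is how a Cauchy estimate passes to the limit below.\<close>

lemma L2_fatou:
  assumes "\<And>n::nat. f n \<in> L2 a b" "\<And>n. L2_norm a b (f n) \<le> e" "AE x in leb a b. (\<lambda>n. f n x) \<longlonglongrightarrow> g x"
    and [measurable]: "g \<in> borel_measurable (leb a b)" and "0 \<le> e"
  shows "g \<in> L2 a b" "L2_norm a b g \<le> e"
proof -
  note [measurable] = L2_measurable[OF assms(1)]
  have int: "(\<integral>\<^sup>+x. ennreal ((f n x)\<^sup>2) \<partial>leb a b) \<le> ennreal (e\<^sup>2)" for n
  proof -
    have "(\<integral>\<^sup>+x. ennreal ((f n x)\<^sup>2) \<partial>leb a b) = ennreal (LINT x|leb a b. (f n x)\<^sup>2)"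
      using assms(1)[of n] by (intro nn_integral_eq_integral) (auto simp: L2_def)
    also have "(LINT x|leb a b. (f n x)\<^sup>2) = (L2_norm a b (f n))\<^sup>2"
      unfolding L2_norm_sq by (simp add: L2_inner_def power2_eq_square)
    also have "ennreal \<dots> \<le> ennreal (e\<^sup>2)"
      using assms(2)[of n] by (intro ennreal_leI power_mono) auto
    finally show ?thesis .
  qed
  have "(\<integral>\<^sup>+x. ennreal ((g x)\<^sup>2) \<partial>leb a b) = (\<integral>\<^sup>+x. liminf (\<lambda>n. ennreal ((f n x)\<^sup>2)) \<partial>leb a b)"
  proof (rule nn_integral_cong_AE)
    show "AE x in leb a b. ennreal ((g x)\<^sup>2) = liminf (\<lambda>n. ennreal ((f n x)\<^sup>2))"
      using assms(3)
    proof eventually_elim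
      fix x assume "(\<lambda>n. f n x) \<longlonglongrightarrow> g x"
      then have "(\<lambda>n. ennreal ((f n x)\<^sup>2)) \<longlonglongrightarrow> ennreal ((g x)\<^sup>2)" by (intro tendsto_ennrealI tendsto_power)
      then show "ennreal ((g x)\<^sup>2) = liminf (\<lambda>n. ennreal ((f n x)\<^sup>2))"
        by (intro lim_imp_Liminf[symmetric]) simp_all
    qed
  qed
  also have "\<dots> \<le> liminf (\<lambda>n. \<integral>\<^sup>+x. ennreal ((f n x)\<^sup>2) \<partial>leb a b)"
    by (rule nn_integral_liminf) measurable
  also have "\<dots> \<le> liminf (\<lambda>n::nat. ennreal (e\<^sup>2))"
    by (intro Liminf_mono always_eventually allI int)
  also have "\<dots> = ennreal (e\<^sup>2)" by (simp add: Liminf_const)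
  finally have *: "(\<integral>\<^sup>+x. ennreal ((g x)\<^sup>2) \<partial>leb a b) \<le> ennreal (e\<^sup>2)" .
  then have g2: "integrable (leb a b) (\<lambda>x. (g x)\<^sup>2)"
    by (intro integrableI_nonneg) (auto intro: le_less_trans)
  then show "g \<in> L2 a b" by (simp add: L2_def)
  have "ennreal (LINT x|leb a b. (g x)\<^sup>2) \<le> ennreal (e\<^sup>2)"
    using * by (subst (asm) nn_integral_eq_integral[OF g2]) auto
  then have "(L2_norm a b g)\<^sup>2 \<le> e\<^sup>2"
    unfolding L2_norm_sq by (simp add: L2_inner_def power2_eq_square)
  then show "L2_norm a b g \<le> e" using assms(5) by (rule power2_le_imp_le)
qed

text \<open>On a bounded interval the \<open>L\<^sub>1\<close> norms of the increments are
  controlled by their \<open>L\<^sub>2\<close> norms, hence summable; so the telescoping series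
  converges absolutely almost everywhere.\<close>

lemma L2_fast_Cauchy_AE_convergent:
  assumes "\<And>k::nat. u k \<in> L2 a b" "a \<le> b" "\<And>k. L2_norm a b (\<lambda>x. u (Suc k) x - u k x) \<le> (1 / 2) ^ k"
  shows "AE x in leb a b. convergent (\<lambda>k. u k x)"
proof -
  define d where "d k = (\<lambda>x. u (Suc k) x - u k x)" for k
  have d: "d k \<in> L2 a b" for k unfolding d_def by (intro L2_diff assms)
  note [measurable] = L2_measurable[OF d]
  have I: "(\<integral>\<^sup>+x. ennreal \<bar>d k x\<bar> \<partial>leb a b) \<le> ennreal (sqrt (b - a) * (1 / 2) ^ k)" for k
  proof -
    have absd: "(\<lambda>x. \<bar>d k x\<bar>) \<in> L2 a b" using d[of k] by (auto simp: L2_def)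
    have "(\<integral>\<^sup>+x. ennreal \<bar>d k x\<bar> \<partial>leb a b) = ennreal (LINT x|leb a b. \<bar>d k x\<bar>)"
      by (intro nn_integral_eq_integral L2_integrable absd) auto
    also have "(LINT x|leb a b. \<bar>d k x\<bar>) \<le> sqrt (b - a) * L2_norm a b (\<lambda>x. \<bar>d k x\<bar>)"
      using abs_LINT_le_L2[OF assms(2) absd] by simp
    also have "L2_norm a b (\<lambda>x. \<bar>d k x\<bar>) = L2_norm a b (d k)" by (simp add: L2_norm_def L2_inner_def)
    also have "sqrt (b - a) * L2_norm a b (d k) \<le> sqrt (b - a) * (1 / 2) ^ k"
      using assms by (intro mult_left_mono) (auto simp: d_def)
    finally show ?thesis by (simp add: ennreal_leI)
  qed
  have "summable (\<lambda>k. sqrt (b - a) * (1 / 2 :: real) ^ k)" by (intro summable_mult summable_geometric) simp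
  then have fin: "(\<Sum>k. ennreal (sqrt (b - a) * (1 / 2) ^ k)) \<noteq> \<infinity>"
    using assms(2) by (subst suminf_ennreal_eq[OF _ summable_sums]) auto
  have "(\<integral>\<^sup>+x. (\<Sum>k. ennreal \<bar>d k x\<bar>) \<partial>leb a b) = (\<Sum>k. \<integral>\<^sup>+x. ennreal \<bar>d k x\<bar> \<partial>leb a b)"
    by (intro nn_integral_suminf) measurable
  also have "\<dots> \<le> (\<Sum>k. ennreal (sqrt (b - a) * (1 / 2) ^ k))" by (intro suminf_le I) auto
  finally have "(\<integral>\<^sup>+x. (\<Sum>k. ennreal \<bar>d k x\<bar>) \<partial>leb a b) \<noteq> \<infinity>" using fin by (auto simp: top_unique)
  then have "AE x in leb a b. (\<Sum>k. ennreal \<bar>d k x\<bar>) \<noteq> \<infinity>"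
    by (intro nn_integral_PInf_AE) measurable
  then show ?thesis
  proof eventually_elim
    fix x assume "(\<Sum>k. ennreal \<bar>d k x\<bar>) \<noteq> \<infinity>"
    then have "summable (\<lambda>k. \<bar>d k x\<bar>)" by (intro summable_suminf_not_top) auto
    then have "summable (\<lambda>k. d k x)" by (rule summable_rabs_cancel)
    then have "convergent (\<lambda>n. \<Sum>k<n. d k x)" by (simp add: summable_iff_convergent)
    moreover have "(\<Sum>k<n. d k x) = u n x - u 0 x" for n
      unfolding d_def by (rule sum_lessThan_telescope)
    ultimately have "convergent (\<lambda>n. u n x - u 0 x)" by simp
    then show "convergent (\<lambda>n. u n x)" by (simp add: convergent_diff_const_right_iff)
  qed
qed

text \<open>Riesz-Fischer: the almost everywhere limit of a fast subsequence is also the limit in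
  norm, by \<open>L2_fatou\<close> applied to differences.\<close>

lemma L2_complete:
  assumes u: "\<And>n::nat. u n \<in> L2 a b" and ab: "a \<le> b"
    and Cauchy: "\<And>e. 0 < e \<Longrightarrow> \<exists>N. \<forall>m\<ge>N. \<forall>n\<ge>N. L2_norm a b (\<lambda>x. u m x - u n x) < e"
  shows "\<exists>w\<in>L2 a b. (\<lambda>n. L2_norm a b (\<lambda>x. u n x - w x)) \<longlonglongrightarrow> 0"
proof -
  have "\<exists>N. \<forall>m\<ge>N. \<forall>n\<ge>N. L2_norm a b (\<lambda>x. u m x - u n x) < (1 / 2) ^ k" for k :: nat
    by (rule Cauchy) simp
  then obtain N where N: "\<And>k m n. N k \<le> m \<Longrightarrow> N k \<le> n \<Longrightarrow> L2_norm a b (\<lambda>x. u m x - u n x) < (1 / 2) ^ k"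
    by metis
  \<comment> \<open>The partial sums exceed every earlier threshold, although \<open>N\<close> need
    not be monotone.\<close>
  define r where "r k = (\<Sum>i\<le>k. N i)" for k
  have r: "N k \<le> r k" "N k \<le> r (Suc k)" for k unfolding r_def by (auto intro: member_le_sum trans_le_add1)
  have r': "N j \<le> r k" if "j \<le> k" for j k unfolding r_def using that by (intro member_le_sum) auto
  define w where "w x = lim (\<lambda>k. u (r k) x)" for x
  note [measurable] = L2_measurable[OF u]
  have w[measurable]: "w \<in> borel_measurable (leb a b)"
    unfolding w_def by (rule borel_measurable_lim_metric) measurable
  have "AE x in leb a b. convergent (\<lambda>k. u (r k) x)"
    by (rule L2_fast_Cauchy_AE_convergent[OF u ab]) (intro less_imp_le N r)
  then have conv: "AE x in leb a b. (\<lambda>k. u (r k) x) \<longlonglongrightarrow> w x"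
    unfolding w_def by eventually_elim (simp add: convergent_LIMSEQ_iff)
  have est: "(\<lambda>x. u n x - w x) \<in> L2 a b \<and> L2_norm a b (\<lambda>x. u n x - w x) \<le> (1 / 2) ^ j" if "N j \<le> n" for n j
  proof -
    have 1: "(\<lambda>x. u n x - u (r (k + j)) x) \<in> L2 a b" for k by (intro L2_diff u)
    have 2: "L2_norm a b (\<lambda>x. u n x - u (r (k + j)) x) \<le> (1 / 2) ^ j" for k
      by (rule less_imp_le[OF N[OF that r']]) simp
    have 3: "AE x in leb a b. (\<lambda>k. u n x - u (r (k + j)) x) \<longlonglongrightarrow> u n x - w x"
      using conv by eventually_elim (intro tendsto_intros, erule LIMSEQ_ignore_initial_segment)
    show ?thesis using L2_fatou[OF 1 2 3] by simp
  qed
  have "(\<lambda>x. u (N 0) x - (u (N 0) x - w x)) \<in> L2 a b"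
    by (intro L2_diff u est[THEN conjunct1]) (rule order_refl)
  then have wL2: "w \<in> L2 a b" by simp
  have "(\<lambda>n. L2_norm a b (\<lambda>x. u n x - w x)) \<longlonglongrightarrow> 0"
  proof (rule LIMSEQ_I)
    fix e :: real assume "0 < e"
    then obtain j where j: "(1 / 2 :: real) ^ j < e" using real_arch_pow_inv[of e "1/2"] by auto
    show "\<exists>no. \<forall>n\<ge>no. norm (L2_norm a b (\<lambda>x. u n x - w x) - 0) < e"
      using est j by (intro exI[where x="N j"]) fastforce
  qed
  then show ?thesis using wL2 by blast
qed

section \<open>Riesz representation and weak derivatives\<close>

lemma L2_inner_tendsto:
  assumes "\<And>n::nat. u n \<in> L2 a b" "w \<in> L2 a b" "z \<in> L2 a b" "(\<lambda>n. L2_norm a b (\<lambda>x. u n x - w x)) \<longlonglongrightarrow> 0"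
  shows "(\<lambda>n. L2_inner a b (u n) z) \<longlonglongrightarrow> L2_inner a b w z"
proof -
  have "(\<lambda>n. L2_inner a b (u n) z - L2_inner a b w z) \<longlonglongrightarrow> 0"
  proof (rule Lim_null_comparison)
    show "\<forall>\<^sub>F n in sequentially. norm (L2_inner a b (u n) z - L2_inner a b w z) \<le> L2_norm a b (\<lambda>x. u n x - w x) * L2_norm a b z"
      using L2_Cauchy_Schwarz[OF L2_diff[OF assms(1,2)] assms(3)]
      by (intro always_eventually allI) (simp add: L2_inner_diff_left assms)
    show "(\<lambda>n. L2_norm a b (\<lambda>x. u n x - w x) * L2_norm a b z) \<longlonglongrightarrow> 0"
      using tendsto_mult_right[OF assms(4), of "L2_norm a b z"] by simp
  qed
  then show ?thesis by (simp add: LIM_zero_iff)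
qed

lemma L2_norm_triangle_rev:
  assumes "u \<in> L2 a b" "w \<in> L2 a b"
  shows "\<bar>L2_norm a b u - L2_norm a b w\<bar> \<le> L2_norm a b (\<lambda>x. u x - w x)"
  using L2_norm_triangle[OF L2_diff[OF assms] assms(2)] L2_norm_triangle[OF L2_diff[OF assms(2,1)] assms(1)]
    L2_norm_minus_commute[of a b u w] by simp

lemma L2_norm_tendsto:
  assumes "\<And>n::nat. u n \<in> L2 a b" "w \<in> L2 a b" "(\<lambda>n. L2_norm a b (\<lambda>x. u n x - w x)) \<longlonglongrightarrow> 0"
  shows "(\<lambda>n. L2_norm a b (u n)) \<longlonglongrightarrow> L2_norm a b w"
proof -
  have "(\<lambda>n. L2_norm a b (u n) - L2_norm a b w) \<longlonglongrightarrow> 0"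
    by (rule Lim_null_comparison[OF _ assms(3)]) (use L2_norm_triangle_rev[OF assms(1,2)] in simp)
  then show ?thesis by (simp add: LIM_zero_iff)
qed

text \<open>The representing element is the maximiser of \<open>2 F \<phi> - \<parallel>\<phi>\<parallel>\<^sup>2\<close>: by the parallelogram law a
  maximising sequence is Cauchy.\<close>

lemma L2_riesz:
  assumes ab: "a \<le> b" and D: "D \<subseteq> L2 a b" "(\<lambda>_. 0) \<in> D"
    and Dadd: "\<And>\<phi> \<psi>. \<phi> \<in> D \<Longrightarrow> \<psi> \<in> D \<Longrightarrow> (\<lambda>x. \<phi> x + \<psi> x) \<in> D"
    and Dcm: "\<And>c \<phi>. \<phi> \<in> D \<Longrightarrow> (\<lambda>x. c * \<phi> x) \<in> D"
    and Fadd: "\<And>\<phi> \<psi>. \<phi> \<in> D \<Longrightarrow> \<psi> \<in> D \<Longrightarrow> F (\<lambda>x. \<phi> x + \<psi> x) = F \<phi> + F \<psi>"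
    and Fcm: "\<And>c \<phi>. \<phi> \<in> D \<Longrightarrow> F (\<lambda>x. c * \<phi> x) = c * F \<phi>"
    and bound: "\<And>\<phi>. \<phi> \<in> D \<Longrightarrow> \<bar>F \<phi>\<bar> \<le> R * L2_norm a b \<phi>" and R: "0 \<le> R"
  shows "\<exists>w\<in>L2 a b. L2_norm a b w \<le> R \<and> (\<forall>\<phi>\<in>D. F \<phi> = L2_inner a b w \<phi>)"
proof -
  let ?N = "L2_norm a b" and ?I = "L2_inner a b"
  define J where "J \<phi> = 2 * F \<phi> - ?I \<phi> \<phi>" for \<phi>
  have DL: "\<phi> \<in> L2 a b" if "\<phi> \<in> D" for \<phi> using D that by blast
  have expand: "?I (\<lambda>x. \<phi> x + c * \<psi> x) (\<lambda>x. \<phi> x + c * \<psi> x) = ?I \<phi> \<phi> + 2 * c * ?I \<phi> \<psi> + c\<^sup>2 * ?I \<psi> \<psi>"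
    if "\<phi> \<in> L2 a b" "\<psi> \<in> L2 a b" for \<phi> \<psi> c
    using that L2_cmult[OF that(2), of c] L2_inner_commute[of a b \<psi> \<phi>]
    by (simp add: L2_inner_add_left L2_inner_add_right L2_add L2_inner_cmult_left L2_inner_cmult_right power2_eq_square algebra_simps)
  have Jexp: "J (\<lambda>x. \<phi> x + c * \<psi> x) = J \<phi> + 2 * c * (F \<psi> - ?I \<phi> \<psi>) - c\<^sup>2 * ?I \<psi> \<psi>"
    if "\<phi> \<in> D" "\<psi> \<in> D" for \<phi> \<psi> c
    unfolding J_def expand[OF DL[OF that(1)] DL[OF that(2)]] Fadd[OF that(1) Dcm[OF that(2)]] Fcm[OF that(2)]
    by (simp add: algebra_simps)
  have Jbound: "J \<phi> \<le> R\<^sup>2" if "\<phi> \<in> D" for \<phi>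
  proof -
    have "J \<phi> \<le> 2 * (R * ?N \<phi>) - (?N \<phi>)\<^sup>2" using bound[OF that] unfolding J_def L2_norm_sq by linarith
    also have "\<dots> \<le> R\<^sup>2" using zero_le_power2[of "R - ?N \<phi>"] by (simp add: power2_diff)
    finally show ?thesis .
  qed
  define S where "S = (SUP \<phi>\<in>D. J \<phi>)"
  have bdd: "bdd_above (J ` D)" using Jbound by (intro bdd_aboveI2)
  have JS: "J \<phi> \<le> S" if "\<phi> \<in> D" for \<phi> unfolding S_def using that bdd by (rule cSUP_upper)
  have "\<exists>\<phi>\<in>D. S - 1 / real (Suc n) < J \<phi>" for n
  proof -
    have "S - 1 / real (Suc n) < S" by simp
    then show ?thesis unfolding S_def using less_cSUP_iff[OF _ bdd] D(2) by blast
  qed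
  then obtain \<phi> where \<phi>: "\<And>n. \<phi> n \<in> D" "\<And>n. S - 1 / real (Suc n) < J (\<phi> n)" by metis
  \<comment> \<open>The midpoint of \<open>f\<close> and \<open>g\<close> is admissible, so
    \<open>J\<close> is at most \<open>S\<close> there; the parallelogram law converts the gap into
    a distance.\<close>
  have par: "(?N (\<lambda>x. f x - g x))\<^sup>2 \<le> 4 * S - 2 * J f - 2 * J g" if "f \<in> D" "g \<in> D" for f g
  proof -
    have h: "(\<lambda>x. (1/2) * f x) \<in> D" by (rule Dcm[OF that(1)])
    have "J (\<lambda>x. (1/2) * f x + (1/2) * g x) \<le> S" by (intro JS Dadd Dcm that)
    moreover have "J (\<lambda>x. (1/2) * f x) = F f - ?I f f / 4"
      unfolding J_def Fcm[OF that(1)] L2_inner_cmult_left L2_inner_cmult_right by simp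
    moreover have "?I (\<lambda>x. (1/2) * f x) g = ?I f g / 2" unfolding L2_inner_cmult_left by simp
    moreover have "(?N (\<lambda>x. f x - g x))\<^sup>2 = ?I f f - 2 * ?I f g + ?I g g"
      unfolding L2_norm_sq using expand[OF DL[OF that(1)] DL[OF that(2)], of "-1"] by simp
    ultimately show ?thesis using Jexp[OF h that(2), of "1/2"] unfolding J_def by (simp add: power2_eq_square)
  qed
  have "\<exists>w\<in>L2 a b. (\<lambda>n. ?N (\<lambda>x. \<phi> n x - w x)) \<longlonglongrightarrow> 0"
  proof (rule L2_complete[OF DL[OF \<phi>(1)] ab])
    fix e :: real assume e: "0 < e"
    obtain N where N: "4 / e\<^sup>2 < real N" by (rule exE[OF reals_Archimedean2])
    have "?N (\<lambda>x. \<phi> m x - \<phi> n x) < e" if "N \<le> m" "N \<le> n" for m n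
    proof -
      have *: "1 / real (Suc j) < e\<^sup>2 / 4" if "N \<le> j" for j
      proof -
        have "4 / e\<^sup>2 < real (Suc j)" using N that by linarith
        then show ?thesis using e by (simp add: field_simps)
      qed
      have "(?N (\<lambda>x. \<phi> m x - \<phi> n x))\<^sup>2 \<le> 4 * S - 2 * J (\<phi> m) - 2 * J (\<phi> n)" by (intro par \<phi>)
      also have "\<dots> < e\<^sup>2" using \<phi>(2)[of m] \<phi>(2)[of n] *[OF that(1)] *[OF that(2)] by linarith
      finally show ?thesis using e by (simp add: power2_less_imp_less)
    qed
    then show "\<exists>N. \<forall>m\<ge>N. \<forall>n\<ge>N. ?N (\<lambda>x. \<phi> m x - \<phi> n x) < e" by blast
  qed
  then obtain w where w: "w \<in> L2 a b" "(\<lambda>n. ?N (\<lambda>x. \<phi> n x - w x)) \<longlonglongrightarrow> 0" by blast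
  have rep: "F \<psi> = ?I w \<psi>" if \<psi>: "\<psi> \<in> D" for \<psi>
  proof -
    \<comment> \<open>Moving the \<open>n\<close>-th element of the maximising sequence by
      \<open>c * \<psi>\<close> can raise \<open>J\<close> by less than
      \<open>1 / real (Suc n)\<close>.\<close>
    have ineq: "2 * c * (F \<psi> - ?I w \<psi>) \<le> c\<^sup>2 * ?I \<psi> \<psi>" for c
    proof (rule LIMSEQ_le)
      show "(\<lambda>n. 2 * c * (F \<psi> - ?I (\<phi> n) \<psi>)) \<longlonglongrightarrow> 2 * c * (F \<psi> - ?I w \<psi>)"
        by (intro tendsto_intros L2_inner_tendsto[OF DL[OF \<phi>(1)] w(1) DL[OF \<psi>] w(2)])
      show "(\<lambda>n. c\<^sup>2 * ?I \<psi> \<psi> + 1 / real (Suc n)) \<longlonglongrightarrow> c\<^sup>2 * ?I \<psi> \<psi>"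
        using tendsto_add[OF tendsto_const LIMSEQ_inverse_real_of_nat] by (simp add: inverse_eq_divide)
      have "2 * c * (F \<psi> - ?I (\<phi> n) \<psi>) \<le> c\<^sup>2 * ?I \<psi> \<psi> + 1 / real (Suc n)" for n
        using JS[OF Dadd[OF \<phi>(1)[of n] Dcm[OF \<psi>, of c]]] \<phi>(2)[of n] Jexp[OF \<phi>(1)[of n] \<psi>, of c] by linarith
      then show "\<exists>N. \<forall>n\<ge>N. 2 * c * (F \<psi> - ?I (\<phi> n) \<psi>) \<le> c\<^sup>2 * ?I \<psi> \<psi> + 1 / real (Suc n)" by blast
    qed
    define d where "d = F \<psi> - ?I w \<psi>"
    define q where "q = ?I \<psi> \<psi>"
    have q: "0 \<le> q" unfolding q_def by (rule L2_inner_self_nonneg)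
    \<comment> \<open>Up to the summand 1, which covers \<open>q = 0\<close>, this is the
      \<open>c\<close> that violates the inequality most.\<close>
    define c where "c = d / (q + 1)"
    have d: "d = c * (q + 1)" using q by (simp add: c_def)
    have "2 * c * d \<le> c\<^sup>2 * q" using ineq[of c] by (simp add: d_def q_def)
    moreover have "2 * c * d = 2 * (c\<^sup>2 * q) + 2 * c\<^sup>2" unfolding d by (simp add: power2_eq_square algebra_simps)
    moreover have "0 \<le> c\<^sup>2 * q" using q by simp
    ultimately have "c\<^sup>2 \<le> 0" by linarith
    then have "d = 0" unfolding d by simp
    then show ?thesis by (simp add: d_def)
  qed
  have "?I w w \<le> R * ?N w"
  proof (rule LIMSEQ_le)
    show "(\<lambda>n. ?I (\<phi> n) w) \<longlonglongrightarrow> ?I w w" by (rule L2_inner_tendsto[OF DL[OF \<phi>(1)] w(1) w(1) w(2)])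
    show "(\<lambda>n. R * ?N (\<phi> n)) \<longlonglongrightarrow> R * ?N w" by (intro tendsto_intros L2_norm_tendsto[OF DL[OF \<phi>(1)] w])
    have "?I (\<phi> n) w \<le> R * ?N (\<phi> n)" for n
      using rep[OF \<phi>(1)[of n]] bound[OF \<phi>(1)[of n]] L2_inner_commute[of a b "\<phi> n" w] by linarith
    then show "\<exists>N. \<forall>n\<ge>N. ?I (\<phi> n) w \<le> R * ?N (\<phi> n)" by blast
  qed
  then have "?N w * ?N w \<le> R * ?N w" by (simp add: L2_norm_sq[symmetric] power2_eq_square)
  then have "?N w \<le> R" using R L2_norm_nonneg[of a b w]
    by (cases "?N w = 0") (auto simp: mult_le_cancel_right)
  then show ?thesis using w(1) rep by blast
qed

text \<open>Integration by parts read backwards: the functional sending \<open>\<phi>\<close> to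
  \<open>(-1) ^ m\<close> times the left-hand inner product is bounded in \<open>L\<^sub>2\<close>,
  and its representing element is the weak derivative, norm bound included.\<close>

lemma weak_deriv_of_bound:
  assumes "a \<le> b" "u \<in> L2 a b" "0 \<le> R"
    "\<And>\<phi>. \<phi> \<in> test_functions a b \<Longrightarrow> \<bar>L2_inner a b u ((deriv ^^ m) \<phi>)\<bar> \<le> R * L2_norm a b \<phi>"
  shows "\<exists>w\<in>L2 a b. L2_norm a b w \<le> R \<and> is_weak_deriv a b m u w"
proof -
  define F where "F \<phi> = (-1) ^ m * L2_inner a b u ((deriv ^^ m) \<phi>)" for \<phi>
  have tL: "(deriv ^^ m) \<phi> \<in> L2 a b" if "\<phi> \<in> test_functions a b" for \<phi> by (intro test_L2[OF test_deriv_iter[OF that]])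
  have "\<exists>w\<in>L2 a b. L2_norm a b w \<le> R \<and> (\<forall>\<phi>\<in>test_functions a b. F \<phi> = L2_inner a b w \<phi>)"
  proof (rule L2_riesz[OF assms(1) _ test_zero test_add test_cmult])
    show "test_functions a b \<subseteq> L2 a b" using test_L2 by blast
    show "F (\<lambda>x. \<phi> x + \<psi> x) = F \<phi> + F \<psi>" if "\<phi> \<in> test_functions a b" "\<psi> \<in> test_functions a b" for \<phi> \<psi>
      unfolding F_def using that
      by (simp add: deriv_iter_add[OF test_smooth[OF that(1)] test_smooth[OF that(2)]] L2_inner_add_right tL assms distrib_left)
    show "F (\<lambda>x. c * \<phi> x) = c * F \<phi>" if "\<phi> \<in> test_functions a b" for c \<phi>
      unfolding F_def by (simp add: deriv_iter_cmult[OF test_smooth[OF that]] L2_inner_cmult_right)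
    show "\<bar>F \<phi>\<bar> \<le> R * L2_norm a b \<phi>" if "\<phi> \<in> test_functions a b" for \<phi>
      using assms(4)[OF that] by (simp add: F_def abs_mult power_abs)
  qed (use assms in auto)
  then obtain w where w: "w \<in> L2 a b" "L2_norm a b w \<le> R" "\<And>\<phi>. \<phi> \<in> test_functions a b \<Longrightarrow> F \<phi> = L2_inner a b w \<phi>" by blast
  have "is_weak_deriv a b m u w" unfolding is_weak_deriv_def
  proof
    fix \<phi> assume "\<phi> \<in> test_functions a b"
    from w(3)[OF this] show "L2_inner a b u ((deriv ^^ m) \<phi>) = (-1) ^ m * L2_inner a b w \<phi>"
      unfolding F_def by (cases "even m") auto
  qed
  then show ?thesis using w by blast
qed

text \<open>Otherwise the constant 1 would be orthogonal to all test functions.\<close>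

lemma test_normalized_exists:
  assumes "a < b" shows "\<exists>\<psi>\<in>test_functions a b. (LINT x|leb a b. \<psi> x) = 1"
proof -
  have "\<exists>\<psi>\<in>test_functions a b. (LINT x|leb a b. \<psi> x) \<noteq> 0"
  proof (rule ccontr)
    assume "\<not> ?thesis"
    then have "L2_inner a b (\<lambda>_. 1) \<phi> = 0" if "\<phi> \<in> test_functions a b" for \<phi> using that by (auto simp: L2_inner_def)
    then have "AE x in leb a b. (1::real) = 0" by (rule fundamental_lemma[OF L2_integrable[OF L2_const]])
    then have "L2_norm a b (\<lambda>_. 1) = L2_norm a b (\<lambda>_. 0)" by (intro L2_norm_cong_AE L2_const)
    then show False using assms by (simp add: L2_norm_const)
  qed
  then obtain \<psi> where \<psi>: "\<psi> \<in> test_functions a b" "(LINT x|leb a b. \<psi> x) \<noteq> 0" by blast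
  show ?thesis
    by (rule bexI[OF _ test_cmult[OF \<psi>(1), of "1 / (LINT x|leb a b. \<psi> x)"]]) (use \<psi>(2) in simp)
qed

text \<open>Every test function is a multiple of a fixed one of integral 1 plus a derivative of a test
  function.  Hence, lowering the order by one, the weak derivative becomes a primitive of \<open>w\<close> with a
  suitable constant.\<close>

lemma weak_deriv_chain:
  assumes "a < b" "u \<in> L2 a b" "w \<in> L2 a b" "is_weak_deriv a b m u w"
  shows "\<exists>D. (AE x in leb a b. u x = D 0 x) \<and> D m = w \<and> (\<forall>j<m. acd a b (D j) (D (Suc j)))"
  using assms(3,4)
proof (induction m arbitrary: w)
  case 0
  have "AE x in leb a b. u x = w x"
  proof (rule weak_deriv_unique[OF _ 0(2) assms(2) 0(1)])
    show "is_weak_deriv a b 0 u u" by (simp add: is_weak_deriv_def)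
  qed
  then show ?case by (intro exI[where x="\<lambda>_. w"]) simp
next
  case (Suc m)
  let ?I = "L2_inner a b"
  obtain \<psi> where \<psi>: "\<psi> \<in> test_functions a b" "(LINT x|leb a b. \<psi> x) = 1" using test_normalized_exists[OF assms(1)] by blast
  define w1 where "w1 y = (LINT s|leb a y. w s)" for y
  have w1: "acd a b w1 w" using acd_integral[OF Suc.prems(1), of 0] unfolding w1_def by simp
  \<comment> \<open>Testing with \<open>\<psi>\<close>, whose integral is 1, determines the constant
    of integration.\<close>
  define K where "K = (-1) ^ m * ?I u ((deriv ^^ m) \<psi>) - ?I w1 \<psi>"
  define w' where "w' y = w1 y + K" for y
  have w': "acd a b w' w" using acd_add[OF w1 acd_const[of a b K]] unfolding w'_def by simp
  note L2 = acd_L2_fun[OF w1] acd_L2_fun[OF w']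
  have "is_weak_deriv a b m u w'" unfolding is_weak_deriv_def
  proof
    fix \<eta> assume \<eta>: "\<eta> \<in> test_functions a b"
    define c where "c = (LINT x|leb a b. \<eta> x)"
    have c\<psi>: "(\<lambda>x. c * \<psi> x) \<in> test_functions a b" by (rule test_cmult[OF \<psi>(1)])
    have "(LINT x|leb a b. \<eta> x - c * \<psi> x) = 0"
      using L2_integrable[OF test_L2[OF \<eta>]] L2_integrable[OF test_L2[OF c\<psi>]] \<psi>(2) by (simp add: c_def)
    then obtain \<phi> where \<phi>: "\<phi> \<in> test_functions a b" "deriv \<phi> = (\<lambda>x. \<eta> x - c * \<psi> x)"
      using test_antideriv[OF test_diff[OF \<eta> c\<psi>] assms(1)] by blast
    have "?I u ((deriv ^^ m) (\<lambda>x. \<eta> x - c * \<psi> x)) = (-1) ^ Suc m * ?I w \<phi>"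
      using Suc.prems(2) \<phi> unfolding is_weak_deriv_def by (metis comp_apply funpow_Suc_right)
    also have "?I w \<phi> = - ?I w1 (\<lambda>x. \<eta> x - c * \<psi> x)"
      using bspec[OF acd_is_weak_deriv[OF less_imp_le[OF assms(1)] w1, unfolded is_weak_deriv_def] \<phi>(1)] \<phi>(2) by simp
    also have "?I w1 (\<lambda>x. \<eta> x - c * \<psi> x) = ?I w1 \<eta> - c * ?I w1 \<psi>"
      using L2_inner_diff_right[OF test_L2[OF \<eta>] test_L2[OF c\<psi>] L2(1)] by (simp add: L2_inner_cmult_right)
    finally have 1: "?I u ((deriv ^^ m) (\<lambda>x. \<eta> x - c * \<psi> x)) = (-1) ^ m * (?I w1 \<eta> - c * ?I w1 \<psi>)"
      by (simp add: algebra_simps)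
    have "?I u ((deriv ^^ m) (\<lambda>x. \<eta> x - c * \<psi> x)) = ?I u (\<lambda>x. (deriv ^^ m) \<eta> x - c * (deriv ^^ m) \<psi> x)"
      using deriv_iter_diff[OF test_smooth[OF \<eta>] test_smooth[OF c\<psi>], of m] deriv_iter_cmult[OF test_smooth[OF \<psi>(1)], of m c] by simp
    also have "\<dots> = ?I u ((deriv ^^ m) \<eta>) - c * ?I u ((deriv ^^ m) \<psi>)"
      using L2_inner_diff_right[OF test_L2[OF test_deriv_iter[OF \<eta>]] L2_cmult[OF test_L2[OF test_deriv_iter[OF \<psi>(1)]]] assms(2)]
      by (simp add: L2_inner_cmult_right)
    finally have 2: "?I u ((deriv ^^ m) \<eta>) = (-1) ^ m * (?I w1 \<eta> - c * ?I w1 \<psi>) + c * ?I u ((deriv ^^ m) \<psi>)" using 1 by simp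
    have "?I w' \<eta> = ?I w1 \<eta> + K * c"
      using L2_inner_add_left[OF L2(1) L2_const[of K] test_L2[OF \<eta>]] by (simp add: w'_def[abs_def] L2_inner_def c_def)
    then show "?I u ((deriv ^^ m) \<eta>) = (-1) ^ m * ?I w' \<eta>"
      unfolding 2 K_def by (cases "even m") (simp_all add: algebra_simps)
  qed
  from Suc.IH[OF L2(2) this] obtain D where D: "AE x in leb a b. u x = D 0 x" "D m = w'" "\<And>j. j < m \<Longrightarrow> acd a b (D j) (D (Suc j))"
    by blast
  have "acd a b ((D(Suc m := w)) j) ((D(Suc m := w)) (Suc j))" if "j < Suc m" for j
    using that D(2) D(3)[of j] w' by (cases "j = m") auto
  then show ?case using D(1) by (intro exI[where x="D(Suc m := w)"]) auto
qed

section \<open>Finite elements, Ritz projection and interpolation\<close>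

lemma poly_antideriv_exists:
  fixes q :: "real poly"
  shows "\<exists>p. pderiv p = q \<and> poly p c = e \<and> degree p \<le> Suc (degree q)"
proof -
  define p0 where "p0 = (\<Sum>i\<le>degree q. monom (coeff q i / real (Suc i)) (Suc i))"
  have pd: "pderiv (sum f A) = (\<Sum>i\<in>A. pderiv (f i))" for f :: "nat \<Rightarrow> real poly" and A
    by (induction A rule: infinite_finite_induct) (auto simp: pderiv_add)
  have "pderiv p0 = (\<Sum>i\<le>degree q. monom (coeff q i) i)"
    unfolding p0_def pd by (intro sum.cong) (auto simp: pderiv_monom)
  then have 1: "pderiv p0 = q" by (simp add: poly_as_sum_of_monoms)
  have 2: "degree p0 \<le> Suc (degree q)"
    unfolding p0_def by (intro degree_sum_le) (auto intro: order_trans[OF degree_monom_le])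
  have "pderiv (p0 + [:e - poly p0 c:]) = q" using 1 by (simp add: pderiv_add pderiv_pCons)
  moreover have "degree (p0 + [:e - poly p0 c:]) \<le> Suc (degree q)" using 2 by (intro degree_add_le) auto
  ultimately show ?thesis by (intro exI[where x="p0 + [:e - poly p0 c:]"]) auto
qed

lemma pderiv_iter_eq_0: "degree p \<le> n \<Longrightarrow> (pderiv ^^ Suc n) p = (0 :: real poly)"
proof (induction n arbitrary: p)
  case 0
  then show ?case by (simp add: pderiv_eq_0_iff)
next
  case (Suc n)
  have "(pderiv ^^ Suc n) (pderiv p) = 0" using Suc.prems by (intro Suc.IH) (simp add: degree_pderiv)
  then show ?case by (simp only: funpow_Suc_right comp_apply)
qed

lemma acd_poly: "acd a b (poly p) (poly (pderiv p))"
  by (rule acd_DERIV) (auto intro: has_field_derivative_at_within poly_DERIV continuous_on_poly)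

lemma acd_poly_iter: "acd a b (poly ((pderiv ^^ j) p)) (poly ((pderiv ^^ Suc j) p))"
  using acd_poly[of a b "(pderiv ^^ j) p"] by simp

lemma poly_L2: "poly p \<in> L2 a b"
  by (rule acd_L2_fun[OF acd_poly])

lemma L2_norm_eq_0_inner:
  assumes "u \<in> L2 a b" "w \<in> L2 a b" "L2_inner a b w w = 0" shows "L2_inner a b u w = 0"
  using L2_Cauchy_Schwarz[OF assms(1,2)] assms(3) by (simp add: L2_norm_def)

text \<open>One Gram-Schmidt step per degree: the induction hypothesis for the monomial of degree
  \<open>Suc n\<close> yields a monic polynomial \<open>r\<close> orthogonal to all lower degrees,
  and the projection of \<open>f\<close> is corrected along \<open>r\<close>.\<close>

lemma poly_L2_projection:
  assumes "c < d"
  shows "f \<in> L2 c d \<Longrightarrow> \<exists>q. degree q \<le> n \<and> (\<forall>p. degree p \<le> n \<longrightarrow> L2_inner c d (\<lambda>y. f y - poly q y) (poly p) = 0)"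
proof (induction n arbitrary: f)
  case 0
  define e where "e = (LINT x|leb c d. f x) / (d - c)"
  have "L2_inner c d (\<lambda>y. f y - poly [:e:] y) (poly p) = 0" if "degree p \<le> 0" for p
  proof -
    obtain b where p: "p = [:b:]" using \<open>degree p \<le> 0\<close> by (auto elim: degree_eq_zeroE)
    have "L2_inner c d (\<lambda>y. f y - e) (\<lambda>_. b) = ((LINT x|leb c d. f x) - e * (d - c)) * b"
      using L2_integrable[OF 0] assms LINT_leb_const[of c d e] L2_integrable[OF L2_const[of e]]
      by (simp add: L2_inner_def del: integral_const)
    moreover have "poly [:b:] = (\<lambda>_. b)" by (simp add: fun_eq_iff)
    ultimately show ?thesis using assms by (simp add: p e_def)
  qed
  then show ?case by (intro exI[where x="[:e:]"]) auto
next
  case (Suc n)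
  let ?I = "L2_inner c d"
  obtain q0 where q0: "degree q0 \<le> n" "\<And>p. degree p \<le> n \<Longrightarrow> ?I (\<lambda>y. f y - poly q0 y) (poly p) = 0"
    using Suc.IH[OF Suc.prems] by blast
  obtain b where b: "degree b \<le> n" "\<And>p. degree p \<le> n \<Longrightarrow> ?I (\<lambda>y. poly (monom 1 (Suc n)) y - poly b y) (poly p) = 0"
    using Suc.IH[OF poly_L2[of "monom 1 (Suc n)"]] by blast
  define r where "r = monom 1 (Suc n) - b"
  have r: "degree r \<le> Suc n" "coeff r (Suc n) = 1"
    using b(1) by (auto simp: r_def degree_monom_eq coeff_eq_0 intro!: degree_diff_le degree_monom_le)
  have rp: "?I (poly r) (poly p) = 0" if "degree p \<le> n" for p
    using b(2)[OF that] by (simp add: r_def[unfolded atomize_eq] poly_diff[abs_def])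
  note L2 = L2_diff[OF Suc.prems poly_L2[of q0]] poly_L2
  \<comment> \<open>Should the denominator vanish, division yields 0; the equation after this
    definition still holds, because the numerator vanishes as well.\<close>
  define s where "s = ?I (\<lambda>y. f y - poly q0 y) (poly r) / ?I (poly r) (poly r)"
  have s: "?I (\<lambda>y. f y - poly q0 y) (poly r) = s * ?I (poly r) (poly r)"
    using L2_norm_eq_0_inner[OF L2(1) poly_L2[of r]] by (simp add: s_def)
  have "?I (\<lambda>y. f y - poly (q0 + smult s r) y) (poly p) = 0" if p: "degree p \<le> Suc n" for p
  proof -
    define e where "e = coeff p (Suc n)"
    define p' where "p' = p - smult e r"
    have "degree p' \<le> Suc n" unfolding p'_def using p r by (intro degree_diff_le) (auto intro: order_trans[OF degree_smult_le])
    moreover have "coeff p' (Suc n) = 0" using r by (simp add: p'_def e_def)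
    ultimately have p': "degree p' \<le> n"
      using leading_coeff_0_iff[of p'] by (cases "degree p' = Suc n") auto
    have decomp: "poly p = (\<lambda>y. poly p' y + e * poly r y)" by (simp add: p'_def fun_eq_iff)
    have *: "?I (\<lambda>y. (f y - poly q0 y) - s * poly r y) g = ?I (\<lambda>y. f y - poly q0 y) g - s * ?I (poly r) g" if "g \<in> L2 c d" for g
      using L2_inner_diff_left[OF L2(1) L2_cmult[OF poly_L2] that] by (simp add: L2_inner_cmult_left)
    have "?I (\<lambda>y. (f y - poly q0 y) - s * poly r y) (poly p)
      = ?I (\<lambda>y. (f y - poly q0 y) - s * poly r y) (poly p') + e * ?I (\<lambda>y. (f y - poly q0 y) - s * poly r y) (poly r)"
      unfolding decomp
      using L2_inner_add_right[OF poly_L2 L2_cmult[OF poly_L2] L2_diff[OF L2(1) L2_cmult[OF poly_L2]]] by (simp add: L2_inner_cmult_right)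
    also have "\<dots> = 0" unfolding *[OF poly_L2] using q0(2)[OF p'] rp[OF p'] s by simp
    finally show ?thesis by (simp add: diff_diff_eq)
  qed
  moreover have "degree (q0 + smult s r) \<le> Suc n"
    using q0(1) r by (intro degree_add_le) (auto intro: order_trans[OF degree_smult_le])
  ultimately show ?case by blast
qed

text \<open>Integrate the polynomial found for the shifted values and fix the constant. It will
  compete with the \<open>L\<^sub>2\<close> projection on an element.\<close>

lemma taylor_poly_exists:
  "\<exists>p::real poly. degree p \<le> n \<and> (\<forall>j\<le>n. poly ((pderiv ^^ j) p) c = e j)"
proof (induction n arbitrary: e)
  case 0
  show ?case by (intro exI[where x="[:e 0:]"]) simp
next
  case (Suc n)
  obtain p' where p': "degree p' \<le> n" "\<And>j. j \<le> n \<Longrightarrow> poly ((pderiv ^^ j) p') c = e (Suc j)"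
    using Suc.IH[of "\<lambda>j. e (Suc j)"] by blast
  obtain p where p: "pderiv p = p'" "poly p c = e 0" "degree p \<le> Suc (degree p')"
    using poly_antideriv_exists by blast
  have "poly ((pderiv ^^ j) p) c = e j" if "j \<le> Suc n" for j
    using that p p' by (cases j) (auto simp del: funpow.simps simp: funpow_Suc_right funpow_0)
  then show ?case using p p' by (intro exI[where x=p]) auto
qed

lemma le_of_square_le_mult: "0 \<le> x \<Longrightarrow> 0 \<le> y \<Longrightarrow> x\<^sup>2 \<le> x * y \<Longrightarrow> x \<le> y" for x y :: real
  by (cases "x = 0") (auto simp: power2_eq_square)

lemma L2_norm_sub_le:
  assumes "a \<le> c" "c \<le> d" "d \<le> b" "u \<in> L2 a b" shows "L2_norm c d u \<le> L2_norm a b u"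
proof -
  have "u \<in> L2 c b" using assms by (intro L2_sub[of a c b b]) auto
  then have "L2_inner a b u u = L2_inner a c u u + (L2_inner c d u u + L2_inner d b u u)"
    using assms L2_inner_combine[of a c b u u] L2_inner_combine[of c d b u u] by simp
  then have "L2_inner c d u u \<le> L2_inner a b u u"
    using L2_inner_self_nonneg[of a c u] L2_inner_self_nonneg[of d b u] by linarith
  then show ?thesis by (simp add: L2_norm_def)
qed

lemma acd_abs_diff:
  assumes "acd a b F f" "x \<in> {a..b}" "y \<in> {a..b}"
  shows "\<bar>F y - F x\<bar> \<le> sqrt (b - a) * L2_norm a b f"
proof -
  have *: "\<bar>F y - F x\<bar> \<le> sqrt (b - a) * L2_norm a b f" if "a \<le> x" "x \<le> y" "y \<le> b" for x y
  proof -
    have "\<bar>F y - F x\<bar> \<le> sqrt (y - x) * L2_norm x y f"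
      unfolding acd_diff_eq[OF assms(1) that] by (rule abs_LINT_le_L2[OF that(2) L2_sub[OF that acd_L2[OF assms(1)]]])
    also have "\<dots> \<le> sqrt (b - a) * L2_norm a b f"
      using that by (intro mult_mono L2_norm_sub_le[OF that acd_L2[OF assms(1)]]) auto
    finally show ?thesis .
  qed
  show ?thesis using *[of x y] *[of y x] assms(2,3) by (cases "x \<le> y") (auto simp: abs_minus_commute)
qed

text \<open>A Poincare inequality from a single zero, located anywhere: half a power of the length
  comes from Cauchy-Schwarz, the other half from the norm of a constant.\<close>

lemma acd_zero_norm_le:
  assumes "acd a b F f" "z \<in> {a..b}" "F z = 0"
  shows "L2_norm a b F \<le> (b - a) * L2_norm a b f"
proof -
  have ab: "a \<le> b" using assms(2) by simp
  have "L2_norm a b F \<le> (sqrt (b - a) * L2_norm a b f) * sqrt (b - a)"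
  proof (rule L2_norm_le_sup[OF ab acd_L2_fun[OF assms(1)]])
    show "\<bar>F y\<bar> \<le> sqrt (b - a) * L2_norm a b f" if "y \<in> {a<..<b}" for y
      using acd_abs_diff[OF assms(1,2), of y] that assms(3) by simp
  qed (use ab in simp)
  also have "\<dots> = (sqrt (b - a) * sqrt (b - a)) * L2_norm a b f" by (simp only: mult_ac)
  also have "sqrt (b - a) * sqrt (b - a) = b - a" using ab by simp
  finally show ?thesis .
qed

text \<open>The Poincare inequality applied downwards from order \<open>Suc k\<close>. The zeros of
  different orders need not be related.\<close>

lemma chain_zeros_norm_le:
  assumes "\<And>j. j \<le> k \<Longrightarrow> acd c d (E j) (E (Suc j))" "\<And>j. j \<le> k \<Longrightarrow> \<exists>z\<in>{c..d}. E j z = 0"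
  shows "i \<le> Suc k \<Longrightarrow> L2_norm c d (E (Suc k - i)) \<le> (d - c) ^ i * L2_norm c d (E (Suc k))"
proof (induction i)
  case (Suc i)
  obtain z where z: "z \<in> {c..d}" "E (k - i) z = 0" using assms(2)[of "k - i"] by auto
  have eq: "Suc (k - i) = Suc k - i" using Suc.prems by simp
  have "L2_norm c d (E (k - i)) \<le> (d - c) * L2_norm c d (E (Suc k - i))"
    using acd_zero_norm_le[OF assms(1)[of "k - i"] z] unfolding eq by simp
  also have "\<dots> \<le> (d - c) * ((d - c) ^ i * L2_norm c d (E (Suc k)))"
    using Suc z by (intro mult_left_mono) auto
  finally show ?case by (simp add: mult.assoc)
qed simp

text \<open>Of the \<open>k + 1\<close> zeros each differentiation loses one, so up to order
  \<open>k\<close> at least one is left. Only the ordering of the nodes enters, which keeps the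
  later bound independent of their position.\<close>

lemma rolle_chain:
  assumes "\<And>j y. j < k \<Longrightarrow> y \<in> {c..d} \<Longrightarrow> (E j has_real_derivative E (Suc j) y) (at y within {c..d})"
    and z: "\<And>r. r < k \<Longrightarrow> z r < z (Suc r)" "\<And>r. r \<le> k \<Longrightarrow> z r \<in> {c..d} \<and> E 0 (z r) = (0::real)"
  shows "j \<le> k \<Longrightarrow> \<exists>w. (\<forall>r<k - j. w r < w (Suc r)) \<and> (\<forall>r\<le>k - j. w r \<in> {c..d} \<and> E j (w r) = 0)"
proof (induction j)
  case 0
  show ?case using z by (intro exI[where x=z]) auto
next
  case (Suc j)
  then obtain w where w: "\<And>r. r < k - j \<Longrightarrow> w r < w (Suc r)" "\<And>r. r \<le> k - j \<Longrightarrow> w r \<in> {c..d}" "\<And>r. r \<le> k - j \<Longrightarrow> E j (w r) = 0"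
    by auto
  have "\<exists>s. w r < s \<and> s < w (Suc r) \<and> E (Suc j) s = 0" if r: "r < k - j" for r
  proof -
    have wr: "c \<le> w r" "w (Suc r) \<le> d" using w(2)[of r] w(2)[of "Suc r"] r by auto
    have D: "(E j has_real_derivative E (Suc j) y) (at y within {c..d})" if "y \<in> {c..d}" for y
      using assms(1)[of j y] that Suc.prems by simp
    have "\<exists>s. w r < s \<and> s < w (Suc r) \<and> (\<lambda>v. E (Suc j) s * v) = (\<lambda>v. 0)"
    proof (rule Rolle_deriv)
      show "w r < w (Suc r)" by (rule w(1)[OF r])
      show "E j (w r) = E j (w (Suc r))" using w(3) r by simp
      have "continuous_on {c..d} (E j)" using D by (intro DERIV_continuous_on)
      then show "continuous_on {w r..w (Suc r)} (E j)" by (rule continuous_on_subset) (use wr in auto)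
      show "(E j has_derivative (\<lambda>v. E (Suc j) x * v)) (at x)" if "w r < x" "x < w (Suc r)" for x
        using D[of x] that wr at_within_Icc_at[of c x d] by (auto simp: has_field_derivative_def)
    qed
    then obtain s where s: "w r < s" "s < w (Suc r)" "(\<lambda>v. E (Suc j) s * v) = (\<lambda>v. 0)" by blast
    have "E (Suc j) s = 0" using fun_cong[OF s(3), of 1] by simp
    then show ?thesis using s by blast
  qed
  then obtain s where s: "\<And>r. r < k - j \<Longrightarrow> w r < s r" "\<And>r. r < k - j \<Longrightarrow> s r < w (Suc r)" "\<And>r. r < k - j \<Longrightarrow> E (Suc j) (s r) = 0"
    by metis
  have "s r < s (Suc r)" if "r < k - Suc j" for r
  proof -
    have "r < k - j" "Suc r < k - j" using that by linarith+
    from s(2)[OF this(1)] s(1)[OF this(2)] show ?thesis by linarith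
  qed
  moreover have "s r \<in> {c..d} \<and> E (Suc j) (s r) = 0" if "r \<le> k - Suc j" for r
  proof -
    have r: "r < k - j" using that Suc.prems by linarith
    show ?thesis using s(1-3)[OF r] w(2)[of r] w(2)[of "Suc r"] r by auto
  qed
  ultimately show ?case by (intro exI[where x=s]) auto
qed

lemma interpolation_error_element:
  assumes chain: "\<And>j. j \<le> k \<Longrightarrow> acd c d (D j) (D (Suc j))" and p: "degree p \<le> k"
    and z: "\<And>r. r < k \<Longrightarrow> z r < z (Suc r)" "\<And>r. r \<le> k \<Longrightarrow> z r \<in> {c..d} \<and> poly p (z r) = D 0 (z r)"
  shows "L2_norm c d (\<lambda>y. D 0 y - poly p y) \<le> (d - c) ^ Suc k * L2_norm c d (D (Suc k))"
proof -
  define E where "E j = (\<lambda>y. D j y - poly ((pderiv ^^ j) p) y)" for j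
  have acdE: "acd c d (E j) (E (Suc j))" if "j \<le> k" for j unfolding E_def by (rule acd_diff[OF chain[OF that] acd_poly_iter])
  have "\<exists>z\<in>{c..d}. E j z = 0" if j: "j \<le> k" for j
  proof -
    have "\<exists>w. (\<forall>r<k - j. w r < w (Suc r)) \<and> (\<forall>r\<le>k - j. w r \<in> {c..d} \<and> E j (w r) = 0)"
    proof (rule rolle_chain[where E=E and k=k and z=z and j=j])
      show "(E i has_real_derivative E (Suc i) y) (at y within {c..d})" if "i < k" "y \<in> {c..d}" for i y
        using that by (intro acd_has_derivative[OF acdE] acd_continuous[OF acdE]) auto
      show "z r \<in> {c..d} \<and> E 0 (z r) = 0" if "r \<le> k" for r using z(2)[OF that] by (simp add: E_def)
      show "z r < z (Suc r)" if "r < k" for r by (rule z(1)[OF that])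
    qed (rule j)
    then obtain w where "\<And>r. r \<le> k - j \<Longrightarrow> w r \<in> {c..d} \<and> E j (w r) = 0" by blast
    from this[of 0] show ?thesis by auto
  qed
  from chain_zeros_norm_le[where i="Suc k" and E=E and k=k, OF acdE this]
  have "L2_norm c d (E 0) \<le> (d - c) ^ Suc k * L2_norm c d (E (Suc k))" by simp
  \<comment> \<open>The polynomial has degree at most \<open>k\<close> and drops out at order
    \<open>Suc k\<close>, so no norm of it remains in the bound.\<close>
  moreover have "E (Suc k) = D (Suc k)" unfolding E_def pderiv_iter_eq_0[OF p] by simp
  ultimately show ?thesis by (simp add: E_def)
qed

text \<open>On an element the Ritz projection is given by the \<open>L\<^sub>2\<close> projection of the derivative; it is
  exact at both end points.\<close>

lemma ritz_element:
  assumes chain: "\<And>j. j \<le> k \<Longrightarrow> acd c d (D j) (D (Suc j))" and "1 \<le> k" "c < d"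
  shows "\<exists>P. degree P \<le> k \<and> poly P c = D 0 c \<and> poly P d = D 0 d \<and>
    (\<forall>p. degree p \<le> k \<longrightarrow> L2_inner c d (\<lambda>y. D 1 y - poly (pderiv P) y) (poly (pderiv p)) = 0) \<and>
    L2_norm c d (\<lambda>y. D 0 y - poly P y) \<le> (d - c) ^ Suc k * L2_norm c d (D (Suc k))"
proof -
  have D0: "acd c d (D 0) (D 1)" using chain[of 0] by simp
  note D1 = acd_L2[OF D0]
  obtain q where q: "degree q \<le> k - 1" "\<And>p. degree p \<le> k - 1 \<Longrightarrow> L2_inner c d (\<lambda>y. D 1 y - poly q y) (poly p) = 0"
    using poly_L2_projection[OF assms(3) D1] by blast
  obtain P where P: "pderiv P = q" "poly P c = D 0 c" "degree P \<le> Suc (degree q)" using poly_antideriv_exists by blast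
  have PD: "acd c d (\<lambda>y. D 0 y - poly P y) (\<lambda>y. D 1 y - poly q y)" using acd_diff[OF D0 acd_poly[of c d P]] P(1) by simp
  \<comment> \<open>Orthogonality to constants says that the error of the derivative has integral 0;
    being exact at \<open>c\<close>, \<open>P\<close> is therefore exact at \<open>d\<close>
    too.\<close>
  have "L2_inner c d (\<lambda>y. D 1 y - poly q y) (poly 1) = 0" by (rule q(2)) simp
  then have "(D 0 d - poly P d) - (D 0 c - poly P c) = 0"
    unfolding acd_diff_eq[OF PD order_refl less_imp_le[OF assms(3)] order_refl] by (simp add: L2_inner_def)
  then have Pd: "poly P d = D 0 d" using P(2) by simp
  \<comment> \<open>A competitor for the best approximation of \<open>D 1\<close>: every derivative
    up to order \<open>k\<close> of the Taylor error vanishes at \<open>c\<close>.\<close>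
  obtain t where t: "degree t \<le> k" "\<And>j. j \<le> k \<Longrightarrow> poly ((pderiv ^^ j) t) c = D j c"
    using taylor_poly_exists[of k c "\<lambda>j. D j c"] by blast
  define E where "E j = (\<lambda>y. D j y - poly ((pderiv ^^ j) t) y)" for j
  have acdE: "acd c d (E j) (E (Suc j))" if "j \<le> k" for j unfolding E_def by (rule acd_diff[OF chain[OF that] acd_poly_iter])
  have "\<exists>z\<in>{c..d}. E j z = 0" if "j \<le> k" for j using t(2)[OF that] assms(3) by (intro bexI[where x=c]) (auto simp: E_def)
  from chain_zeros_norm_le[where i=k and E=E and k=k, OF acdE this]
  have "L2_norm c d (E 1) \<le> (d - c) ^ k * L2_norm c d (E (Suc k))" by simp
  moreover have "E (Suc k) = D (Suc k)" unfolding E_def pderiv_iter_eq_0[OF t(1)] by simp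
  ultimately have E1: "L2_norm c d (\<lambda>y. D 1 y - poly (pderiv t) y) \<le> (d - c) ^ k * L2_norm c d (D (Suc k))" by (simp add: E_def)
  have best: "L2_norm c d (\<lambda>y. D 1 y - poly q y) \<le> L2_norm c d (\<lambda>y. D 1 y - poly (pderiv t) y)"
  proof -
    let ?r = "\<lambda>y. D 1 y - poly q y" and ?s = "\<lambda>y. D 1 y - poly (pderiv t) y"
    have L: "?r \<in> L2 c d" "?s \<in> L2 c d" by (intro L2_diff D1 poly_L2)+
    have "L2_inner c d ?r (poly (pderiv t - q)) = 0"
      using q(1) t(1) by (intro q(2) degree_diff_le) (auto simp: degree_pderiv)
    moreover have "L2_inner c d ?r (\<lambda>y. ?s y + poly (pderiv t - q) y) = L2_inner c d ?r ?s + L2_inner c d ?r (poly (pderiv t - q))"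
      by (intro L2_inner_add_right L poly_L2)
    ultimately have "L2_inner c d ?r ?r = L2_inner c d ?r ?s" by simp
    then have "(L2_norm c d ?r)\<^sup>2 \<le> L2_norm c d ?r * L2_norm c d ?s" using L2_Cauchy_Schwarz[OF L] unfolding L2_norm_sq by linarith
    then show ?thesis by (rule le_of_square_le_mult[OF L2_norm_nonneg L2_norm_nonneg])
  qed
  have "L2_norm c d (\<lambda>y. D 0 y - poly P y) \<le> (d - c) * L2_norm c d (\<lambda>y. D 1 y - poly q y)"
    using P(2) assms(3) by (intro acd_zero_norm_le[OF PD, of c]) auto
  also have "\<dots> \<le> (d - c) * ((d - c) ^ k * L2_norm c d (D (Suc k)))"
    using order_trans[OF best E1] assms(3) by (intro mult_left_mono) auto
  finally have "L2_norm c d (\<lambda>y. D 0 y - poly P y) \<le> (d - c) ^ Suc k * L2_norm c d (D (Suc k))" by (simp add: mult.assoc)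
  moreover have "degree P \<le> k" using P(3) q(1) assms(2) by linarith
  moreover have "L2_inner c d (\<lambda>y. D 1 y - poly (pderiv P) y) (poly (pderiv p)) = 0" if "degree p \<le> k" for p
    unfolding P(1) using that by (intro q(2)) (simp add: degree_pderiv)
  ultimately show ?thesis using P(2) Pd by blast
qed

section \<open>Partitions and piecewise polynomials\<close>

lemma partition_less:
  assumes "is_partition M x" "i < j" "j \<le> M" shows "x i < x j"
  using assms(2,3)
proof (induction j)
  case (Suc j)
  have step: "x j < x (Suc j)" using assms(1) Suc.prems by (simp add: is_partition_def)
  show ?case
  proof (cases "i = j")
    case False
    then have "x i < x j" using Suc by simp
    then show ?thesis using step by simp
  qed (use step in simp)
qed simp

lemma partition_le:
  assumes "is_partition M x" "i \<le> j" "j \<le> M" shows "x i \<le> x j"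
  using partition_less[OF assms(1)] assms(2,3) by (cases "i = j") (auto intro: less_imp_le)

lemma partition_bounds:
  assumes "is_partition M x" "j \<le> M" shows "0 \<le> x j" "x j \<le> 1"
  using partition_le[OF assms(1), of 0 j] partition_le[OF assms(1), of j M] assms by (auto simp: is_partition_def)

lemma mesh_size_ge:
  assumes "is_partition M x" "j < M" shows "x (Suc j) - x j \<le> mesh_size M x"
  unfolding mesh_size_def using assms by (intro Max_ge) auto

lemma mesh_size_pos:
  assumes "is_partition M x" shows "0 < mesh_size M x"
proof -
  have "0 < M" using assms by (simp add: is_partition_def)
  then show ?thesis using mesh_size_ge[OF assms, of 0] partition_less[OF assms, of 0 1] by simp
qed

lemma L2_glue:
  assumes "a \<le> c" "c \<le> b" "u \<in> L2 a c" "u \<in> L2 c b" shows "u \<in> L2 a b"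
proof -
  have *: "integrable (leb a b) g" if "integrable (leb a c) g" "integrable (leb c b) g" for g :: "real \<Rightarrow> real"
  proof -
    have abs: "g absolutely_integrable_on {p..q}" if "integrable (leb p q) g" for p q
    proof -
      have "g absolutely_integrable_on {p<..<q}"
        using that unfolding set_integrable_def by (subst (asm) integrable_restrict_space) auto
      then show ?thesis by (rule absolutely_integrable_on_Icc_iff_Ioo[THEN iffD2])
    qed
    have "g absolutely_integrable_on {a..b}"
      by (rule absolutely_integrable_on_combine[OF abs[OF that(1)] abs[OF that(2)] assms(1,2)])
    then have "g absolutely_integrable_on {a<..<b}" by (rule absolutely_integrable_on_Icc_iff_Ioo[THEN iffD1])
    then show ?thesis by (rule absolutely_integrable_imp_integrable) simp
  qed
  have "integrable (leb a b) u" by (intro * L2_integrable assms)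
  moreover have "integrable (leb a b) (\<lambda>x. (u x)\<^sup>2)" using assms(3,4) by (intro *) (auto simp: L2_def)
  ultimately show ?thesis by (auto simp: L2_def)
qed

lemma acd_glue:
  assumes "a \<le> c" "c \<le> b" "acd a c F f" "acd c b F f" shows "acd a b F f"
proof (rule acdI)
  show f: "f \<in> L2 a b" by (rule L2_glue[OF assms(1,2) acd_L2[OF assms(3)] acd_L2[OF assms(4)]])
  fix y assume y: "a \<le> y" "y \<le> b"
  show "F y = F a + (LINT s|leb a y. f s)"
  proof (cases "y \<le> c")
    case True
    then show ?thesis by (intro acd_eq[OF assms(3)] y)
  next
    case False
    have "integrable (leb a y) f" by (rule integrable_leb_sub[OF order_refl y L2_integrable[OF f]])
    then have "(LINT s|leb a y. f s) = (LINT s|leb a c. f s) + (LINT s|leb c y. f s)"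
      using assms False by (intro integral_leb_combine(3)) auto
    moreover have "F y - F c = (LINT s|leb c y. f s)" using acd_diff_eq[OF assms(4), of c y] assms False y by simp
    moreover have "F c - F a = (LINT s|leb a c. f s)" using acd_diff_eq[OF assms(3), of a c] assms by simp
    ultimately show ?thesis by linarith
  qed
qed

lemma acd_mesh:
  assumes "is_partition M x" "\<And>j. j < M \<Longrightarrow> acd (x j) (x (Suc j)) F f" shows "acd 0 1 F f"
proof -
  have x0: "x 0 = 0" "x M = 1" using assms(1) by (auto simp: is_partition_def)
  have "acd (x 0) (x m) F f" if "m \<le> M" for m
    using that
  proof (induction m)
    case 0
    have M: "0 < M" using assms(1) by (simp add: is_partition_def)
    show ?case using partition_le[OF assms(1), of 0 1] M by (intro acd_sub[OF assms(2)[OF M]]) auto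
  next
    case (Suc m)
    then have m: "acd (x 0) (x m) F f" "m < M" by simp_all
    show ?case
      by (rule acd_glue[OF _ _ m(1) assms(2)[OF m(2)]]) (use m(2) in \<open>simp_all add: partition_le[OF assms(1)]\<close>)
  qed
  from this[of M] show ?thesis by (simp add: x0)
qed

lemma L2_inner_mesh:
  assumes "is_partition M x" "u \<in> L2 0 1" "w \<in> L2 0 1"
  shows "L2_inner 0 1 u w = (\<Sum>j<M. L2_inner (x j) (x (Suc j)) u w)"
proof -
  have x0: "x 0 = 0" "x M = 1" using assms(1) by (auto simp: is_partition_def)
  have "L2_inner 0 (x m) u w = (\<Sum>j<m. L2_inner (x j) (x (Suc j)) u w)" if "m \<le> M" for m
    using that
  proof (induction m)
    case 0
    show ?case by (simp add: x0 L2_inner_def)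
  next
    case (Suc m)
    have "L2_inner 0 (x (Suc m)) u w = L2_inner 0 (x m) u w + L2_inner (x m) (x (Suc m)) u w"
    proof (rule L2_inner_combine)
      show "0 \<le> x m" "x m \<le> x (Suc m)" using partition_bounds[OF assms(1)] partition_le[OF assms(1)] Suc.prems by auto
      show "u \<in> L2 0 (x (Suc m))" "w \<in> L2 0 (x (Suc m))"
        using partition_bounds[OF assms(1) Suc.prems] assms(2,3) by (auto intro: L2_sub[of 0 0 "x (Suc m)" 1])
    qed
    then show ?case using Suc by simp
  qed
  from this[of M] show ?thesis by (simp add: x0)
qed

text \<open>Squared norms add over the elements, so elementwise bounds carry over without a further
  constant.\<close>

lemma L2_norm_mesh_le:
  assumes P: "is_partition M x" and u: "u \<in> L2 0 1" and w: "w \<in> L2 0 1"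
    and "\<And>j. j < M \<Longrightarrow> L2_norm (x j) (x (Suc j)) u \<le> (x (Suc j) - x j) ^ n * L2_norm (x j) (x (Suc j)) w"
  shows "L2_norm 0 1 u \<le> mesh_size M x ^ n * L2_norm 0 1 w"
proof (rule power2_le_imp_le)
  let ?h = "mesh_size M x"
  have h: "0 \<le> ?h" using mesh_size_pos[OF P] by simp
  have "(L2_norm 0 1 u)\<^sup>2 = (\<Sum>j<M. (L2_norm (x j) (x (Suc j)) u)\<^sup>2)"
    unfolding L2_norm_sq by (rule L2_inner_mesh[OF P u u])
  also have "\<dots> \<le> (\<Sum>j<M. (?h ^ n)\<^sup>2 * (L2_norm (x j) (x (Suc j)) w)\<^sup>2)"
  proof (rule sum_mono)
    fix j assume "j \<in> {..<M}" then have j: "j < M" by simp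
    have "(x (Suc j) - x j) ^ n \<le> ?h ^ n"
      using mesh_size_ge[OF P j] partition_le[OF P, of j "Suc j"] j by (intro power_mono) auto
    then have "L2_norm (x j) (x (Suc j)) u \<le> ?h ^ n * L2_norm (x j) (x (Suc j)) w"
      using assms(4)[OF j] by (meson L2_norm_nonneg mult_right_mono order_trans)
    then show "(L2_norm (x j) (x (Suc j)) u)\<^sup>2 \<le> (?h ^ n)\<^sup>2 * (L2_norm (x j) (x (Suc j)) w)\<^sup>2"
      unfolding power_mult_distrib[symmetric] by (intro power_mono) auto
  qed
  also have "\<dots> = (?h ^ n * L2_norm 0 1 w)\<^sup>2"
    unfolding sum_distrib_left[symmetric] power_mult_distrib L2_norm_sq L2_inner_mesh[OF P w w] ..
  finally show "(L2_norm 0 1 u)\<^sup>2 \<le> (?h ^ n * L2_norm 0 1 w)\<^sup>2" .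
  show "0 \<le> ?h ^ n * L2_norm 0 1 w" using h by simp
qed

text \<open>Elements are taken open on the left, so that a mesh point is assigned to one element
  only; 0 is assigned to none.\<close>

lemma mesh_index_exists:
  assumes P: "is_partition M x"
  shows "\<exists>J. \<forall>j<M. \<forall>y. x j < y \<and> y \<le> x (Suc j) \<longrightarrow> J y = j"
proof (intro exI allI impI)
  fix j y assume j: "j < M" and y: "x j < y \<and> y \<le> x (Suc j)"
  show "(LEAST i. y \<le> x (Suc i)) = j"
  proof (rule Least_equality)
    show "y \<le> x (Suc j)" using y by simp
    fix i assume i: "y \<le> x (Suc i)"
    show "j \<le> i"
    proof (rule ccontr)
      assume "\<not> j \<le> i"
      then have "x (Suc i) \<le> x j" using j by (intro partition_le[OF P]) auto
      then show False using i y by linarith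
    qed
  qed
qed

text \<open>The piecewise derivative \<open>w\<close> is specified inside the elements only, as it
  is determined up to null sets.\<close>

lemma fe_acd:
  assumes P: "is_partition M x" and W: "W \<in> fe_space M x k"
  obtains w p where "acd 0 1 W w" "\<And>j. j < M \<Longrightarrow> degree (p j) \<le> k"
    "\<And>j y. j < M \<Longrightarrow> y \<in> {x j..x (Suc j)} \<Longrightarrow> W y = poly (p j) y"
    "\<And>j y. j < M \<Longrightarrow> y \<in> {x j<..<x (Suc j)} \<Longrightarrow> w y = poly (pderiv (p j)) y"
proof -
  obtain J where J: "\<And>j y. j < M \<Longrightarrow> x j < y \<Longrightarrow> y \<le> x (Suc j) \<Longrightarrow> J y = j" using mesh_index_exists[OF P] by blast
  have "\<forall>j<M. \<exists>p. degree p \<le> k \<and> (\<forall>y\<in>{x j..x (Suc j)}. W y = poly p y)" using W by (simp add: fe_space_def)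
  then obtain p where p: "\<And>j. j < M \<Longrightarrow> degree (p j) \<le> k" "\<And>j y. j < M \<Longrightarrow> y \<in> {x j..x (Suc j)} \<Longrightarrow> W y = poly (p j) y"
    by metis
  define w where "w y = poly (pderiv (p (J y))) y" for y
  have w: "w y = poly (pderiv (p j)) y" if "j < M" "y \<in> {x j<..<x (Suc j)}" for j y
    using J[of j y] that by (simp add: w_def)
  have "acd (x j) (x (Suc j)) W w" if j: "j < M" for j
    by (rule acd_cong[OF acd_poly[of _ _ "p j"]]) (use p(2)[OF j] w[OF j] in simp_all)
  then have "acd 0 1 W w" by (rule acd_mesh[OF P])
  then show ?thesis using p w by (rule that)
qed

lemma fe_acd_exists: "is_partition M x \<Longrightarrow> W \<in> fe_space M x k \<Longrightarrow> \<exists>w. acd 0 1 W w"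
  by (erule (1) fe_acd) (rule exI)

lemma fe_zero: "W \<in> fe_space M x k \<Longrightarrow> W 0 = 0" "W \<in> fe_space M x k \<Longrightarrow> W 1 = 0"
  by (auto simp: fe_space_def)

lemma fe_diff:
  assumes "W \<in> fe_space M x k" "W' \<in> fe_space M x k" shows "(\<lambda>y. W y - W' y) \<in> fe_space M x k"
proof -
  have "\<exists>p::real poly. degree p \<le> k \<and> (\<forall>y\<in>{x j..x (Suc j)}. W y - W' y = poly p y)" if "j < M" for j
  proof -
    have "\<exists>p::real poly. degree p \<le> k \<and> (\<forall>y\<in>{x j..x (Suc j)}. W y = poly p y)" using assms(1) that by (simp add: fe_space_def)
    then obtain p :: "real poly" where p: "degree p \<le> k" "\<forall>y\<in>{x j..x (Suc j)}. W y = poly p y" by blast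
    have "\<exists>p::real poly. degree p \<le> k \<and> (\<forall>y\<in>{x j..x (Suc j)}. W' y = poly p y)" using assms(2) that by (simp add: fe_space_def)
    then obtain p' :: "real poly" where p': "degree p' \<le> k" "\<forall>y\<in>{x j..x (Suc j)}. W' y = poly p' y" by blast
    show ?thesis using p p' degree_diff_le[of p k p'] by (intro exI[where x="p - p'"]) simp
  qed
  then show ?thesis using assms continuous_on_diff[of "{0..1}" W W'] by (simp add: fe_space_def)
qed

text \<open>Independent of the representatives of the derivatives.\<close>

definition dinner :: "(real \<Rightarrow> real) \<Rightarrow> (real \<Rightarrow> real) \<Rightarrow> real" where
  "dinner F G = L2_inner 0 1 (weak_deriv 0 1 1 F) (weak_deriv 0 1 1 G)"

section \<open>The Ritz projection\<close>

lemma dinner_eq: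
  assumes "acd 0 1 F f" "acd 0 1 G g" shows "dinner F G = L2_inner 0 1 f g"
  unfolding dinner_def
  using acd_weak_deriv[OF zero_le_one assms(1)] acd_weak_deriv[OF zero_le_one assms(2)]
  by (intro L2_inner_cong_AE acd_L2[OF assms(1)] acd_L2[OF assms(2)]) (auto intro: acd_L2)

text \<open>A relation, because membership in \<open>fe_space\<close> and orthogonality determine
  \<open>R\<close> on the unit interval only.\<close>

definition ritz :: "nat \<Rightarrow> (nat \<Rightarrow> real) \<Rightarrow> nat \<Rightarrow> (real \<Rightarrow> real) \<Rightarrow> (real \<Rightarrow> real) \<Rightarrow> bool" where
  "ritz M x k U R \<longleftrightarrow> R \<in> fe_space M x k \<and> (\<forall>W\<in>fe_space M x k. dinner (\<lambda>y. U y - R y) W = 0)"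

lemma ritz_fe: "ritz M x k U R \<Longrightarrow> R \<in> fe_space M x k"
  by (simp add: ritz_def)

lemma ritz_orth: "ritz M x k U R \<Longrightarrow> W \<in> fe_space M x k \<Longrightarrow> dinner (\<lambda>y. U y - R y) W = 0"
  by (simp add: ritz_def)

text \<open>Linearity of the projection; applied to two time levels, it makes the increment of the
  errors the error of an increment.\<close>

lemma ritz_diff:
  assumes P: "is_partition M x" and r: "ritz M x k U R" "ritz M x k U' R'" and U: "acd 0 1 U u" "acd 0 1 U' u'"
  shows "ritz M x k (\<lambda>y. U y - U' y) (\<lambda>y. R y - R' y)"
  unfolding ritz_def
proof (intro conjI ballI)
  show "(\<lambda>y. R y - R' y) \<in> fe_space M x k" by (rule fe_diff[OF ritz_fe[OF r(1)] ritz_fe[OF r(2)]])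
  fix W assume W: "W \<in> fe_space M x k"
  obtain w where w: "acd 0 1 W w" using fe_acd_exists[OF P W] by blast
  obtain s where s: "acd 0 1 R s" using fe_acd_exists[OF P ritz_fe[OF r(1)]] by blast
  obtain s' where s': "acd 0 1 R' s'" using fe_acd_exists[OF P ritz_fe[OF r(2)]] by blast
  note d = acd_diff[OF U(1) s] acd_diff[OF U(2) s']
  have "dinner (\<lambda>y. U y - U' y - (R y - R' y)) W = dinner (\<lambda>y. (U y - R y) - (U' y - R' y)) W"
    by (simp add: algebra_simps)
  also have "\<dots> = dinner (\<lambda>y. U y - R y) W - dinner (\<lambda>y. U' y - R' y) W"
    unfolding dinner_eq[OF acd_diff[OF d] w] dinner_eq[OF d(1) w] dinner_eq[OF d(2) w]
    by (intro L2_inner_diff_left acd_L2[OF d(1)] acd_L2[OF d(2)] acd_L2[OF w])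
  also have "\<dots> = 0" using ritz_orth[OF r(1) W] ritz_orth[OF r(2) W] by simp
  finally show "dinner (\<lambda>y. U y - U' y - (R y - R' y)) W = 0" .
qed

text \<open>The difference of two projections is orthogonal to itself, so its derivative has norm 0
  and the zero at the left end fixes it.\<close>

lemma ritz_unique:
  assumes P: "is_partition M x" and r: "ritz M x k U R" "ritz M x k U R'" and U: "acd 0 1 U u" and y: "y \<in> {0..1}"
  shows "R y = R' y"
proof -
  have "ritz M x k (\<lambda>y. U y - U y) (\<lambda>y. R y - R' y)" by (rule ritz_diff[OF P r U U])
  then have S: "(\<lambda>y. R y - R' y) \<in> fe_space M x k" "\<And>W. W \<in> fe_space M x k \<Longrightarrow> dinner (\<lambda>y. 0 - (R y - R' y)) W = 0"
    using ritz_fe ritz_orth by fastforce+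
  obtain s where s: "acd 0 1 (\<lambda>y. R y - R' y) s" using fe_acd_exists[OF P S(1)] by blast
  have "dinner (\<lambda>y. 0 - (R y - R' y)) (\<lambda>y. R y - R' y) = L2_inner 0 1 (\<lambda>y. 0 - s y) s"
    by (rule dinner_eq[OF acd_diff[OF acd_const s] s])
  then have "L2_inner 0 1 s s = 0" using S(2)[OF S(1)] L2_inner_uminus_left[of 0 1 s s] by simp
  then have "L2_norm 0 1 s = 0" by (simp add: L2_norm_def)
  then have "\<bar>(R y - R' y) - (R 0 - R' 0)\<bar> \<le> 0" using acd_abs_diff[OF s, of 0 y] y by simp
  moreover have "R 0 = 0" "R' 0 = 0" using fe_zero(1) ritz_fe[OF r(1)] ritz_fe[OF r(2)] by blast+
  ultimately show ?thesis by simp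
qed

text \<open>The element projections agree with \<open>D 0\<close> at the mesh points and therefore
  glue continuously. Orthogonality can be checked element by element, because there the derivative
  of a finite element function is that of a polynomial of degree at most \<open>k\<close>.\<close>

lemma ritz_exists:
  assumes P: "is_partition M x" and k: "1 \<le> k" and chain: "\<And>j. j \<le> k \<Longrightarrow> acd 0 1 (D j) (D (Suc j))"
    and bd: "D 0 0 = 0" "D 0 1 = 0"
  shows "\<exists>R. ritz M x k (D 0) R \<and> L2_norm 0 1 (\<lambda>y. D 0 y - R y) \<le> mesh_size M x ^ Suc k * L2_norm 0 1 (D (Suc k))"
proof -
  have sub: "acd (x j) (x (Suc j)) F f" if "acd 0 1 F f" "j < M" for j F f
    using that partition_bounds[OF P] partition_le[OF P, of j "Suc j"] by (intro acd_sub[OF that(1)]) auto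
  define Q where "Q j q \<longleftrightarrow> degree q \<le> k \<and> poly q (x j) = D 0 (x j) \<and> poly q (x (Suc j)) = D 0 (x (Suc j)) \<and>
    (\<forall>p. degree p \<le> k \<longrightarrow> L2_inner (x j) (x (Suc j)) (\<lambda>y. D 1 y - poly (pderiv q) y) (poly (pderiv p)) = 0) \<and>
    L2_norm (x j) (x (Suc j)) (\<lambda>y. D 0 y - poly q y) \<le> (x (Suc j) - x j) ^ Suc k * L2_norm (x j) (x (Suc j)) (D (Suc k))"
    for j q
  have "\<exists>q. Q j q" if j: "j < M" for j
    unfolding Q_def by (rule ritz_element[where D=D, OF sub[OF chain j] k]) (use j in \<open>simp_all add: partition_less[OF P]\<close>)
  then obtain q where "\<And>j. j < M \<Longrightarrow> Q j (q j)" by metis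
  then have q: "\<And>j. j < M \<Longrightarrow> degree (q j) \<le> k"
    "\<And>j. j < M \<Longrightarrow> poly (q j) (x j) = D 0 (x j)" "\<And>j. j < M \<Longrightarrow> poly (q j) (x (Suc j)) = D 0 (x (Suc j))"
    "\<And>j p. j < M \<Longrightarrow> degree p \<le> k \<Longrightarrow> L2_inner (x j) (x (Suc j)) (\<lambda>y. D 1 y - poly (pderiv (q j)) y) (poly (pderiv p)) = 0"
    "\<And>j. j < M \<Longrightarrow> L2_norm (x j) (x (Suc j)) (\<lambda>y. D 0 y - poly (q j) y) \<le> (x (Suc j) - x j) ^ Suc k * L2_norm (x j) (x (Suc j)) (D (Suc k))"
    unfolding Q_def by blast+
  obtain J where J: "\<And>j y. j < M \<Longrightarrow> x j < y \<Longrightarrow> y \<le> x (Suc j) \<Longrightarrow> J y = j" using mesh_index_exists[OF P] by blast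
  have x0: "x 0 = 0" "x M = 1" "0 < M" using P by (auto simp: is_partition_def)
  \<comment> \<open>The index function is unconstrained at 0, so the value there is set by
    hand.\<close>
  define R where "R y = (if y \<le> 0 then 0 else poly (q (J y)) y)" for y
  define r where "r y = poly (pderiv (q (J y))) y" for y
  have R: "R y = poly (q j) y" if j: "j < M" and y: "y \<in> {x j..x (Suc j)}" for j y
  proof (cases "y = x j")
    case False
    then have "x j < y" using y by simp
    moreover have "0 \<le> x j" using partition_bounds[OF P] j by simp
    ultimately show ?thesis using J[OF j] y by (simp add: R_def)
  next
    case True
    show ?thesis
    proof (cases j)
      case 0
      then show ?thesis using True q(2)[OF j] bd x0 by (simp add: R_def)
    next
      case (Suc i)
      have i: "i < M" "x i < x (Suc i)" using Suc j partition_less[OF P, of i "Suc i"] by auto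
      have "0 < y" using True partition_less[OF P, of 0 j] j Suc x0 by simp
      then have "R y = poly (q i) y" using J[OF i(1), of y] i(2) True Suc by (simp add: R_def)
      then show ?thesis using q(3)[OF i(1)] q(2)[OF j] True Suc by simp
    qed
  qed
  have r: "r y = poly (pderiv (q j)) y" if "j < M" "y \<in> {x j<..<x (Suc j)}" for j y
    using J[of j y] that by (simp add: r_def)
  have "acd (x j) (x (Suc j)) R r" if j: "j < M" for j
    by (rule acd_cong[OF acd_poly[of _ _ "q j"]]) (use R[OF j] r[OF j] in simp_all)
  then have Rr: "acd 0 1 R r" by (rule acd_mesh[OF P])
  have "R 0 = 0" by (simp add: R_def)
  moreover have "R 1 = 0"
  proof -
    obtain m where m: "M = Suc m" using x0(3) gr0_implies_Suc by blast
    have "x m < 1" using partition_less[OF P, of m M] m x0 by simp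
    then show ?thesis using R[of m 1] q(3)[of m] m x0 bd by simp
  qed
  moreover have "\<exists>p::real poly. degree p \<le> k \<and> (\<forall>y\<in>{x j..x (Suc j)}. R y = poly p y)" if "j < M" for j
    using R[OF that] q(1)[OF that] by blast
  ultimately have RS: "R \<in> fe_space M x k"
    using acd_continuous[OF Rr] by (simp add: fe_space_def)
  have D0: "acd 0 1 (D 0) (D 1)" using chain[of 0] by simp
  have "dinner (\<lambda>y. D 0 y - R y) W = 0" if W: "W \<in> fe_space M x k" for W
  proof -
    obtain w p where w: "acd 0 1 W w" "\<And>j. j < M \<Longrightarrow> degree (p j) \<le> k"
      "\<And>j y. j < M \<Longrightarrow> y \<in> {x j<..<x (Suc j)} \<Longrightarrow> w y = poly (pderiv (p j)) y"
      by (rule fe_acd[OF P W], rule that)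
    have "dinner (\<lambda>y. D 0 y - R y) W = L2_inner 0 1 (\<lambda>y. D 1 y - r y) w"
      by (rule dinner_eq[OF acd_diff[OF D0 Rr] w(1)])
    also have "\<dots> = (\<Sum>j<M. L2_inner (x j) (x (Suc j)) (\<lambda>y. D 1 y - r y) w)"
      by (rule L2_inner_mesh[OF P acd_L2[OF acd_diff[OF D0 Rr]] acd_L2[OF w(1)]])
    also have "\<dots> = 0"
    proof (rule sum.neutral, rule ballI)
      fix j assume "j \<in> {..<M}" then have j: "j < M" by simp
      have "L2_inner (x j) (x (Suc j)) (\<lambda>y. D 1 y - r y) w =
        L2_inner (x j) (x (Suc j)) (\<lambda>y. D 1 y - poly (pderiv (q j)) y) (poly (pderiv (p j)))"
        by (rule L2_inner_cong) (simp_all add: r[OF j] w(3)[OF j])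
      also have "\<dots> = 0" by (rule q(4)[OF j w(2)[OF j]])
      finally show "L2_inner (x j) (x (Suc j)) (\<lambda>y. D 1 y - r y) w = 0" .
    qed
    finally show ?thesis .
  qed
  then have ritz: "ritz M x k (D 0) R" using RS by (simp add: ritz_def)
  have "L2_norm 0 1 (\<lambda>y. D 0 y - R y) \<le> mesh_size M x ^ Suc k * L2_norm 0 1 (D (Suc k))"
  proof (rule L2_norm_mesh_le[OF P acd_L2_fun[OF acd_diff[OF D0 Rr]] acd_L2[OF chain[of k]]])
    fix j assume j: "j < M"
    have "L2_norm (x j) (x (Suc j)) (\<lambda>y. D 0 y - R y) = L2_norm (x j) (x (Suc j)) (\<lambda>y. D 0 y - poly (q j) y)"
      by (rule L2_norm_cong) (simp add: R[OF j])
    then show "L2_norm (x j) (x (Suc j)) (\<lambda>y. D 0 y - R y) \<le> (x (Suc j) - x j) ^ Suc k * L2_norm (x j) (x (Suc j)) (D (Suc k))"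
      using q(5)[OF j] by simp
  qed simp
  then show ?thesis using ritz by blast
qed

text \<open>Uniqueness transfers the bound from the constructed projection to any other, in
  particular to one obtained as a difference.\<close>

lemma ritz_error:
  assumes P: "is_partition M x" and k: "1 \<le> k" and chain: "\<And>j. j \<le> k \<Longrightarrow> acd 0 1 (D j) (D (Suc j))"
    and bd: "D 0 0 = 0" "D 0 1 = 0" and r: "ritz M x k (D 0) R"
  shows "L2_norm 0 1 (\<lambda>y. D 0 y - R y) \<le> mesh_size M x ^ Suc k * L2_norm 0 1 (D (Suc k))"
proof -
  obtain R' where R': "ritz M x k (D 0) R'" "L2_norm 0 1 (\<lambda>y. D 0 y - R' y) \<le> mesh_size M x ^ Suc k * L2_norm 0 1 (D (Suc k))"
    using ritz_exists[where D=D, OF P k chain bd] by blast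
  have "R y = R' y" if "y \<in> {0..1}" for y by (rule ritz_unique[OF P r R'(1) chain[of 0] that]) simp
  then have "L2_norm 0 1 (\<lambda>y. D 0 y - R y) = L2_norm 0 1 (\<lambda>y. D 0 y - R' y)" by (intro L2_norm_cong) simp
  then show ?thesis using R'(2) by simp
qed

lemma interpolation_error:
  assumes P: "is_partition M x" and k: "1 \<le> k" and \<xi>: "reference_nodes \<xi>"
    and chain: "\<And>j. j \<le> k \<Longrightarrow> acd 0 1 (D j) (D (Suc j))"
    and AE: "AE y in leb 0 1. w y = D 0 y" and W: "is_interpolant \<xi> M x k w W"
  shows "L2_norm 0 1 (\<lambda>y. D 0 y - W y) \<le> mesh_size M x ^ Suc k * L2_norm 0 1 (D (Suc k))"
proof -
  obtain w' where w': "continuous_on {0..1} w'" "AE y in leb 0 1. w' y = w y"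
    "\<And>j r. j < M \<Longrightarrow> r \<le> k \<Longrightarrow> W (x j + (x (Suc j) - x j) * \<xi> k r) = w' (x j + (x (Suc j) - x j) * \<xi> k r)"
    using W unfolding is_interpolant_def Let_def by blast
  have WS: "W \<in> fe_space M x k" using W by (simp add: is_interpolant_def)
  have D0: "acd 0 1 (D 0) (D 1)" using chain[of 0] by simp
  have "AE y in leb 0 1. w' y = D 0 y" using w'(2) AE by eventually_elim simp
  \<comment> \<open>Both functions are continuous, so the nodal values prescribed through
    \<open>w'\<close> are those of \<open>D 0\<close>.\<close>
  then have w'D: "w' y = D 0 y" if "y \<in> {0..1}" for y
    using continuous_AE_eq[OF zero_less_one w'(1) acd_continuous[OF D0] _ that] by blast
  obtain V p where V: "acd 0 1 W V" "\<And>j. j < M \<Longrightarrow> degree (p j) \<le> k"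
      "\<And>j y. j < M \<Longrightarrow> y \<in> {x j..x (Suc j)} \<Longrightarrow> W y = poly (p j) y"
    by (rule fe_acd[OF P WS], rule that)
  have \<xi>k: "\<xi> k 0 = 0" "\<xi> k k = 1" "\<And>r. r < k \<Longrightarrow> \<xi> k r < \<xi> k (Suc r)" using \<xi> k by (auto simp: reference_nodes_def)
  have \<xi>mono: "r \<le> s \<Longrightarrow> s \<le> k \<Longrightarrow> \<xi> k r \<le> \<xi> k s" for r s
  proof (induction s)
    case (Suc s)
    then show ?case using \<xi>k(3)[of s] by (cases "r = Suc s") auto
  qed simp
  show ?thesis
  proof (rule L2_norm_mesh_le[OF P acd_L2_fun[OF acd_diff[OF D0 V(1)]] acd_L2[OF chain[of k]]])
    fix j assume j: "j < M"
    define l where "l = x (Suc j) - x j"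
    have l: "0 < l" using partition_less[OF P, of j "Suc j"] j by (simp add: l_def)
    have xj: "0 \<le> x j" "x (Suc j) \<le> 1" using partition_bounds[OF P] j by auto
    define z where "z r = x j + l * \<xi> k r" for r
    have zI: "z r \<in> {x j..x (Suc j)}" if "r \<le> k" for r
    proof -
      have \<xi>01: "0 \<le> \<xi> k r" "\<xi> k r \<le> 1" using \<xi>mono[of 0 r] \<xi>mono[of r k] that \<xi>k by auto
      then have "0 \<le> l * \<xi> k r" "l * \<xi> k r \<le> l * 1" using l by (auto intro!: mult_left_mono)
      then show ?thesis by (simp add: z_def l_def)
    qed
    have "L2_norm (x j) (x (Suc j)) (\<lambda>y. D 0 y - poly (p j) y) \<le> (x (Suc j) - x j) ^ Suc k * L2_norm (x j) (x (Suc j)) (D (Suc k))"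
    proof (rule interpolation_error_element[OF _ V(2)[OF j]])
      show "acd (x j) (x (Suc j)) (D i) (D (Suc i))" if "i \<le> k" for i
        using acd_sub[OF chain[OF that] xj(1) _ xj(2)] l by (simp add: l_def)
      show "z r < z (Suc r)" if "r < k" for r
        using mult_strict_left_mono[OF \<xi>k(3)[OF that] l] by (simp add: z_def)
      show "z r \<in> {x j..x (Suc j)} \<and> poly (p j) (z r) = D 0 (z r)" if r: "r \<le> k" for r
      proof -
        have "poly (p j) (z r) = W (z r)" using V(3)[OF j zI[OF r]] by simp
        also have "\<dots> = w' (z r)" using w'(3)[OF j r] by (simp add: z_def l_def)
        also have "\<dots> = D 0 (z r)" using zI[OF r] xj by (intro w'D) auto
        finally show ?thesis using zI[OF r] by simp
      qed
    qed
    moreover have "L2_norm (x j) (x (Suc j)) (\<lambda>y. D 0 y - W y) = L2_norm (x j) (x (Suc j)) (\<lambda>y. D 0 y - poly (p j) y)"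
      by (rule L2_norm_cong) (simp add: V(3)[OF j])
    ultimately show "L2_norm (x j) (x (Suc j)) (\<lambda>y. D 0 y - W y) \<le> (x (Suc j) - x j) ^ Suc k * L2_norm (x j) (x (Suc j)) (D (Suc k))" by simp
  qed simp
qed

section \<open>Regularity of the solution in time and space\<close>

lemma Linf_norm_finite_bochner:
  assumes "Linf_norm T X N u < \<infinity>" shows "bochner_measurable T X N u"
proof (rule ccontr)
  assume "\<not> bochner_measurable T X N u"
  then have "Linf_norm T X N u = \<infinity>" unfolding Linf_norm_def by (rule if_not_P)
  then show False using assms by simp
qed

lemma Linf_norm_finite_AE:
  assumes "Linf_norm T X N u < \<infinity>" shows "AE t in leb 0 T. u t \<in> X"
proof -
  obtain S where "AE t in leb 0 T. u t \<in> X \<and> (\<lambda>n. N (\<lambda>y. S n t y - u t y)) \<longlonglongrightarrow> (0::real)"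
    using Linf_norm_finite_bochner[OF assms] unfolding bochner_measurable_def by blast
  then show ?thesis by eventually_elim simp
qed

text \<open>Every number above the infimum is an essential bound; the slack 1 avoids showing that
  the infimum is attained.\<close>

lemma Linf_norm_AE:
  assumes "Linf_norm T X N u \<le> ereal R"
  shows "AE t in leb 0 T. u t \<in> X \<and> N (u t) \<le> R + 1"
proof -
  have fin: "Linf_norm T X N u < \<infinity>" using assms by (rule le_less_trans) simp
  note bm = Linf_norm_finite_bochner[OF fin] and X = Linf_norm_finite_AE[OF fin]
  have "\<exists>r\<in>{ereal R |R. AE t in leb 0 T. N (u t) \<le> R}. r < ereal (R + 1)"
  proof (rule Inf_less_iff[THEN iffD1])
    have "Inf {ereal R |R. AE t in leb 0 T. N (u t) \<le> R} \<le> ereal R"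
      using assms bm unfolding Linf_norm_def by (simp only: if_True)
    also have "\<dots> < ereal (R + 1)" by simp
    finally show "Inf {ereal R |R. AE t in leb 0 T. N (u t) \<le> R} < ereal (R + 1)" .
  qed
  then obtain r where r: "AE t in leb 0 T. N (u t) \<le> r" "r < R + 1" by auto
  from r(1) X show ?thesis by eventually_elim (use r(2) in auto)
qed

text \<open>The positive part of \<open>f t - R\<close> is continuous and vanishes almost
  everywhere.\<close>

lemma AE_le_imp_le_continuous:
  fixes f :: "real \<Rightarrow> real"
  assumes "a < b" "continuous_on {a..b} f" "AE t in leb a b. f t \<le> R" "t \<in> {a..b}"
  shows "f t \<le> R"
proof -
  have "max (f t - R) 0 = 0"
  proof (rule continuous_AE_eq[OF assms(1) _ _ _ assms(4)])
    show "continuous_on {a..b} (\<lambda>t. max (f t - R) 0)" by (intro continuous_on_max continuous_on_diff continuous_on_const assms(2))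
    show "AE t in leb a b. max (f t - R) 0 = 0" using assms(3) by eventually_elim simp
  qed simp
  then show ?thesis by linarith
qed

section \<open>Regularity in time\<close>

lemma continuous_in_L2_L2: "continuous_in_L2 T u \<Longrightarrow> t \<in> {0..T} \<Longrightarrow> u t \<in> L2 0 1"
  by (simp add: continuous_in_L2_def)

lemma continuous_in_L2_inner:
  assumes "continuous_in_L2 T u" "\<psi> \<in> L2 0 1"
  shows "continuous_on {0..T} (\<lambda>t. L2_inner 0 1 (u t) \<psi>)"
  unfolding continuous_on_def
proof
  fix t assume t: "t \<in> {0..T}"
  have "((\<lambda>s. L2_inner 0 1 (u s) \<psi> - L2_inner 0 1 (u t) \<psi>) \<longlongrightarrow> 0) (at t within {0..T})"
  proof (rule Lim_null_comparison)
    have "\<bar>L2_inner 0 1 (u s) \<psi> - L2_inner 0 1 (u t) \<psi>\<bar> \<le> L2_norm 0 1 (\<lambda>y. u s y - u t y) * L2_norm 0 1 \<psi>" if "s \<in> {0..T}" for s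
      using L2_Cauchy_Schwarz[OF L2_diff[OF continuous_in_L2_L2[OF assms(1) that] continuous_in_L2_L2[OF assms(1) t]] assms(2)]
        L2_inner_diff_left[OF continuous_in_L2_L2[OF assms(1) that] continuous_in_L2_L2[OF assms(1) t] assms(2)] by simp
    then show "\<forall>\<^sub>F s in at t within {0..T}. norm (L2_inner 0 1 (u s) \<psi> - L2_inner 0 1 (u t) \<psi>) \<le> L2_norm 0 1 (\<lambda>y. u s y - u t y) * L2_norm 0 1 \<psi>"
      unfolding eventually_at_filter by (intro always_eventually) simp
    have "((\<lambda>s. L2_norm 0 1 (\<lambda>y. u s y - u t y)) \<longlongrightarrow> 0) (at t within {0..T})"
      using assms(1) t by (simp add: continuous_in_L2_def)
    from tendsto_mult_left_zero[OF this]
    show "((\<lambda>s. L2_norm 0 1 (\<lambda>y. u s y - u t y) * L2_norm 0 1 \<psi>) \<longlongrightarrow> 0) (at t within {0..T})" .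
  qed
  then show "((\<lambda>s. L2_inner 0 1 (u s) \<psi>) \<longlongrightarrow> L2_inner 0 1 (u t) \<psi>) (at t within {0..T})" by (simp add: LIM_zero_iff)
qed

text \<open>Test with \<open>w\<close> itself. This turns bounds on scalar functions of time back
  into norm bounds.\<close>

lemma L2_norm_le_dual:
  assumes "w \<in> L2 a b" "\<And>\<psi>. \<psi> \<in> L2 a b \<Longrightarrow> \<bar>L2_inner a b w \<psi>\<bar> \<le> R * L2_norm a b \<psi>" "0 \<le> R"
  shows "L2_norm a b w \<le> R"
proof (rule le_of_square_le_mult[OF L2_norm_nonneg assms(3)])
  show "(L2_norm a b w)\<^sup>2 \<le> L2_norm a b w * R"
    using assms(2)[OF assms(1)] unfolding L2_norm_sq by (simp add: mult.commute)
qed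

lemma L2_abs: "u \<in> L2 a b \<Longrightarrow> (\<lambda>x. \<bar>u x\<bar>) \<in> L2 a b"
  by (auto simp: L2_def)

text \<open>The hypothesis says that the distributional derivative is bounded by \<open>R\<close>.
  Riesz representation first gives it as a square integrable \<open>g\<close>; approximating
  indicators by test functions then bounds the integral of \<open>g\<close> over an interval by
  \<open>R\<close> times its length.\<close>

lemma continuous_Lipschitz_of_weak_bound:
  fixes f :: "real \<Rightarrow> real"
  assumes T: "0 < T" and f: "continuous_on {0..T} f" and R: "0 \<le> R"
    and bound: "\<And>\<phi>. \<phi> \<in> test_functions 0 T \<Longrightarrow> \<bar>L2_inner 0 T f (deriv \<phi>)\<bar> \<le> R * (LINT t|leb 0 T. \<bar>\<phi> t\<bar>)"
    and s: "s \<in> {0..T}" and t: "t \<in> {0..T}"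
  shows "\<bar>f t - f s\<bar> \<le> R * \<bar>t - s\<bar>"
proof -
  have fL: "f \<in> L2 0 T" by (rule L2_continuous[OF f])
  have "\<exists>g\<in>L2 0 T. L2_norm 0 T g \<le> R * sqrt T \<and> is_weak_deriv 0 T 1 f g"
  proof (rule weak_deriv_of_bound[OF less_imp_le[OF T] fL])
    fix \<phi> assume \<phi>: "\<phi> \<in> test_functions 0 T"
    have "\<bar>LINT t|leb 0 T. \<bar>\<phi> t\<bar>\<bar> \<le> sqrt (T - 0) * L2_norm 0 T (\<lambda>t. \<bar>\<phi> t\<bar>)"
      by (rule abs_LINT_le_L2[OF less_imp_le[OF T] L2_abs[OF test_L2[OF \<phi>]]])
    also have "L2_norm 0 T (\<lambda>t. \<bar>\<phi> t\<bar>) = L2_norm 0 T \<phi>" by (simp add: L2_norm_def L2_inner_def)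
    finally have "R * (LINT t|leb 0 T. \<bar>\<phi> t\<bar>) \<le> R * (sqrt T * L2_norm 0 T \<phi>)" using R by (intro mult_left_mono) auto
    then show "\<bar>L2_inner 0 T f ((deriv ^^ 1) \<phi>)\<bar> \<le> R * sqrt T * L2_norm 0 T \<phi>" using bound[OF \<phi>] by (simp add: mult.assoc)
  qed (use R T in simp)
  then obtain g where g: "g \<in> L2 0 T" "is_weak_deriv 0 T 1 f g" by blast
  obtain D where D: "AE x in leb 0 T. f x = D 0 x" "D 1 = g" "\<forall>j<1. acd 0 T (D j) (D (Suc j))"
    using weak_deriv_chain[OF T fL g] by blast
  have D0: "acd 0 T (D 0) g" using D(2,3) by simp
  have "f x = D 0 x" if "x \<in> {0..T}" for x by (rule continuous_AE_eq[OF T f acd_continuous[OF D0] D(1) that])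
  then have fg: "acd 0 T f g" by (intro acd_cong[OF D0]) simp_all
  have int: "\<bar>f t - f s\<bar> \<le> R * \<bar>t - s\<bar>" if st: "0 < s" "s \<le> t" "t < T" for s t
  proof -
    obtain \<phi> where \<phi>: "\<And>n::nat. \<phi> n \<in> test_functions 0 T" "\<And>n x. 0 \<le> \<phi> n x \<and> \<phi> n x \<le> 1"
      "\<And>x. (\<lambda>n. \<phi> n x) \<longlonglongrightarrow> indicator {s<..t} x"
      using test_approx_indicator[OF st] by blast
    have 1: "(\<lambda>n. \<bar>LINT x|leb 0 T. g x * \<phi> n x\<bar>) \<longlonglongrightarrow> \<bar>LINT x|leb s t. g x\<bar>"
      by (intro tendsto_rabs test_approx_LINT[OF st L2_integrable[OF g(1)] \<phi>])
    have 2: "(\<lambda>n. R * (LINT x|leb 0 T. 1 * \<phi> n x)) \<longlonglongrightarrow> R * (LINT x|leb s t. 1)"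
      by (intro tendsto_intros test_approx_LINT[OF st L2_integrable[OF L2_const] \<phi>])
    have "\<bar>LINT x|leb 0 T. g x * \<phi> n x\<bar> \<le> R * (LINT x|leb 0 T. 1 * \<phi> n x)" for n
    proof -
      have "\<bar>LINT x|leb 0 T. g x * \<phi> n x\<bar> = \<bar>L2_inner 0 T f (deriv (\<phi> n))\<bar>"
        using g(2) \<phi>(1)[of n] by (simp add: is_weak_deriv_def L2_inner_def)
      also have "\<dots> \<le> R * (LINT x|leb 0 T. \<bar>\<phi> n x\<bar>)" by (rule bound[OF \<phi>(1)])
      also have "(\<lambda>x. \<bar>\<phi> n x\<bar>) = (\<lambda>x. 1 * \<phi> n x)" using \<phi>(2)[of n] by (auto simp: fun_eq_iff)
      finally show ?thesis .
    qed
    then have "\<bar>LINT x|leb s t. g x\<bar> \<le> R * (LINT x|leb s t. 1)" by (intro LIMSEQ_le[OF 1 2]) blast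
    then show ?thesis using acd_diff_eq[OF fg, of s t] st LINT_leb_const[of s t 1] by (simp del: integral_const)
  qed
  \<comment> \<open>So far the interval stays away from 0 and \<open>T\<close>, because test
    functions have compact support; continuity closes the gap, one argument at a time.\<close>
  have cl: "closure {0<..<T} = {0..T}" using T by (rule closure_greaterThanLessThan)
  have int': "\<bar>f t - f s\<bar> - R * \<bar>t - s\<bar> \<le> 0" if "s \<in> {0<..<T}" "t \<in> {0<..<T}" for s t
    using int[of s t] int[of t s] that by (cases "s \<le> t") (auto simp: abs_minus_commute)
  have left: "\<bar>f t - f s\<bar> - R * \<bar>t - s\<bar> \<le> 0" if "s \<in> {0..T}" "t \<in> {0<..<T}" for s t
  proof (rule continuous_le_on_closure[where S="{0<..<T}" and f="\<lambda>s. \<bar>f t - f s\<bar> - R * \<bar>t - s\<bar>"])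
    show "continuous_on (closure {0<..<T}) (\<lambda>s. \<bar>f t - f s\<bar> - R * \<bar>t - s\<bar>)"
      unfolding cl by (intro continuous_intros f)
    show "s \<in> closure {0<..<T}" using that cl by simp
  qed (use int' that in blast)
  have "\<bar>f t - f s\<bar> - R * \<bar>t - s\<bar> \<le> 0"
  proof (rule continuous_le_on_closure[where S="{0<..<T}" and f="\<lambda>t. \<bar>f t - f s\<bar> - R * \<bar>t - s\<bar>"])
    show "continuous_on (closure {0<..<T}) (\<lambda>t. \<bar>f t - f s\<bar> - R * \<bar>t - s\<bar>)"
      unfolding cl by (intro continuous_intros f)
    show "t \<in> closure {0<..<T}" using t cl by simp
  qed (use left s in blast)
  then show ?thesis by simp
qed

text \<open>No measurability of \<open>h\<close> is assumed: otherwise the integral is \<open>0\<close>.\<close>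

lemma abs_LINT_le_AE:
  fixes h g :: "real \<Rightarrow> real"
  assumes "integrable M g" "AE x in M. \<bar>h x\<bar> \<le> g x"
  shows "\<bar>LINT x|M. h x\<bar> \<le> (LINT x|M. g x)"
proof (cases "integrable M h")
  case True
  have "\<bar>LINT x|M. h x\<bar> \<le> (LINT x|M. \<bar>h x\<bar>)" by (rule integral_abs_bound)
  also have "\<dots> \<le> (LINT x|M. g x)" using True assms by (intro integral_mono_AE) auto
  finally show ?thesis .
next
  case False
  have "AE x in M. 0 \<le> g x" using assms(2) by eventually_elim linarith
  then have "0 \<le> (LINT x|M. g x)" by (rule integral_nonneg_AE)
  then show ?thesis using False by (simp add: not_integrable_integral_eq)
qed

text \<open>Pairing with a fixed \<open>\<psi>\<close> makes the problem scalar. As the bound is on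
  the pairing and not on \<open>ut\<close>, \<open>\<psi>\<close> may be a high derivative of a test
  function.\<close>

lemma weak_time_deriv_Lipschitz:
  assumes T: "0 < T" and wt: "weak_time_deriv T u ut" and u: "continuous_in_L2 T u" and \<psi>: "\<psi> \<in> L2 0 1"
    and K: "0 \<le> K" and AE: "AE r in leb 0 T. \<bar>L2_inner 0 1 (ut r) \<psi>\<bar> \<le> K"
    and st: "s \<in> {0..T}" "t \<in> {0..T}"
  shows "\<bar>L2_inner 0 1 (u t) \<psi> - L2_inner 0 1 (u s) \<psi>\<bar> \<le> K * \<bar>t - s\<bar>"
proof (rule continuous_Lipschitz_of_weak_bound[OF T continuous_in_L2_inner[OF u \<psi>] K _ st])
  fix \<phi> assume \<phi>: "\<phi> \<in> test_functions 0 T"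
  have "L2_inner 0 T (\<lambda>t. L2_inner 0 1 (u t) \<psi>) (deriv \<phi>) = - (LINT t|leb 0 T. \<phi> t * L2_inner 0 1 (ut t) \<psi>)"
    using wt \<phi> \<psi> unfolding weak_time_deriv_def by (simp add: L2_inner_def[of 0 T] mult.commute)
  moreover have "\<bar>LINT t|leb 0 T. \<phi> t * L2_inner 0 1 (ut t) \<psi>\<bar> \<le> (LINT t|leb 0 T. K * \<bar>\<phi> t\<bar>)"
  proof (rule abs_LINT_le_AE)
    show "integrable (leb 0 T) (\<lambda>t. K * \<bar>\<phi> t\<bar>)" by (intro L2_integrable L2_cmult L2_abs test_L2[OF \<phi>])
    show "AE t in leb 0 T. \<bar>\<phi> t * L2_inner 0 1 (ut t) \<psi>\<bar> \<le> K * \<bar>\<phi> t\<bar>"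
      using AE
    proof eventually_elim
      fix t assume "\<bar>L2_inner 0 1 (ut t) \<psi>\<bar> \<le> K"
      then have "\<bar>\<phi> t\<bar> * \<bar>L2_inner 0 1 (ut t) \<psi>\<bar> \<le> \<bar>\<phi> t\<bar> * K" by (rule mult_left_mono) simp
      then show "\<bar>\<phi> t * L2_inner 0 1 (ut t) \<psi>\<bar> \<le> K * \<bar>\<phi> t\<bar>" by (simp add: abs_mult mult.commute)
    qed
  qed
  ultimately show "\<bar>L2_inner 0 T (\<lambda>t. L2_inner 0 1 (u t) \<psi>) (deriv \<phi>)\<bar> \<le> K * (LINT t|leb 0 T. \<bar>\<phi> t\<bar>)" by simp
qed

text \<open>The difference between the pairing and the primitive of the candidate derivative has
  weak derivative 0, hence is Lipschitz with constant 0.\<close>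

lemma weak_time_deriv_acd:
  assumes T: "0 < T" and wt: "weak_time_deriv T u ut" and u: "continuous_in_L2 T u" "continuous_in_L2 T ut" and \<psi>: "\<psi> \<in> L2 0 1"
  shows "acd 0 T (\<lambda>t. L2_inner 0 1 (u t) \<psi>) (\<lambda>t. L2_inner 0 1 (ut t) \<psi>)"
proof -
  define f where "f t = L2_inner 0 1 (u t) \<psi>" for t
  define g where "g t = L2_inner 0 1 (ut t) \<psi>" for t
  have f: "continuous_on {0..T} f" and g: "continuous_on {0..T} g"
    unfolding f_def g_def by (intro continuous_in_L2_inner u \<psi>)+
  define G where "G t = 0 + (LINT s|leb 0 t. g s)" for t
  have G: "acd 0 T G g" unfolding G_def by (rule acd_integral[OF L2_continuous[OF g]])
  have const: "\<bar>(f t - G t) - (f 0 - G 0)\<bar> \<le> 0 * \<bar>t - 0\<bar>" if "t \<in> {0..T}" for t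
  proof (rule continuous_Lipschitz_of_weak_bound[OF T, of "\<lambda>t. f t - G t"])
    show "continuous_on {0..T} (\<lambda>t. f t - G t)" by (intro continuous_on_diff f acd_continuous[OF G])
    fix \<phi> assume \<phi>: "\<phi> \<in> test_functions 0 T"
    have "L2_inner 0 T f (deriv \<phi>) = - (LINT t|leb 0 T. \<phi> t * g t)"
      using wt \<phi> \<psi> unfolding weak_time_deriv_def f_def g_def by (simp add: L2_inner_def[of 0 T] mult.commute)
    moreover have "L2_inner 0 T G (deriv \<phi>) = - L2_inner 0 T g \<phi>"
      using bspec[OF acd_is_weak_deriv[OF less_imp_le[OF T] G, unfolded is_weak_deriv_def] \<phi>] by simp
    ultimately have "L2_inner 0 T (\<lambda>t. f t - G t) (deriv \<phi>) = 0"
      using L2_inner_diff_left[OF L2_continuous[OF f] acd_L2_fun[OF G] test_L2[OF test_deriv[OF \<phi>]]] by (simp add: L2_inner_def mult.commute)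
    then show "\<bar>L2_inner 0 T (\<lambda>t. f t - G t) (deriv \<phi>)\<bar> \<le> 0 * (LINT t|leb 0 T. \<bar>\<phi> t\<bar>)" by simp
  qed (use that T in auto)
  have "acd 0 T f g"
  proof (rule acd_cong[OF acd_add[OF G acd_const[of 0 T "f 0 - G 0"]]])
    show "G t + (f 0 - G 0) = f t" if "t \<in> {0..T}" for t using const[OF that] by simp
  qed simp
  then show ?thesis by (simp add: f_def[abs_def] g_def[abs_def])
qed

text \<open>Expansion around the later time \<open>t\<close>, as the scheme is implicit. The
  Lipschitz bound for the pairing with \<open>ut\<close> is integrated crudely, so the usual factor
  1/2 is lost.\<close>

lemma weak_time_deriv_taylor:
  assumes T: "0 < T" and wt: "weak_time_deriv T u ut" "weak_time_deriv T ut utt"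
    and u: "continuous_in_L2 T u" "continuous_in_L2 T ut" and R: "0 \<le> R"
    and AE: "AE r in leb 0 T. utt r \<in> L2 0 1 \<and> L2_norm 0 1 (utt r) \<le> R"
    and st: "0 \<le> s" "s \<le> t" "t \<le> T"
  shows "L2_norm 0 1 (\<lambda>y. u t y - u s y - (t - s) * ut t y) \<le> R * (t - s)\<^sup>2"
proof (rule L2_norm_le_dual)
  note L2 = continuous_in_L2_L2[OF u(1), of s] continuous_in_L2_L2[OF u(1), of t] continuous_in_L2_L2[OF u(2), of t]
  have L: "u s \<in> L2 0 1" "u t \<in> L2 0 1" "ut t \<in> L2 0 1" using L2 st by auto
  show "(\<lambda>y. u t y - u s y - (t - s) * ut t y) \<in> L2 0 1" by (intro L2_diff L2_cmult L)
  show "0 \<le> R * (t - s)\<^sup>2" using R by simp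
  fix \<psi> assume \<psi>: "\<psi> \<in> L2 0 1"
  let ?g = "\<lambda>r. L2_inner 0 1 (ut r) \<psi>"
  have lip: "\<bar>?g r - ?g t\<bar> \<le> (R * L2_norm 0 1 \<psi>) * \<bar>r - t\<bar>" if "r \<in> {0..T}" for r
  proof (rule weak_time_deriv_Lipschitz[OF T wt(2) u(2) \<psi>])
    show "AE r in leb 0 T. \<bar>L2_inner 0 1 (utt r) \<psi>\<bar> \<le> R * L2_norm 0 1 \<psi>"
      using AE
    proof eventually_elim
      fix r assume r: "utt r \<in> L2 0 1 \<and> L2_norm 0 1 (utt r) \<le> R"
      have "\<bar>L2_inner 0 1 (utt r) \<psi>\<bar> \<le> L2_norm 0 1 (utt r) * L2_norm 0 1 \<psi>" using r \<psi> by (intro L2_Cauchy_Schwarz) auto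
      also have "\<dots> \<le> R * L2_norm 0 1 \<psi>" using r by (intro mult_right_mono) auto
      finally show "\<bar>L2_inner 0 1 (utt r) \<psi>\<bar> \<le> R * L2_norm 0 1 \<psi>" .
    qed
  qed (use R that st in auto)
  have fg: "acd 0 T (\<lambda>t. L2_inner 0 1 (u t) \<psi>) ?g" by (rule weak_time_deriv_acd[OF T wt(1) u \<psi>])
  have gint: "integrable (leb s t) ?g" using st by (intro integrable_leb_sub[OF st(1,2,3) L2_integrable[OF acd_L2[OF fg]]])
  have "L2_inner 0 1 (\<lambda>y. u t y - u s y - (t - s) * ut t y) \<psi> = (L2_inner 0 1 (u t) \<psi> - L2_inner 0 1 (u s) \<psi>) - (t - s) * ?g t"
    using L2_inner_diff_left[OF L2_diff[OF L(2,1)] L2_cmult[OF L(3)] \<psi>] L2_inner_diff_left[OF L(2,1) \<psi>] by (simp add: L2_inner_cmult_left)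
  also have "\<dots> = (LINT r|leb s t. ?g r) - (LINT r|leb s t. ?g t)"
    unfolding acd_diff_eq[OF fg st] LINT_leb_const[OF st(2)] by simp
  also have "\<dots> = (LINT r|leb s t. ?g r - ?g t)"
    by (rule Bochner_Integration.integral_diff[symmetric, OF gint L2_integrable[OF L2_const]])
  finally have eq: "L2_inner 0 1 (\<lambda>y. u t y - u s y - (t - s) * ut t y) \<psi> = (LINT r|leb s t. ?g r - ?g t)" .
  have "\<bar>LINT r|leb s t. ?g r - ?g t\<bar> \<le> (LINT r|leb s t. (R * L2_norm 0 1 \<psi>) * (t - s))"
  proof (rule abs_LINT_le_AE[OF L2_integrable[OF L2_const] AE_I2])
    fix r assume "r \<in> space (leb s t)"
    then have r: "s < r" "r < t" by auto
    have "\<bar>?g r - ?g t\<bar> \<le> (R * L2_norm 0 1 \<psi>) * \<bar>r - t\<bar>" using r st by (intro lip) auto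
    also have "\<dots> \<le> (R * L2_norm 0 1 \<psi>) * (t - s)" using r R by (intro mult_left_mono) auto
    finally show "\<bar>?g r - ?g t\<bar> \<le> (R * L2_norm 0 1 \<psi>) * (t - s)" .
  qed
  also have "\<dots> = R * (t - s)\<^sup>2 * L2_norm 0 1 \<psi>" unfolding LINT_leb_const[OF st(2)] by (simp add: power2_eq_square)
  finally show "\<bar>L2_inner 0 1 (\<lambda>y. u t y - u s y - (t - s) * ut t y) \<psi>\<bar> \<le> R * (t - s)\<^sup>2 * L2_norm 0 1 \<psi>" unfolding eq .
qed

section \<open>Spatial derivatives and boundary values by duality\<close>

lemma sobolev_weak_deriv:
  assumes "u \<in> sobolev a b m" "j \<le> m"
  shows "weak_deriv a b j u \<in> L2 a b" "is_weak_deriv a b j u (weak_deriv a b j u)"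
    "L2_norm a b (weak_deriv a b j u) \<le> sobolev_norm a b m u"
proof -
  obtain w where "w \<in> L2 a b" "is_weak_deriv a b j u w" using assms unfolding sobolev_def by blast
  then show "weak_deriv a b j u \<in> L2 a b" "is_weak_deriv a b j u (weak_deriv a b j u)" using weak_deriv_spec by blast+
  have "(L2_norm a b (weak_deriv a b j u))\<^sup>2 \<le> (\<Sum>j\<le>m. (L2_norm a b (weak_deriv a b j u))\<^sup>2)"
    using assms(2) by (intro member_le_sum) auto
  then show "L2_norm a b (weak_deriv a b j u) \<le> sobolev_norm a b m u"
    unfolding sobolev_norm_def by (rule real_le_rsqrt)
qed

text \<open>The left-hand side sees \<open>u\<close> only through a scalar product with a fixed
  function; this is what makes it continuous in time when \<open>u\<close> is.\<close>

lemma weak_deriv_dual_bound: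
  assumes "is_weak_deriv a b j u w" "w \<in> L2 a b" "L2_norm a b w \<le> R" "\<phi> \<in> test_functions a b"
  shows "\<bar>L2_inner a b u ((deriv ^^ j) \<phi>)\<bar> \<le> R * L2_norm a b \<phi>"
proof -
  have "\<bar>L2_inner a b u ((deriv ^^ j) \<phi>)\<bar> = \<bar>L2_inner a b w \<phi>\<bar>"
    using assms(1,4) by (simp add: is_weak_deriv_def abs_mult power_abs)
  also have "\<dots> \<le> L2_norm a b w * L2_norm a b \<phi>" by (rule L2_Cauchy_Schwarz[OF assms(2) test_L2[OF assms(4)]])
  also have "\<dots> \<le> R * L2_norm a b \<phi>" using assms(3) by (rule mult_right_mono) simp
  finally show ?thesis .
qed

lemma is_weak_deriv_diff:
  assumes "is_weak_deriv a b j u w" "is_weak_deriv a b j u' w'" "u \<in> L2 a b" "u' \<in> L2 a b" "w \<in> L2 a b" "w' \<in> L2 a b"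
  shows "is_weak_deriv a b j (\<lambda>x. u x - u' x) (\<lambda>x. w x - w' x)"
  unfolding is_weak_deriv_def
proof
  fix \<phi> assume \<phi>: "\<phi> \<in> test_functions a b"
  then show "L2_inner a b (\<lambda>x. u x - u' x) ((deriv ^^ j) \<phi>) = (- 1) ^ j * L2_inner a b (\<lambda>x. w x - w' x) \<phi>"
    using assms(1,2) L2_inner_diff_left[OF assms(3,4) test_L2[OF test_deriv_iter[OF \<phi>]]] L2_inner_diff_left[OF assms(5,6) test_L2[OF \<phi>]]
    by (simp add: is_weak_deriv_def right_diff_distrib)
qed

text \<open>By uniqueness of weak derivatives the norm of the given one equals that of the Riesz
  representative.\<close>

lemma weak_deriv_norm_le_dual:
  assumes "a \<le> b" "is_weak_deriv a b m u w" "w \<in> L2 a b" "u \<in> L2 a b" "0 \<le> R"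
    "\<And>\<phi>. \<phi> \<in> test_functions a b \<Longrightarrow> \<bar>L2_inner a b u ((deriv ^^ m) \<phi>)\<bar> \<le> R * L2_norm a b \<phi>"
  shows "L2_norm a b w \<le> R"
proof -
  obtain w' where w': "w' \<in> L2 a b" "L2_norm a b w' \<le> R" "is_weak_deriv a b m u w'"
    using weak_deriv_of_bound[OF assms(1,4,5,6)] by blast
  have "L2_norm a b w = L2_norm a b w'"
    by (rule L2_norm_cong_AE[OF assms(3) w'(1) weak_deriv_unique[OF assms(2) w'(3) assms(3) w'(1)]])
  then show ?thesis using w'(2) by simp
qed

lemma test_weak_deriv: "\<phi> \<in> test_functions a b \<Longrightarrow> a \<le> b \<Longrightarrow> is_weak_deriv a b 1 \<phi> (deriv \<phi>)"
  by (rule acd_is_weak_deriv[OF _ acd_test])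

lemma is_weak_deriv_0: "is_weak_deriv a b 0 u u"
  by (simp add: is_weak_deriv_def)

lemma test_sobolev0:
  assumes "\<phi> \<in> test_functions a b" "a \<le> b" shows "\<phi> \<in> sobolev0 a b"
  unfolding sobolev0_def
proof (intro CollectI conjI allI impI)
  have "\<exists>w\<in>L2 a b. is_weak_deriv a b j \<phi> w" if "j \<le> 1" for j
    using that test_weak_deriv[OF assms] is_weak_deriv_0[of a b \<phi>] test_L2[OF assms(1)] test_L2[OF test_deriv[OF assms(1)]]
    by (cases "j = 0") (auto simp: le_Suc_eq)
  then show "\<phi> \<in> sobolev a b 1" using test_L2[OF assms(1)] by (simp add: sobolev_def)
  fix e :: real assume e: "0 < e"
  \<comment> \<open>Even for the zero function the representative picked by
    \<open>weak_deriv\<close> is known to vanish only almost everywhere.\<close>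
  have z: "is_weak_deriv a b j (\<lambda>_. 0) (\<lambda>_. 0)" for j by (simp add: is_weak_deriv_def L2_inner_def)
  have "L2_norm a b (weak_deriv a b j (\<lambda>_. 0)) = 0" for j
  proof -
    have "L2_norm a b (weak_deriv a b j (\<lambda>_. 0)) = L2_norm a b (\<lambda>_. 0)"
      using weak_deriv_spec[OF z L2_const] by (intro L2_norm_cong_AE L2_const)
    then show ?thesis by (simp add: L2_norm_def L2_inner_def)
  qed
  then show "\<exists>\<psi>\<in>test_functions a b. sobolev_norm a b 1 (\<lambda>x. \<phi> x - \<psi> x) < e"
    using e by (intro bexI[OF _ assms(1)]) (simp add: sobolev_norm_def)
qed

text \<open>For \<open>p\<close> not vanishing at the end points this expresses the boundary condition.\<close>

lemma sobolev0_parts_poly: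
  assumes "a \<le> b" "u \<in> sobolev0 a b"
  shows "L2_inner a b u (poly (pderiv p)) = - L2_inner a b (weak_deriv a b 1 u) (poly p)"
proof -
  have us: "u \<in> sobolev a b 1" using assms(2) by (simp add: sobolev0_def)
  define w where "w = weak_deriv a b 1 u"
  have u: "u \<in> L2 a b" using us by (simp add: sobolev_def)
  have w: "w \<in> L2 a b" "is_weak_deriv a b 1 u w" unfolding w_def using sobolev_weak_deriv[OF us] by simp_all
  define A where "A = L2_norm a b (poly (pderiv p)) + L2_norm a b (poly p)"
  have A: "0 \<le> A" by (simp add: A_def)
  have "\<bar>L2_inner a b u (poly (pderiv p)) + L2_inner a b w (poly p)\<bar> \<le> 0 + e" if "0 < e" for e
  proof -
    define e' where "e' = e / (A + 1)"
    have e': "0 < e'" "e' * A \<le> e" using that A by (auto simp: e'_def field_simps)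
    obtain \<phi> where \<phi>: "\<phi> \<in> test_functions a b" "sobolev_norm a b 1 (\<lambda>x. u x - \<phi> x) < e'"
      using assms(2) e'(1) by (auto simp: sobolev0_def)
    have \<phi>L: "\<phi> \<in> L2 a b" "deriv \<phi> \<in> L2 a b" using test_L2[OF \<phi>(1)] test_L2[OF test_deriv[OF \<phi>(1)]] by auto
    note d0 = L2_diff[OF u \<phi>L(1)] and d1 = L2_diff[OF w(1) \<phi>L(2)]
    have wd: "is_weak_deriv a b 1 (\<lambda>x. u x - \<phi> x) (\<lambda>x. w x - deriv \<phi> x)"
      by (rule is_weak_deriv_diff[OF w(2) test_weak_deriv[OF \<phi>(1) assms(1)] u \<phi>L(1) w(1) \<phi>L(2)])
    have "\<exists>z\<in>L2 a b. is_weak_deriv a b j (\<lambda>x. u x - \<phi> x) z" if "j \<le> 1" for j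
      using that wd is_weak_deriv_0[of a b "\<lambda>x. u x - \<phi> x"] d0 d1 by (cases "j = 0") (auto simp: le_Suc_eq)
    then have "(\<lambda>x. u x - \<phi> x) \<in> sobolev a b 1" using d0 by (simp add: sobolev_def)
    note s = sobolev_weak_deriv(3)[OF this]
    have "L2_norm a b (\<lambda>x. w x - deriv \<phi> x) = L2_norm a b (weak_deriv a b 1 (\<lambda>x. u x - \<phi> x))"
      by (rule L2_norm_cong_AE[OF weak_deriv_spec(1)[OF wd d1] d1 weak_deriv_spec(3)[OF wd d1], symmetric])
    then have n1: "L2_norm a b (\<lambda>x. w x - deriv \<phi> x) \<le> e'" using s[of 1] \<phi>(2) by simp
    have "L2_norm a b (\<lambda>x. u x - \<phi> x) = L2_norm a b (weak_deriv a b 0 (\<lambda>x. u x - \<phi> x))"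
      by (rule L2_norm_cong_AE[OF weak_deriv_spec(1)[OF is_weak_deriv_0 d0] d0 weak_deriv_spec(3)[OF is_weak_deriv_0 d0], symmetric])
    then have n0: "L2_norm a b (\<lambda>x. u x - \<phi> x) \<le> e'" using s[of 0] \<phi>(2) by simp
    have "L2_inner a b \<phi> (poly (pderiv p)) + L2_inner a b (deriv \<phi>) (poly p) = 0"
      using acd_parts[OF assms(1) acd_test[OF \<phi>(1)] acd_poly[of a b p]] test_outside[OF \<phi>(1)] by simp
    then have eq: "L2_inner a b u (poly (pderiv p)) + L2_inner a b w (poly p)
      = L2_inner a b (\<lambda>x. u x - \<phi> x) (poly (pderiv p)) + L2_inner a b (\<lambda>x. w x - deriv \<phi> x) (poly p)"
      using L2_inner_diff_left[OF u \<phi>L(1) poly_L2[of "pderiv p"]] L2_inner_diff_left[OF w(1) \<phi>L(2) poly_L2[of p]] by linarith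
    have "\<bar>L2_inner a b (\<lambda>x. u x - \<phi> x) (poly (pderiv p)) + L2_inner a b (\<lambda>x. w x - deriv \<phi> x) (poly p)\<bar> \<le> L2_norm a b (\<lambda>x. u x - \<phi> x) * L2_norm a b (poly (pderiv p)) + L2_norm a b (\<lambda>x. w x - deriv \<phi> x) * L2_norm a b (poly p)"
      using L2_Cauchy_Schwarz[OF d0 poly_L2[of "pderiv p"]] L2_Cauchy_Schwarz[OF d1 poly_L2[of p]] by linarith
    also have "\<dots> \<le> e' * L2_norm a b (poly (pderiv p)) + e' * L2_norm a b (poly p)"
      using n0 n1 by (intro add_mono mult_right_mono) auto
    also have "\<dots> \<le> e" using e'(2) by (simp add: A_def distrib_left)
    finally show ?thesis unfolding eq by simp
  qed
  then have "\<bar>L2_inner a b u (poly (pderiv p)) + L2_inner a b w (poly p)\<bar> \<le> 0" by (rule field_le_epsilon)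
  then show ?thesis by (simp add: w_def)
qed

lemma zero_of_square_le_inverse:
  fixes X :: real
  assumes "\<And>n. 1 \<le> n \<Longrightarrow> X\<^sup>2 \<le> A / real (2 * n + 1)" shows "X = 0"
proof (rule ccontr)
  assume "X \<noteq> 0"
  then have X: "0 < X\<^sup>2" by simp
  obtain n where n: "A / X\<^sup>2 < real n" by (rule exE[OF reals_Archimedean2])
  define m where "m = Suc n"
  have "A / X\<^sup>2 < real (2 * m + 1)" using n by (simp add: m_def)
  then have "A / real (2 * m + 1) < X\<^sup>2" using X by (simp add: field_simps)
  moreover have "X\<^sup>2 \<le> A / real (2 * m + 1)" by (rule assms) (simp add: m_def)
  ultimately show False by linarith
qed

lemma L2_inner_power:
  "L2_inner 0 1 (\<lambda>y. y ^ n) (\<lambda>y. y ^ n) = 1 / real (2 * n + 1)"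
  "L2_inner 0 1 (\<lambda>y. (1 - y) ^ n) (\<lambda>y. (1 - y) ^ n) = 1 / real (2 * n + 1)"
proof -
  have c: "continuous_on {0..1} (\<lambda>y::real. y ^ (2 * n))" "continuous_on {0..1} (\<lambda>y::real. (1 - y) ^ (2 * n))"
    by (intro continuous_intros)+
  define F where "F y = y ^ Suc (2 * n) / real (Suc (2 * n))" for y :: real
  have F: "(F has_real_derivative y ^ (2 * n)) (at y within S)" for y S
    unfolding F_def using DERIV_cdivide[OF DERIV_pow[of "Suc (2 * n)" y S], of "real (Suc (2 * n))"] by simp
  have G: "((\<lambda>y. - F (1 - y)) has_real_derivative (1 - y) ^ (2 * n)) (at y within S)" for y S
  proof -
    have "((\<lambda>y. 1 - y) has_real_derivative -1) (at y within S)" by (auto intro!: derivative_eq_intros)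
    from DERIV_minus[OF DERIV_chain2[OF F[of "1 - y" UNIV] this]] show ?thesis by simp
  qed
  have sq: "(x ^ n) * (x ^ n) = x ^ (2 * n)" for x :: real by (simp add: mult_2 power_add)
  have "(LINT y|leb 0 1. y ^ (2 * n)) = F 1 - F 0" by (rule LINT_leb_DERIV[OF zero_le_one F c(1)])
  then show "L2_inner 0 1 (\<lambda>y. y ^ n) (\<lambda>y. y ^ n) = 1 / real (2 * n + 1)"
    unfolding L2_inner_def sq by (simp add: F_def)
  have "(LINT y|leb 0 1. (1 - y) ^ (2 * n)) = - F (1 - 1) - (- F (1 - 0))" by (rule LINT_leb_DERIV[OF zero_le_one G c(2)])
  then show "L2_inner 0 1 (\<lambda>y. (1 - y) ^ n) (\<lambda>y. (1 - y) ^ n) = 1 / real (2 * n + 1)"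
    unfolding L2_inner_def sq by (simp add: F_def)
qed

text \<open>Tested with \<open>y ^ n\<close> and \<open>(1 - y) ^ n\<close>, whose norms tend to \<open>0\<close>.\<close>

lemma acd_boundary_zero:
  assumes U: "acd 0 1 U u" and bound: "\<And>p. \<bar>L2_inner 0 1 U (poly (pderiv p))\<bar> \<le> R * L2_norm 0 1 (poly p)"
  shows "U 0 = 0" "U 1 = 0"
proof -
  define A where "A = R + L2_norm 0 1 u"
  have main: "(U 1 * poly p 1 - U 0 * poly p 0)\<^sup>2 \<le> A\<^sup>2 * L2_inner 0 1 (poly p) (poly p)" for p
  proof -
    have "U 1 * poly p 1 - U 0 * poly p 0 = L2_inner 0 1 U (poly (pderiv p)) + L2_inner 0 1 u (poly p)"
      using acd_parts[OF zero_le_one U acd_poly[of 0 1 p]] by simp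
    then have "\<bar>U 1 * poly p 1 - U 0 * poly p 0\<bar> \<le> A * L2_norm 0 1 (poly p)"
      using bound[of p] L2_Cauchy_Schwarz[OF acd_L2[OF U] poly_L2[of p]] by (simp add: A_def distrib_right)
    then have "(U 1 * poly p 1 - U 0 * poly p 0)\<^sup>2 \<le> (A * L2_norm 0 1 (poly p))\<^sup>2" by (rule power2_le_of_abs_le)
    then show ?thesis by (simp add: power_mult_distrib L2_norm_sq)
  qed
  show "U 1 = 0"
  proof (rule zero_of_square_le_inverse[where A="A\<^sup>2"])
    fix n :: nat assume n: "1 \<le> n"
    have "poly (monom 1 n) = (\<lambda>y::real. y ^ n)" by (simp add: fun_eq_iff poly_monom)
    then show "(U 1)\<^sup>2 \<le> A\<^sup>2 / real (2 * n + 1)"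
      using main[of "monom 1 n"] n by (simp add: L2_inner_power power_0_left)
  qed
  show "U 0 = 0"
  proof (rule zero_of_square_le_inverse[where A="A\<^sup>2"])
    fix n :: nat assume n: "1 \<le> n"
    have "poly ([:1, -1:] ^ n) = (\<lambda>y::real. (1 - y) ^ n)" by (simp add: fun_eq_iff poly_power)
    then show "(U 0)\<^sup>2 \<le> A\<^sup>2 / real (2 * n + 1)"
      using main[of "[:1, -1:] ^ n"] n by (simp add: L2_inner_power power_0_left)
  qed
qed

text \<open>\<open>D 0\<close> is the smooth representative of \<open>u\<close>, with derivatives \<open>D j\<close>, and \<open>z\<close> is its second
  derivative (which differs from \<open>D 2\<close> on a null set if \<open>k = 1\<close>).\<close>

definition profile :: "nat \<Rightarrow> real \<Rightarrow> (real \<Rightarrow> real) \<Rightarrow> (nat \<Rightarrow> real \<Rightarrow> real) \<Rightarrow> (real \<Rightarrow> real) \<Rightarrow> bool" where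
  "profile k R u D z \<longleftrightarrow> (AE y in leb 0 1. u y = D 0 y) \<and> (\<forall>j\<le>k. acd 0 1 (D j) (D (Suc j))) \<and>
     is_weak_deriv 0 1 (Suc k) u (D (Suc k)) \<and> L2_norm 0 1 (D (Suc k)) \<le> R \<and> D 0 0 = 0 \<and> D 0 1 = 0 \<and>
     acd 0 1 (D 1) z \<and> L2_norm 0 1 z \<le> R \<and> L2_norm 0 1 (D 1) \<le> R"

lemma is_weak_deriv_AE_cong:
  assumes "is_weak_deriv a b j u w" "u \<in> L2 a b" "u' \<in> L2 a b" "AE x in leb a b. u x = u' x"
  shows "is_weak_deriv a b j u' w"
  unfolding is_weak_deriv_def
proof
  fix \<phi> assume \<phi>: "\<phi> \<in> test_functions a b"
  note t = test_L2[OF test_deriv_iter[OF \<phi>], of j a b]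
  have "L2_inner a b u' ((deriv ^^ j) \<phi>) = L2_inner a b u ((deriv ^^ j) \<phi>)"
    by (rule L2_inner_cong_AE[OF assms(2,3) t t assms(4), symmetric]) simp
  then show "L2_inner a b u' ((deriv ^^ j) \<phi>) = (- 1) ^ j * L2_inner a b w \<phi>"
    using assms(1) \<phi> by (simp add: is_weak_deriv_def)
qed

lemma profile_exists:
  assumes u: "u \<in> L2 0 1" and R: "0 \<le> R" and k: "1 \<le> k"
    and dual: "\<And>j \<phi>. j \<le> Suc k \<Longrightarrow> \<phi> \<in> test_functions 0 1 \<Longrightarrow> \<bar>L2_inner 0 1 u ((deriv ^^ j) \<phi>)\<bar> \<le> R * L2_norm 0 1 \<phi>"
    and bd: "\<And>p. \<bar>L2_inner 0 1 u (poly (pderiv p))\<bar> \<le> R * L2_norm 0 1 (poly p)"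
  shows "\<exists>D z. profile k R u D z"
proof -
  obtain w where w: "w \<in> L2 0 1" "L2_norm 0 1 w \<le> R" "is_weak_deriv 0 1 (Suc k) u w"
    using weak_deriv_of_bound[OF zero_le_one u R dual[OF order_refl]] by blast
  obtain D where D: "AE x in leb 0 1. u x = D 0 x" "D (Suc k) = w" "\<forall>j<Suc k. acd 0 1 (D j) (D (Suc j))"
    using weak_deriv_chain[OF zero_less_one u w(1,3)] by blast
  have D0: "acd 0 1 (D 0) (D 1)" and D1: "acd 0 1 (D 1) (D 2)"
    using D(3)[rule_format, of 0] D(3)[rule_format, of 1] k by (simp_all add: numeral_2_eq_2)
  \<comment> \<open>Order 2 gets a chain of its own, as the first one comes with a norm bound for
    \<open>D (Suc k)\<close> only. Since derivatives of the same function are unique, both chains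
    share the first derivative.\<close>
  obtain z where z: "z \<in> L2 0 1" "L2_norm 0 1 z \<le> R" "is_weak_deriv 0 1 2 u z"
    using weak_deriv_of_bound[OF zero_le_one u R dual, of 2] k by auto
  obtain D' where D': "AE x in leb 0 1. u x = D' 0 x" "D' 2 = z" "\<forall>j<2. acd 0 1 (D' j) (D' (Suc j))"
    using weak_deriv_chain[OF zero_less_one u z(1,3)] by blast
  have D'0: "acd 0 1 (D' 0) (D' 1)" and D'1: "acd 0 1 (D' 1) z"
    using D'(3)[rule_format, of 0] D'(3)[rule_format, of 1] D'(2) by (simp_all add: numeral_2_eq_2)
  have "AE x in leb 0 1. D' 0 x = D 0 x" using D(1) D'(1) by eventually_elim simp
  then have "D' 0 x = D 0 x" if "x \<in> {0..1}" for x
    by (rule continuous_AE_eq[OF zero_less_one acd_continuous[OF D'0] acd_continuous[OF D0] _ that])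
  then have "acd 0 1 (D 0) (D' 1)" by (intro acd_cong[OF D'0]) simp_all
  then have "AE x in leb 0 1. D' 1 x = D 1 x" by (rule acd_unique[OF zero_le_one _ D0])
  then have eq: "D' 1 x = D 1 x" if "x \<in> {0..1}" for x
    by (rule continuous_AE_eq[OF zero_less_one acd_continuous[OF D'1] acd_continuous[OF D1] _ that])
  have Dz: "acd 0 1 (D 1) z" by (rule acd_cong[OF D'1]) (rule eq, assumption, rule refl)
  have wd1: "is_weak_deriv 0 1 1 u (D 1)"
  proof (rule is_weak_deriv_AE_cong[OF acd_is_weak_deriv[OF zero_le_one D0] acd_L2_fun[OF D0] u])
    show "AE x in leb 0 1. D 0 x = u x" using D(1) by eventually_elim simp
  qed
  have n1: "L2_norm 0 1 (D 1) \<le> R"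
    by (rule weak_deriv_norm_le_dual[OF zero_le_one wd1 acd_L2[OF D0] u R dual]) simp_all
  have "\<bar>L2_inner 0 1 (D 0) (poly (pderiv p))\<bar> \<le> R * L2_norm 0 1 (poly p)" for p
  proof -
    have "L2_inner 0 1 (D 0) (poly (pderiv p)) = L2_inner 0 1 u (poly (pderiv p))"
      by (rule L2_inner_cong_AE[OF u acd_L2_fun[OF D0] poly_L2 poly_L2 D(1), symmetric]) simp
    then show ?thesis using bd[of p] by simp
  qed
  note b = acd_boundary_zero[OF D0 this]
  have "profile k R u D z"
    unfolding profile_def using D w z(2) Dz n1 b by (simp add: less_Suc_eq_le)
  then show ?thesis by blast
qed

text \<open>For fixed \<open>\<phi>\<close> the left-hand side is continuous in time, so the almost
  everywhere bound holds at every time.\<close>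

lemma sobolev_profile_bounds:
  assumes T: "0 < T" and c: "continuous_in_L2 T u" and AE: "AE s in leb 0 T. u s \<in> sobolev 0 1 m \<and> sobolev_norm 0 1 m (u s) \<le> R"
    and t: "t \<in> {0..T}" and j: "j \<le> m" and \<phi>: "\<phi> \<in> test_functions 0 1"
  shows "\<bar>L2_inner 0 1 (u t) ((deriv ^^ j) \<phi>)\<bar> \<le> R * L2_norm 0 1 \<phi>"
proof (rule AE_le_imp_le_continuous[OF T _ _ t])
  show "continuous_on {0..T} (\<lambda>t. \<bar>L2_inner 0 1 (u t) ((deriv ^^ j) \<phi>)\<bar>)"
    by (intro continuous_on_rabs continuous_in_L2_inner c test_L2[OF test_deriv_iter[OF \<phi>]])
  show "AE t in leb 0 T. \<bar>L2_inner 0 1 (u t) ((deriv ^^ j) \<phi>)\<bar> \<le> R * L2_norm 0 1 \<phi>"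
    using AE
  proof eventually_elim
    fix s assume s: "u s \<in> sobolev 0 1 m \<and> sobolev_norm 0 1 m (u s) \<le> R"
    note w = sobolev_weak_deriv[OF conjunct1[OF s] j]
    show "\<bar>L2_inner 0 1 (u s) ((deriv ^^ j) \<phi>)\<bar> \<le> R * L2_norm 0 1 \<phi>"
      by (rule weak_deriv_dual_bound[OF w(2,1) _ \<phi>]) (use w(3) s in linarith)
  qed
qed

text \<open>The same passage for polynomials, which need not vanish at the end points: this is how
  the boundary condition reaches every time.\<close>

lemma sobolev0_bound_poly:
  assumes T: "0 < T" and c: "continuous_in_L2 T u" and AE0: "AE s in leb 0 T. u s \<in> sobolev0 0 1"
    and AE: "AE s in leb 0 T. u s \<in> sobolev 0 1 m \<and> sobolev_norm 0 1 m (u s) \<le> R" and m: "1 \<le> m" and t: "t \<in> {0..T}"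
  shows "\<bar>L2_inner 0 1 (u t) (poly (pderiv p))\<bar> \<le> R * L2_norm 0 1 (poly p)"
proof (rule AE_le_imp_le_continuous[OF T _ _ t])
  show "continuous_on {0..T} (\<lambda>t. \<bar>L2_inner 0 1 (u t) (poly (pderiv p))\<bar>)"
    by (intro continuous_on_rabs continuous_in_L2_inner c poly_L2)
  show "AE t in leb 0 T. \<bar>L2_inner 0 1 (u t) (poly (pderiv p))\<bar> \<le> R * L2_norm 0 1 (poly p)"
    using AE AE0
  proof eventually_elim
    fix s assume s: "u s \<in> sobolev 0 1 m \<and> sobolev_norm 0 1 m (u s) \<le> R" and s0: "u s \<in> sobolev0 0 1"
    note w = sobolev_weak_deriv[OF conjunct1[OF s] m]
    have "\<bar>L2_inner 0 1 (u s) (poly (pderiv p))\<bar> \<le> L2_norm 0 1 (weak_deriv 0 1 1 (u s)) * L2_norm 0 1 (poly p)"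
      using L2_Cauchy_Schwarz[OF w(1) poly_L2[of p]] sobolev0_parts_poly[OF zero_le_one s0, of p] by simp
    also have "\<dots> \<le> R * L2_norm 0 1 (poly p)" using w(3) s by (intro mult_right_mono) auto
    finally show "\<bar>L2_inner 0 1 (u s) (poly (pderiv p))\<bar> \<le> R * L2_norm 0 1 (poly p)" .
  qed
qed

lemma sobolev_norm_all_times:
  assumes T: "0 < T" and c: "continuous_in_L2 T u" and R: "0 \<le> R"
    and AE: "AE s in leb 0 T. u s \<in> sobolev 0 1 m \<and> sobolev_norm 0 1 m (u s) \<le> R" and t: "t \<in> {0..T}"
  shows "L2_norm 0 1 (u t) \<le> R"
proof (rule weak_deriv_norm_le_dual[OF zero_le_one is_weak_deriv_0 _ _ R])
  show "u t \<in> L2 0 1" "u t \<in> L2 0 1" by (rule continuous_in_L2_L2[OF c t])+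
  show "\<bar>L2_inner 0 1 (u t) ((deriv ^^ 0) \<phi>)\<bar> \<le> R * L2_norm 0 1 \<phi>" if "\<phi> \<in> test_functions 0 1" for \<phi>
    by (rule sobolev_profile_bounds[OF T c AE t _ that]) simp
qed

text \<open>Source of the factor \<open>\<delta>\<close> that cancels the
  \<open>1 / \<delta>\<close> in front of the increment of the projection error.\<close>

lemma profile_diff_bound:
  assumes T: "0 < T" and wt: "weak_time_deriv T u ut" and u: "continuous_in_L2 T u" and R: "0 \<le> R"
    and AE: "AE s in leb 0 T. ut s \<in> sobolev 0 1 (Suc k) \<and> sobolev_norm 0 1 (Suc k) (ut s) \<le> R"
    and st: "s \<in> {0..T}" "t \<in> {0..T}" and p: "profile k R1 (u t) D z" "profile k R2 (u s) D' z'"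
  shows "L2_norm 0 1 (\<lambda>y. D (Suc k) y - D' (Suc k) y) \<le> R * \<bar>t - s\<bar>"
proof -
  note uL = continuous_in_L2_L2[OF u st(2)] continuous_in_L2_L2[OF u st(1)]
  have a: "acd 0 1 (D k) (D (Suc k))" "acd 0 1 (D' k) (D' (Suc k))" and wd: "is_weak_deriv 0 1 (Suc k) (u t) (D (Suc k))" "is_weak_deriv 0 1 (Suc k) (u s) (D' (Suc k))"
    using p by (auto simp: profile_def)
  note L = acd_L2[OF a(1)] acd_L2[OF a(2)]
  show ?thesis
  proof (rule weak_deriv_norm_le_dual[OF zero_le_one is_weak_deriv_diff[OF wd uL L] L2_diff[OF L] L2_diff[OF uL]])
    show "0 \<le> R * \<bar>t - s\<bar>" using R by simp
    fix \<phi> assume \<phi>: "\<phi> \<in> test_functions 0 1"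
    note tL = test_L2[OF test_deriv_iter[OF \<phi>], of "Suc k" 0 1]
    have "AE r in leb 0 T. \<bar>L2_inner 0 1 (ut r) ((deriv ^^ Suc k) \<phi>)\<bar> \<le> R * L2_norm 0 1 \<phi>"
      using AE
    proof eventually_elim
      fix r assume r: "ut r \<in> sobolev 0 1 (Suc k) \<and> sobolev_norm 0 1 (Suc k) (ut r) \<le> R"
      note w = sobolev_weak_deriv[OF conjunct1[OF r] order_refl]
      show "\<bar>L2_inner 0 1 (ut r) ((deriv ^^ Suc k) \<phi>)\<bar> \<le> R * L2_norm 0 1 \<phi>"
        by (rule weak_deriv_dual_bound[OF w(2,1) _ \<phi>]) (use w(3) r in linarith)
    qed
    from weak_time_deriv_Lipschitz[OF T wt u tL _ this st]
    have "\<bar>L2_inner 0 1 (u t) ((deriv ^^ Suc k) \<phi>) - L2_inner 0 1 (u s) ((deriv ^^ Suc k) \<phi>)\<bar> \<le> R * L2_norm 0 1 \<phi> * \<bar>t - s\<bar>"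
      using R by simp
    then show "\<bar>L2_inner 0 1 (\<lambda>x. u t x - u s x) ((deriv ^^ Suc k) \<phi>)\<bar> \<le> R * \<bar>t - s\<bar> * L2_norm 0 1 \<phi>"
      unfolding L2_inner_diff_left[OF uL tL] by (simp add: mult_ac)
  qed
qed

text \<open>Smooth test functions suffice to determine the residual almost everywhere, after one
  derivative has been moved back to \<open>D 1\<close>. The result can be paired with finite element
  functions.\<close>

lemma strong_equation:
  assumes p: "profile k R u D z" and u: "u \<in> L2 0 1" and L: "vt \<in> L2 0 1" "g \<in> L2 0 1" and \<beta>: "continuous_on {0..1} \<beta>"
    and eq: "\<And>w. w \<in> sobolev0 0 1 \<Longrightarrow> L2_inner 0 1 vt w + c * L2_inner 0 1 (weak_deriv 0 1 1 u) (weak_deriv 0 1 1 w)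
      - L2_inner 0 1 (\<lambda>y. \<beta> y * weak_deriv 0 1 1 u y) w = L2_inner 0 1 g w"
  shows "AE y in leb 0 1. g y - (vt y - c * z y - \<beta> y * D 1 y) = 0"
proof (rule fundamental_lemma)
  have D0: "acd 0 1 (D 0) (D 1)" and D1: "acd 0 1 (D 1) z" and AE: "AE y in leb 0 1. u y = D 0 y"
    using p unfolding profile_def by auto
  have wd: "is_weak_deriv 0 1 1 u (D 1)"
  proof (rule is_weak_deriv_AE_cong[OF acd_is_weak_deriv[OF zero_le_one D0] acd_L2_fun[OF D0] u])
    show "AE x in leb 0 1. D 0 x = u x" using AE by eventually_elim simp
  qed
  note w = weak_deriv_spec[OF wd acd_L2[OF D0]]
  note zL = acd_L2[OF D1] and D1L = acd_L2[OF D0]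
  note bL = L2_continuous_mult[OF \<beta> D1L] and bwL = L2_continuous_mult[OF \<beta> w(1)]
  note s1 = L2_diff[OF L(1) L2_cmult[OF zL, of c]]
  note sL = L2_diff[OF s1 bL]
  show "integrable (leb 0 1) (\<lambda>y. g y - (vt y - c * z y - \<beta> y * D 1 y))" by (intro L2_integrable L2_diff L sL)
  fix \<phi> assume \<phi>: "\<phi> \<in> test_functions 0 1"
  note \<phi>L = test_L2[OF \<phi>, of 0 1] and d\<phi>L = test_L2[OF test_deriv[OF \<phi>], of 0 1]
  note w\<phi> = weak_deriv_spec[OF test_weak_deriv[OF \<phi> zero_le_one] d\<phi>L]
  have "L2_inner 0 1 (weak_deriv 0 1 1 u) (weak_deriv 0 1 1 \<phi>) = L2_inner 0 1 (D 1) (deriv \<phi>)"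
    by (rule L2_inner_cong_AE[OF w(1) D1L w\<phi>(1) d\<phi>L w(3) w\<phi>(3)])
  also have "\<dots> = - L2_inner 0 1 z \<phi>"
    using acd_parts[OF zero_le_one D1 acd_test[OF \<phi>]] test_outside[OF \<phi>] by simp
  finally have 1: "L2_inner 0 1 (weak_deriv 0 1 1 u) (weak_deriv 0 1 1 \<phi>) = - L2_inner 0 1 z \<phi>" .
  have "AE y in leb 0 1. \<beta> y * weak_deriv 0 1 1 u y = \<beta> y * D 1 y" using w(3) by eventually_elim simp
  then have 2: "L2_inner 0 1 (\<lambda>y. \<beta> y * weak_deriv 0 1 1 u y) \<phi> = L2_inner 0 1 (\<lambda>y. \<beta> y * D 1 y) \<phi>"
    by (rule L2_inner_cong_AE[OF bwL bL \<phi>L \<phi>L]) simp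
  have "L2_inner 0 1 (\<lambda>y. g y - (vt y - c * z y - \<beta> y * D 1 y)) \<phi>
    = L2_inner 0 1 g \<phi> - (L2_inner 0 1 vt \<phi> - c * L2_inner 0 1 z \<phi> - L2_inner 0 1 (\<lambda>y. \<beta> y * D 1 y) \<phi>)"
    unfolding L2_inner_diff_left[OF L(2) sL \<phi>L] L2_inner_diff_left[OF s1 bL \<phi>L]
      L2_inner_diff_left[OF L(1) L2_cmult[OF zL] \<phi>L] L2_inner_cmult_left ..
  also have "\<dots> = 0" using eq[OF test_sobolev0[OF \<phi> zero_le_one]] unfolding 1 2 by simp
  finally show "L2_inner 0 1 (\<lambda>y. g y - (vt y - c * z y - \<beta> y * D 1 y)) \<phi> = 0" .
qed

text \<open>\<open>D\<close>, \<open>V1\<close>, \<open>R1\<close> belong to the new time level and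
  \<open>D'\<close>, \<open>V0\<close>, \<open>R0\<close> to the old one; \<open>av\<close> is the
  diffusion coefficient of the exact solution, \<open>aV\<close> that of the discrete one. The
  witness \<open>r\<close> is the norm of the derivative of the tested error; the term
  \<open>- c * r\<^sup>2\<close> is kept in order to absorb what is linear in
  \<open>r\<close>.\<close>

lemma energy_step:
  fixes b0 b' :: real
  defines "\<beta> \<equiv> \<lambda>y. b0 + b' * y"
  assumes P: "is_partition M x" and \<delta>: "0 < \<delta>"
    and D: "acd 0 1 (D 0) (D 1)" "acd 0 1 (D 1) z" "acd 0 1 (D' 0) (D' 1)" "D 0 0 = 0" "D 0 1 = 0"
    and R: "ritz M x k (D 0) R1" "ritz M x k (D' 0) R0"
    and V: "V1 \<in> fe_space M x k" "V0 \<in> fe_space M x k" and L: "g \<in> L2 0 1" "vt \<in> L2 0 1"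
    and eq: "\<And>W. W \<in> fe_space M x k \<Longrightarrow> L2_inner 0 1 (\<lambda>y. (V1 y - V0 y) / \<delta>) W + aV * dinner V1 W
       - L2_inner 0 1 (\<lambda>y. \<beta> y * weak_deriv 0 1 1 V1 y) W = L2_inner 0 1 g W"
    and B: "\<And>y. y \<in> {0..1} \<Longrightarrow> \<bar>\<beta> y\<bar> \<le> B" "\<bar>b'\<bar> \<le> B" and aV: "c \<le> aV"
  defines "p \<equiv> L2_norm 0 1 (\<lambda>y. V1 y - R1 y)" and "q \<equiv> L2_norm 0 1 (\<lambda>y. V0 y - R0 y)"
  shows "\<exists>r\<ge>0. (p\<^sup>2 - q\<^sup>2) / (2 * \<delta>) \<le> p * (L2_norm 0 1 (\<lambda>y. g y - (vt y - av * z y - \<beta> y * D 1 y))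
       + L2_norm 0 1 (\<lambda>y. vt y - (D 0 y - D' 0 y) / \<delta>)
       + L2_norm 0 1 (\<lambda>y. (D 0 y - R1 y) - (D' 0 y - R0 y)) / \<delta> + \<bar>av - aV\<bar> * L2_norm 0 1 z)
       + B * r * p + B * L2_norm 0 1 (\<lambda>y. D 0 y - R1 y) * (p + r) - c * r\<^sup>2"
proof -
  let ?I = "L2_inner 0 1" and ?N = "L2_norm 0 1"
  define \<theta> where "\<theta> y = V1 y - R1 y" for y
  define \<theta>0 where "\<theta>0 y = V0 y - R0 y" for y
  define \<rho> where "\<rho> y = D 0 y - R1 y" for y
  define \<rho>0 where "\<rho>0 y = D' 0 y - R0 y" for y
  define v1 where "v1 = weak_deriv 0 1 1 V1"
  have \<theta>fe: "\<theta> \<in> fe_space M x k" unfolding \<theta>_def by (rule fe_diff[OF V(1) ritz_fe[OF R(1)]])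
  obtain v' where v': "acd 0 1 V1 v'" using fe_acd_exists[OF P V(1)] by blast
  have v1: "acd 0 1 V1 v1" unfolding v1_def by (rule acd_weak_deriv(1)[OF zero_le_one v'])
  obtain v0 where v0: "acd 0 1 V0 v0" using fe_acd_exists[OF P V(2)] by blast
  obtain r1 where r1: "acd 0 1 R1 r1" using fe_acd_exists[OF P ritz_fe[OF R(1)]] by blast
  obtain r0 where r0: "acd 0 1 R0 r0" using fe_acd_exists[OF P ritz_fe[OF R(2)]] by blast
  define \<tau> where "\<tau> y = v1 y - r1 y" for y
  have \<theta>: "acd 0 1 \<theta> \<tau>" unfolding \<theta>_def \<tau>_def by (rule acd_diff[OF v1 r1])
  have \<theta>0: "acd 0 1 \<theta>0 (\<lambda>y. v0 y - r0 y)" unfolding \<theta>0_def by (rule acd_diff[OF v0 r0])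
  have \<rho>: "acd 0 1 \<rho> (\<lambda>y. D 1 y - r1 y)" unfolding \<rho>_def by (rule acd_diff[OF D(1) r1])
  have \<rho>0: "acd 0 1 \<rho>0 (\<lambda>y. D' 1 y - r0 y)" unfolding \<rho>0_def by (rule acd_diff[OF D(3) r0])
  have \<beta>acd: "acd 0 1 \<beta> (\<lambda>_. b')"
    unfolding \<beta>_def by (rule acd_DERIV) (auto intro!: derivative_eq_intros)
  have \<beta>c: "continuous_on {0..1} \<beta>" by (rule acd_continuous[OF \<beta>acd])
  note \<theta>L = acd_L2_fun[OF \<theta>] and \<tau>L = acd_L2[OF \<theta>] and \<theta>0L = acd_L2_fun[OF \<theta>0] and \<rho>L = acd_L2_fun[OF \<rho>]
    and \<rho>'L = acd_L2[OF \<rho>] and \<rho>0L = acd_L2_fun[OF \<rho>0] and zL = acd_L2[OF D(2)] and D1L = acd_L2[OF D(1)]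
    and D0L = acd_L2_fun[OF D(1)] and D'0L = acd_L2_fun[OF D(3)] and v1L = acd_L2[OF v1] and r1L = acd_L2[OF r1]
  have bd: "\<theta> 0 = 0" "\<theta> 1 = 0" using fe_zero[OF \<theta>fe] by auto
  have E1: "?I (\<lambda>y. (V1 y - V0 y) / \<delta>) \<theta> + aV * dinner V1 \<theta> - ?I (\<lambda>y. \<beta> y * v1 y) \<theta> = ?I g \<theta>"
    using eq[OF \<theta>fe] by (simp add: v1_def)
  have E2: "dinner V1 \<theta> = ?I \<tau> \<tau> + ?I r1 \<tau>"
    unfolding dinner_eq[OF v1 \<theta>] using L2_inner_add_left[OF \<tau>L r1L \<tau>L] by (simp add: \<tau>_def)
  \<comment> \<open>Orthogonality and one integration by parts trade the derivative of the
    projection for \<open>z\<close>, so that the difference of the two diffusion coefficients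
    multiplies \<open>z\<close> and an undifferentiated \<open>\<theta>\<close>.\<close>
  have "?I (\<lambda>y. D 1 y - r1 y) \<tau> = 0"
    using ritz_orth[OF R(1) \<theta>fe] dinner_eq[OF \<rho> \<theta>] by (simp add: \<rho>_def[abs_def])
  then have E3: "?I (D 1) \<tau> - ?I r1 \<tau> = 0" unfolding L2_inner_diff_left[OF D1L r1L \<tau>L] .
  have E4: "?I (D 1) \<tau> + ?I z \<theta> = 0" using acd_parts[OF zero_le_one D(2) \<theta>] bd by simp
  note b\<tau>L = L2_continuous_mult[OF \<beta>c \<tau>L] and bDL = L2_continuous_mult[OF \<beta>c D1L] and b\<rho>L = L2_continuous_mult[OF \<beta>c \<rho>'L]
  have "?I (\<lambda>y. \<beta> y * v1 y) \<theta> = ?I (\<lambda>y. (\<beta> y * \<tau> y + \<beta> y * D 1 y) - \<beta> y * (D 1 y - r1 y)) \<theta>"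
    by (simp add: \<tau>_def algebra_simps)
  then have E5: "?I (\<lambda>y. \<beta> y * v1 y) \<theta> = ?I (\<lambda>y. \<beta> y * \<tau> y) \<theta> + ?I (\<lambda>y. \<beta> y * D 1 y) \<theta> - ?I (\<lambda>y. \<beta> y * (D 1 y - r1 y)) \<theta>"
    unfolding L2_inner_diff_left[OF L2_add[OF b\<tau>L bDL] b\<rho>L \<theta>L] L2_inner_add_left[OF b\<tau>L bDL \<theta>L] .
  note \<beta>\<theta> = acd_mult[OF \<beta>acd \<theta>]
  \<comment> \<open>The derivative of \<open>\<rho>\<close> is one order worse in the mesh size than
    \<open>\<rho>\<close>, so it is moved onto \<open>\<beta> * \<theta>\<close>; the boundary terms
    vanish with \<open>\<theta>\<close>.\<close>
  have "?I (\<lambda>y. \<beta> y * (D 1 y - r1 y)) \<theta> = ?I (\<lambda>y. D 1 y - r1 y) (\<lambda>y. \<beta> y * \<theta> y)"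
    by (simp add: L2_inner_def mult_ac)
  moreover have "?I \<rho> (\<lambda>y. \<beta> y * \<tau> y + b' * \<theta> y) + ?I (\<lambda>y. D 1 y - r1 y) (\<lambda>y. \<beta> y * \<theta> y) = 0"
    using acd_parts[OF zero_le_one \<rho> \<beta>\<theta>] bd by simp
  ultimately have E6: "?I (\<lambda>y. \<beta> y * (D 1 y - r1 y)) \<theta> = - ?I \<rho> (\<lambda>y. \<beta> y * \<tau> y + b' * \<theta> y)" by linarith
  note d1 = L2_diff[OF \<theta>L \<theta>0L] and d2 = L2_diff[OF D0L D'0L] and d3 = L2_diff[OF \<rho>L \<rho>0L]
  \<comment> \<open>Inserting the projections splits the increment into those of the discrete error,
    of the exact profile and of the projection error.\<close>
  have "?I (\<lambda>y. V1 y - V0 y) \<theta> = ?I (\<lambda>y. ((\<theta> y - \<theta>0 y) + (D 0 y - D' 0 y)) - (\<rho> y - \<rho>0 y)) \<theta>"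
    by (simp add: \<theta>_def \<theta>0_def \<rho>_def \<rho>0_def)
  then have E7: "?I (\<lambda>y. (V1 y - V0 y) / \<delta>) \<theta> = ?I (\<lambda>y. \<theta> y - \<theta>0 y) \<theta> / \<delta> + ?I (\<lambda>y. D 0 y - D' 0 y) \<theta> / \<delta> - ?I (\<lambda>y. \<rho> y - \<rho>0 y) \<theta> / \<delta>"
    unfolding L2_inner_divide_left L2_inner_diff_left[OF L2_add[OF d1 d2] d3 \<theta>L] L2_inner_add_left[OF d1 d2 \<theta>L]
    by (simp add: add_divide_distrib diff_divide_distrib)
  note s1 = L2_diff[OF L(2) L2_cmult[OF zL, of av]]
  note sL = L2_diff[OF s1 bDL]
  have E8: "?I (\<lambda>y. g y - (vt y - av * z y - \<beta> y * D 1 y)) \<theta> = ?I g \<theta> - (?I vt \<theta> - av * ?I z \<theta> - ?I (\<lambda>y. \<beta> y * D 1 y) \<theta>)"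
    unfolding L2_inner_diff_left[OF L(1) sL \<theta>L] L2_inner_diff_left[OF s1 bDL \<theta>L]
      L2_inner_diff_left[OF L(2) L2_cmult[OF zL] \<theta>L] L2_inner_cmult_left ..
  have E9: "?I (\<lambda>y. vt y - (D 0 y - D' 0 y) / \<delta>) \<theta> = ?I vt \<theta> - ?I (\<lambda>y. D 0 y - D' 0 y) \<theta> / \<delta>"
    unfolding L2_inner_diff_left[OF L(2) L2_divide[OF d2] \<theta>L] L2_inner_divide_left ..
  define r where "r = ?N \<tau>"
  have p: "p = ?N \<theta>" "q = ?N \<theta>0" by (simp_all add: p_def q_def \<theta>_def[abs_def] \<theta>0_def[abs_def])
  define e1 e2 e3 where "e1 = ?N (\<lambda>y. g y - (vt y - av * z y - \<beta> y * D 1 y))"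
    and "e2 = ?N (\<lambda>y. vt y - (D 0 y - D' 0 y) / \<delta>)" and "e3 = ?N (\<lambda>y. \<rho> y - \<rho>0 y)"
  have key: "?I (\<lambda>y. \<theta> y - \<theta>0 y) \<theta> / \<delta> + aV * ?I \<tau> \<tau> = ?I (\<lambda>y. \<beta> y * \<tau> y) \<theta> + ?I \<rho> (\<lambda>y. \<beta> y * \<tau> y + b' * \<theta> y)
    + ?I (\<lambda>y. g y - (vt y - av * z y - \<beta> y * D 1 y)) \<theta> + ?I (\<lambda>y. vt y - (D 0 y - D' 0 y) / \<delta>) \<theta>
    + ?I (\<lambda>y. \<rho> y - \<rho>0 y) \<theta> / \<delta> + (aV - av) * ?I z \<theta>"
  proof -
    have "?I r1 \<tau> = - ?I z \<theta>" using E3 E4 by linarith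
    then have "aV * dinner V1 \<theta> = aV * ?I \<tau> \<tau> - aV * ?I z \<theta>" unfolding E2 by (simp add: algebra_simps)
    then show ?thesis using E1 E5 E6 E7 E8 E9 unfolding left_diff_distrib by linarith
  qed
  have Bpos: "0 \<le> B" using B(2) by linarith
  have \<beta>M: "\<beta> \<in> borel_measurable (leb 0 1)" by (rule L2_measurable[OF L2_continuous[OF \<beta>c]])
  have b\<tau>: "?N (\<lambda>y. \<beta> y * \<tau> y) \<le> B * r" unfolding r_def by (rule L2_norm_bounded_mult[OF \<beta>M B(1) \<tau>L Bpos]) simp
  have i1: "?I (\<lambda>y. \<beta> y * \<tau> y) \<theta> \<le> B * r * p"
  proof -
    have "?I (\<lambda>y. \<beta> y * \<tau> y) \<theta> \<le> ?N (\<lambda>y. \<beta> y * \<tau> y) * ?N \<theta>" using L2_Cauchy_Schwarz[OF b\<tau>L \<theta>L] by linarith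
    also have "\<dots> \<le> B * r * p" unfolding p by (rule mult_right_mono[OF b\<tau>]) simp
    finally show ?thesis .
  qed
  have i2: "?I \<rho> (\<lambda>y. \<beta> y * \<tau> y + b' * \<theta> y) \<le> B * ?N \<rho> * (p + r)"
  proof -
    have "?N (\<lambda>y. \<beta> y * \<tau> y + b' * \<theta> y) \<le> ?N (\<lambda>y. \<beta> y * \<tau> y) + ?N (\<lambda>y. b' * \<theta> y)"
      by (rule L2_norm_triangle[OF b\<tau>L L2_cmult[OF \<theta>L]])
    also have "\<dots> \<le> B * r + B * p"
      unfolding L2_norm_cmult p using b\<tau> B(2) by (intro add_mono mult_right_mono) auto
    finally have *: "?N (\<lambda>y. \<beta> y * \<tau> y + b' * \<theta> y) \<le> B * (p + r)" by (simp add: algebra_simps)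
    have "?I \<rho> (\<lambda>y. \<beta> y * \<tau> y + b' * \<theta> y) \<le> ?N \<rho> * ?N (\<lambda>y. \<beta> y * \<tau> y + b' * \<theta> y)"
      using L2_Cauchy_Schwarz[OF \<rho>L L2_add[OF b\<tau>L L2_cmult[OF \<theta>L, of b']]] by linarith
    also have "\<dots> \<le> ?N \<rho> * (B * (p + r))" by (rule mult_left_mono[OF *]) simp
    finally show ?thesis by (simp add: mult_ac)
  qed
  have i3: "?I (\<lambda>y. g y - (vt y - av * z y - \<beta> y * D 1 y)) \<theta> \<le> p * e1"
    using L2_Cauchy_Schwarz[OF L2_diff[OF L(1) sL] \<theta>L] unfolding p e1_def by (simp add: mult.commute)
  have i4: "?I (\<lambda>y. vt y - (D 0 y - D' 0 y) / \<delta>) \<theta> \<le> p * e2"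
    using L2_Cauchy_Schwarz[OF L2_diff[OF L(2) L2_divide[OF d2, of \<delta>]] \<theta>L] unfolding p e2_def by (simp add: mult.commute)
  have "?I (\<lambda>y. \<rho> y - \<rho>0 y) \<theta> \<le> p * e3"
    using L2_Cauchy_Schwarz[OF d3 \<theta>L] unfolding p e3_def by (simp add: mult.commute)
  then have i5: "?I (\<lambda>y. \<rho> y - \<rho>0 y) \<theta> / \<delta> \<le> p * (e3 / \<delta>)" using \<delta> by (simp add: divide_right_mono)
  have i6: "(aV - av) * ?I z \<theta> \<le> p * (\<bar>av - aV\<bar> * ?N z)"
  proof -
    have "(aV - av) * ?I z \<theta> \<le> \<bar>av - aV\<bar> * \<bar>?I z \<theta>\<bar>" by (simp add: abs_mult[symmetric] abs_minus_commute[of av])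
    also have "\<dots> \<le> \<bar>av - aV\<bar> * (?N z * ?N \<theta>)" by (intro mult_left_mono L2_Cauchy_Schwarz[OF zL \<theta>L]) simp
    finally show ?thesis by (simp add: p mult_ac)
  qed
  have i7: "(p\<^sup>2 - q\<^sup>2) / (2 * \<delta>) \<le> ?I (\<lambda>y. \<theta> y - \<theta>0 y) \<theta> / \<delta>"
  proof -
    have "?I \<theta>0 \<theta> \<le> q * p" using L2_Cauchy_Schwarz[OF \<theta>0L \<theta>L] unfolding p by linarith
    moreover have "2 * (q * p) \<le> q\<^sup>2 + p\<^sup>2" using sum_squares_bound[of q p] by simp
    ultimately have "(p\<^sup>2 - q\<^sup>2) / 2 \<le> ?I (\<lambda>y. \<theta> y - \<theta>0 y) \<theta>"
      unfolding L2_inner_diff_left[OF \<theta>L \<theta>0L \<theta>L] L2_norm_sq[symmetric] p(1)[symmetric] by (simp add: field_simps)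
    then have "(p\<^sup>2 - q\<^sup>2) / 2 / \<delta> \<le> ?I (\<lambda>y. \<theta> y - \<theta>0 y) \<theta> / \<delta>"
      by (rule divide_right_mono) (use \<delta> in simp)
    then show ?thesis by simp
  qed
  have i8: "c * r\<^sup>2 \<le> aV * ?I \<tau> \<tau>" unfolding r_def L2_norm_sq by (rule mult_right_mono[OF aV L2_inner_self_nonneg])
  have "(p\<^sup>2 - q\<^sup>2) / (2 * \<delta>) \<le> p * (e1 + e2 + e3 / \<delta> + \<bar>av - aV\<bar> * ?N z) + B * r * p + B * ?N \<rho> * (p + r) - c * r\<^sup>2"
    using key i1 i2 i3 i4 i5 i6 i7 i8 unfolding distrib_left[of p] by linarith
  moreover have "0 \<le> r" by (simp add: r_def)
  ultimately show ?thesis unfolding e1_def e2_def e3_def \<rho>_def \<rho>0_def by blast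
qed

section \<open>The error estimate\<close>

text \<open>Young's inequality is used for the two products with \<open>r\<close>, each time
  spending half of \<open>c * r\<^sup>2\<close>. \<open>S\<close> stands for the summed errors of
  all species. The residual bound \<open>\<kappa>\<close> is kept apart because it need not be
  small.\<close>

lemma energy_absorb:
  fixes X :: real
  assumes c: "0 < c" and nn: "0 \<le> p" "0 \<le> r" "0 \<le> B" "0 \<le> \<rho>" "0 \<le> \<eta>" "0 \<le> R" "0 \<le> E" "0 \<le> A" "0 \<le> S" "0 \<le> N"
    and \<rho>: "\<rho> \<le> \<eta> * R"
    and X: "X \<le> p * (\<kappa> + \<eta> * A + E * (S + N * \<eta> * R)) + B * r * p + B * \<rho> * (p + r) - c * r\<^sup>2"
  shows "X \<le> \<kappa> * p + (A + E * N * R + E + B * R + B\<^sup>2 / (2 * c) + (B * R)\<^sup>2 / (2 * c)) * (p * \<eta> + p * S + p\<^sup>2 + \<eta>\<^sup>2)"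
proof -
  have young: "a * r \<le> c / 2 * r\<^sup>2 + a\<^sup>2 / (2 * c)" for a
  proof -
    have "0 \<le> (c * r - a)\<^sup>2 / (2 * c)" using c by simp
    also have "\<dots> = c / 2 * r\<^sup>2 - a * r + a\<^sup>2 / (2 * c)" using c by (simp add: power2_diff field_simps power2_eq_square)
    finally show ?thesis by linarith
  qed
  have 1: "B * r * p \<le> c / 2 * r\<^sup>2 + B\<^sup>2 / (2 * c) * p\<^sup>2"
    using young[of "B * p"] by (simp add: power_mult_distrib mult_ac)
  have \<rho>2: "\<rho>\<^sup>2 \<le> (\<eta> * R)\<^sup>2" using \<rho> nn(4) by (rule power_mono)
  have 2: "B * \<rho> * r \<le> c / 2 * r\<^sup>2 + (B * R)\<^sup>2 / (2 * c) * \<eta>\<^sup>2"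
  proof -
    have "(B * \<rho>)\<^sup>2 \<le> (B * R)\<^sup>2 * \<eta>\<^sup>2" using mult_left_mono[OF \<rho>2, of "B\<^sup>2"] by (simp add: power_mult_distrib mult_ac)
    then have "(B * \<rho>)\<^sup>2 / (2 * c) \<le> (B * R)\<^sup>2 * \<eta>\<^sup>2 / (2 * c)" using c by (intro divide_right_mono) auto
    then show ?thesis using young[of "B * \<rho>"] by simp
  qed
  have 3: "B * \<rho> * p \<le> B * R * (p * \<eta>)"
    using mult_left_mono[OF \<rho>, of "B * p"] nn by (simp add: mult_ac)
  define K where "K = A + E * N * R + E + B * R + B\<^sup>2 / (2 * c) + (B * R)\<^sup>2 / (2 * c)"
  have nn': "0 \<le> E * N * R" "0 \<le> B * R" "0 \<le> B\<^sup>2 / (2 * c)" "0 \<le> (B * R)\<^sup>2 / (2 * c)" using nn c by auto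
  have k: "(A + E * N * R + B * R) * (p * \<eta>) \<le> K * (p * \<eta>)" "E * (p * S) \<le> K * (p * S)"
    "B\<^sup>2 / (2 * c) * p\<^sup>2 \<le> K * p\<^sup>2" "(B * R)\<^sup>2 / (2 * c) * \<eta>\<^sup>2 \<le> K * \<eta>\<^sup>2"
    unfolding K_def by (intro mult_right_mono; use nn nn' in auto)+
  have "X \<le> \<kappa> * p + (A + E * N * R) * (p * \<eta>) + E * (p * S) + B * r * p + B * \<rho> * p + B * \<rho> * r - c * r\<^sup>2"
    using X by (simp add: algebra_simps)
  also have "\<dots> \<le> \<kappa> * p + (A + E * N * R + B * R) * (p * \<eta>) + E * (p * S) + B\<^sup>2 / (2 * c) * p\<^sup>2 + (B * R)\<^sup>2 / (2 * c) * \<eta>\<^sup>2"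
    using 1 2 3 unfolding distrib_right by linarith
  also have "\<dots> \<le> \<kappa> * p + K * (p * \<eta> + p * S + p\<^sup>2 + \<eta>\<^sup>2)" using k unfolding distrib_left by linarith
  finally show ?thesis unfolding K_def .
qed

text \<open>The coupling through \<open>S\<close> is quadratic: by Cauchy-Schwarz
  \<open>S\<^sup>2\<close> is at most \<open>N\<close> times the sum of squares. The factor
  \<open>2 + 2 * N\<close> dominates both \<open>2 + N\<close>, in front of the squares, and
  \<open>2 * N\<close>, in front of \<open>\<eta>\<^sup>2\<close>.\<close>

lemma energy_sum:
  fixes p q :: "'n::finite \<Rightarrow> real"
  defines "S \<equiv> \<Sum>j\<in>UNIV. p j" and "N \<equiv> real CARD('n)"
  assumes p: "\<And>i. 0 \<le> p i" and nn: "0 \<le> K" "0 \<le> \<eta>" "0 < \<delta>"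
    and step: "\<And>i. ((p i)\<^sup>2 - (q i)\<^sup>2) / (2 * \<delta>) \<le> \<kappa> * p i + K * (p i * \<eta> + p i * S + (p i)\<^sup>2 + \<eta>\<^sup>2)"
  shows "(\<Sum>i\<in>UNIV. (p i)\<^sup>2) \<le> (\<Sum>i\<in>UNIV. (q i)\<^sup>2) + 2 * \<delta> * \<kappa> * S
     + 2 * \<delta> * (K * (2 + 2 * N)) * ((\<Sum>i\<in>UNIV. (p i)\<^sup>2) + \<eta>\<^sup>2)"
proof -
  define P2 where "P2 = (\<Sum>i\<in>UNIV. (p i)\<^sup>2)"
  define Q2 where "Q2 = (\<Sum>i\<in>UNIV. (q i)\<^sup>2)"
  have P2: "0 \<le> P2" unfolding P2_def by (simp add: sum_nonneg)
  have "0 < CARD('n)" by (simp add: card_gt_0_iff)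
  then have N: "1 \<le> N" unfolding N_def by linarith
  have S2: "S\<^sup>2 \<le> N * P2" using sum_squared_le_sum_of_squares[of p UNIV] by (simp add: S_def N_def P2_def mult.commute)
  have p\<eta>: "p i * \<eta> \<le> (p i)\<^sup>2 + \<eta>\<^sup>2" for i
    using sum_squares_bound[of "p i" \<eta>] mult_nonneg_nonneg[OF p[of i] nn(2)] by simp
  have "(P2 - Q2) / (2 * \<delta>) = (\<Sum>i\<in>UNIV. ((p i)\<^sup>2 - (q i)\<^sup>2) / (2 * \<delta>))"
    by (simp add: P2_def Q2_def sum_divide_distrib[symmetric] sum_subtractf)
  also have "\<dots> \<le> (\<Sum>i\<in>UNIV. \<kappa> * p i + K * (2 * (p i)\<^sup>2 + p i * S + 2 * \<eta>\<^sup>2))"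
  proof (rule sum_mono)
    fix i
    have "K * (p i * \<eta> + p i * S + (p i)\<^sup>2 + \<eta>\<^sup>2) \<le> K * (2 * (p i)\<^sup>2 + p i * S + 2 * \<eta>\<^sup>2)"
      using p\<eta>[of i] by (intro mult_left_mono nn) linarith
    then show "((p i)\<^sup>2 - (q i)\<^sup>2) / (2 * \<delta>) \<le> \<kappa> * p i + K * (2 * (p i)\<^sup>2 + p i * S + 2 * \<eta>\<^sup>2)"
      using step[of i] by linarith
  qed
  also have "\<dots> = \<kappa> * S + K * (2 * P2 + S * S + N * (2 * \<eta>\<^sup>2))"
    by (simp add: S_def P2_def N_def sum.distrib sum_distrib_left[symmetric] sum_distrib_right[symmetric])
  also have "\<dots> \<le> \<kappa> * S + K * ((2 + 2 * N) * (P2 + \<eta>\<^sup>2))"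
  proof -
    have "2 * P2 + S * S + N * (2 * \<eta>\<^sup>2) \<le> 2 * P2 + N * P2 + 2 * (N * \<eta>\<^sup>2)" using S2 by (simp add: power2_eq_square)
    also have "\<dots> \<le> (2 + 2 * N) * (P2 + \<eta>\<^sup>2)" using mult_nonneg_nonneg[of N P2] N P2 by (simp add: algebra_simps)
    finally show ?thesis by (intro add_left_mono mult_left_mono nn)
  qed
  finally have "P2 - Q2 \<le> (\<kappa> * S + K * ((2 + 2 * N) * (P2 + \<eta>\<^sup>2))) * (2 * \<delta>)"
    using nn(3) by (subst (asm) pos_divide_le_eq) auto
  then show ?thesis unfolding P2_def[symmetric] Q2_def[symmetric] by (simp add: algebra_simps)
qed

text \<open>For \<open>x \<le> 1 / 2\<close> the inverse of \<open>1 - x\<close> is at most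
  \<open>exp (2 * x)\<close>, since \<open>1 \<le> (1 - x) * (1 + 2 * x)\<close>.\<close>

lemma discrete_gronwall:
  fixes S :: "nat \<Rightarrow> real"
  assumes x: "0 \<le> x" "x \<le> 1 / 2" and y: "0 \<le> y" and S: "\<And>n. 0 \<le> S n"
    and step: "\<And>n. n < m \<Longrightarrow> S (Suc n) * (1 - x) \<le> S n + y"
  shows "n \<le> m \<Longrightarrow> S n \<le> exp (2 * x * real n) * (S 0 + real n * y)"
proof (induction n)
  case (Suc n)
  have e: "1 \<le> (1 - x) * exp (2 * x)"
  proof -
    have "1 \<le> (1 - x) * (1 + 2 * x)" using x mult_left_mono[OF x(2) x(1)] by (simp add: algebra_simps)
    also have "\<dots> \<le> (1 - x) * exp (2 * x)" using exp_ge_add_one_self[of "2 * x"] x by (intro mult_left_mono) auto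
    finally show ?thesis .
  qed
  have "S (Suc n) \<le> S (Suc n) * ((1 - x) * exp (2 * x))" using mult_left_mono[OF e S[of "Suc n"]] by simp
  also have "\<dots> = (S (Suc n) * (1 - x)) * exp (2 * x)" by simp
  also have "\<dots> \<le> (S n + y) * exp (2 * x)" using step[of n] Suc.prems by (intro mult_right_mono) auto
  also have "\<dots> \<le> (exp (2 * x * real n) * (S 0 + real n * y) + exp (2 * x * real n) * y) * exp (2 * x)"
  proof (intro mult_right_mono add_mono)
    show "S n \<le> exp (2 * x * real n) * (S 0 + real n * y)" using Suc by simp
    have "1 \<le> exp (2 * x * real n)" using x by simp
    then show "y \<le> exp (2 * x * real n) * y" using mult_right_mono[OF _ y, of 1 "exp (2 * x * real n)"] by simp
  qed simp
  also have "\<dots> = exp (2 * x * real (Suc n)) * (S 0 + real (Suc n) * y)"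
    by (simp add: algebra_simps exp_add[symmetric])
  finally show ?case .
qed simp

text \<open>One instance of all the data. The constants defined inside stay explicit expressions, so
  that they can be matched with those chosen in advance.\<close>

locale euler_scheme =
  fixes T \<gamma>0 \<gamma>1 dgmax damax m_a M_a L_a Rtt Rt Ry RyH RH :: real
    and \<xi> :: "nat \<Rightarrow> nat \<Rightarrow> real" and \<alpha> da \<beta> db :: "real \<Rightarrow> real" and a :: "'n::finite \<Rightarrow> real^'n \<Rightarrow> real"
    and f :: "'n \<Rightarrow> real \<Rightarrow> real \<Rightarrow> real" and u0 :: "'n \<Rightarrow> real \<Rightarrow> real" and v vt vtt :: "'n \<Rightarrow> real \<Rightarrow> real \<Rightarrow> real"
    and k M :: nat and x :: "nat \<Rightarrow> real" and \<delta> :: real and ni :: nat and V :: "'n \<Rightarrow> nat \<Rightarrow> real \<Rightarrow> real"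
  assumes T: "0 < T" and \<gamma>0: "0 < \<gamma>0" and m_a: "0 < m_a" and \<xi>: "reference_nodes \<xi>"
    and domain: "admissible_domain T \<gamma>0 \<gamma>1 dgmax damax \<alpha> da \<beta> db"
    and coefficients: "admissible_coefficients m_a M_a L_a a"
    and weak: "weak_solution T \<alpha> da \<beta> db a f u0 v vt" and k: "1 \<le> k"
    and regular: "regular_solution T k Rtt Rt Ry RyH RH v vt vtt"
    and P: "is_partition M x" and \<delta>: "0 < \<delta>" and T_eq: "T = real ni * \<delta>"
    and source_L2: "\<And>i n. n \<le> ni \<Longrightarrow> source \<alpha> \<beta> f i (real n * \<delta>) \<in> L2 0 1"
    and euler: "backward_euler \<alpha> da \<beta> db a f u0 \<xi> M x k \<delta> ni V"
begin

abbreviation "t n \<equiv> real n * \<delta>"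

text \<open>In these three bounds the summand 1 is the slack of \<open>Linf_norm_AE\<close>;
  absolute values stand in for sign assumptions on the given numbers.\<close>

definition "AH = \<bar>RH\<bar> + 1"
definition "At = \<bar>Rt\<bar> + 1"
definition "Att = \<bar>Rtt\<bar> + 1"
text \<open>Bounds both \<open>b1\<close> and its derivative in space, which appears when the
  convection term is integrated by parts.\<close>

definition "B = (\<bar>damax\<bar> + \<bar>dgmax\<bar>) / \<gamma>0"
text \<open>Ellipticity constant: a lower bound for \<open>b2\<close> times any diffusion
  coefficient.\<close>

definition "c = m_a / \<gamma>1\<^sup>2"
text \<open>Lipschitz constant of \<open>b2\<close> times the diffusion coefficient with respect to
  the means of the species, multiplied by the bound on the second space derivative.\<close>

definition "E = \<bar>L_a\<bar> * \<bar>\<gamma>1\<bar> / \<gamma>0\<^sup>2 * AH"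
definition "N = real CARD('n)"
definition "H = mesh_size M x ^ Suc k"
text \<open>The target order; merging its two parts leaves a single small quantity in the energy
  argument.\<close>

definition "\<eta> = H + \<delta>"

lemma constants_pos: "0 < AH" "0 < At" "0 < Att" "0 \<le> B" "0 \<le> E" "0 < N" "0 < H" "0 < \<eta>" "H \<le> \<eta>" "\<delta> \<le> \<eta>"
proof -
  show "0 < AH" "0 < At" "0 < Att" by (auto simp: AH_def At_def Att_def)
  then show "0 \<le> E" by (simp add: E_def)
  show "0 \<le> B" using \<gamma>0 by (simp add: B_def)
  have "0 < CARD('n)" by (simp add: card_gt_0_iff)
  then show "0 < N" unfolding N_def by linarith
  show H: "0 < H" unfolding H_def using mesh_size_pos[OF P] by simp
  show "0 < \<eta>" "H \<le> \<eta>" "\<delta> \<le> \<eta>" using H \<delta> by (auto simp: \<eta>_def)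
qed

lemma t_mem: "n \<le> ni \<Longrightarrow> t n \<in> {0..T}"
  using \<delta> by (auto simp: T_eq)

lemma t_Suc: "t (Suc n) - t n = \<delta>"
  by (simp add: algebra_simps)

lemma gap: assumes "s \<in> {0..T}" shows "\<gamma>0 < gap \<alpha> \<beta> s" "gap \<alpha> \<beta> s < \<gamma>1" "\<bar>db s - da s\<bar> \<le> dgmax" "\<bar>da s\<bar> \<le> damax"
  using domain assms by (auto simp: admissible_domain_def)

lemma \<gamma>1: "0 < \<gamma>1"
  using gap[of 0] T \<gamma>0 by auto

lemma c_pos: "0 < c"
  using m_a \<gamma>1 by (simp add: c_def)

lemma v_continuous: "continuous_in_L2 T (v i)" and vt_continuous: "continuous_in_L2 T (vt i)"
  and v_deriv: "weak_time_deriv T (v i) (vt i)" and vt_deriv: "weak_time_deriv T (vt i) (vtt i)"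
  using weak regular by (auto simp: weak_solution_def regular_solution_def)

lemma AE_v: "AE s in leb 0 T. v i s \<in> sobolev 0 1 (Suc k) \<and> sobolev_norm 0 1 (Suc k) (v i s) \<le> AH"
proof -
  have "Linf_norm T (sobolev 0 1 (k + 1)) (sobolev_norm 0 1 (k + 1)) (v i) \<le> ereal RH"
    using regular by (simp add: regular_solution_def)
  from Linf_norm_AE[OF this] show ?thesis by eventually_elim (auto simp: AH_def)
qed

lemma AE_vt: "AE s in leb 0 T. vt i s \<in> sobolev 0 1 (Suc k) \<and> sobolev_norm 0 1 (Suc k) (vt i s) \<le> At"
proof -
  have "Linf_norm T (sobolev 0 1 (k + 1)) (sobolev_norm 0 1 (k + 1)) (vt i) \<le> ereal Rt"
    using regular by (simp add: regular_solution_def)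
  from Linf_norm_AE[OF this] show ?thesis by eventually_elim (auto simp: At_def)
qed

lemma AE_vtt: "AE s in leb 0 T. vtt i s \<in> L2 0 1 \<and> L2_norm 0 1 (vtt i s) \<le> Att"
proof -
  have "Linf_norm T (L2 0 1) (L2_norm 0 1) (vtt i) \<le> ereal Rtt" using regular by (simp add: regular_solution_def)
  from Linf_norm_AE[OF this] show ?thesis by eventually_elim (auto simp: Att_def)
qed

lemma AE_v0: "AE s in leb 0 T. v i s \<in> sobolev0 0 1"
proof -
  have "Linf_norm T (sobolev0 0 1 \<inter> sobolev 0 1 2) (sobolev_norm 0 1 2) (v i) < \<infinity>" using weak by (simp add: weak_solution_def)
  from Linf_norm_finite_AE[OF this] show ?thesis by eventually_elim simp
qed

lemma profile_at:
  assumes "s \<in> {0..T}" shows "\<exists>D z. profile k AH (v i s) D z"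
proof (rule profile_exists[OF continuous_in_L2_L2[OF v_continuous assms] less_imp_le[OF constants_pos(1)] k])
  show "\<bar>L2_inner 0 1 (v i s) ((deriv ^^ j) \<phi>)\<bar> \<le> AH * L2_norm 0 1 \<phi>" if "j \<le> Suc k" "\<phi> \<in> test_functions 0 1" for j \<phi>
    by (rule sobolev_profile_bounds[OF T v_continuous AE_v assms that])
  show "\<bar>L2_inner 0 1 (v i s) (poly (pderiv p))\<bar> \<le> AH * L2_norm 0 1 (poly p)" for p
    by (rule sobolev0_bound_poly[OF T v_continuous AE_v0 AE_v _ assms]) simp
qed

section \<open>Profiles, projections and errors at the time levels\<close>

definition D :: "'n \<Rightarrow> nat \<Rightarrow> nat \<Rightarrow> real \<Rightarrow> real" where "D i n = (SOME D. \<exists>z. profile k AH (v i (t n)) D z)"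
definition Z :: "'n \<Rightarrow> nat \<Rightarrow> real \<Rightarrow> real" where "Z i n = (SOME z. profile k AH (v i (t n)) (D i n) z)"

lemma profile_D:
  assumes "n \<le> ni" shows "profile k AH (v i (t n)) (D i n) (Z i n)"
proof -
  have "\<exists>z. profile k AH (v i (t n)) (D i n) z" unfolding D_def by (rule someI_ex[OF profile_at[OF t_mem[OF assms]]])
  then show ?thesis unfolding Z_def by (rule someI_ex)
qed

lemma D_props:
  assumes "n \<le> ni"
  shows "AE y in leb 0 1. v i (t n) y = D i n 0 y" "j \<le> k \<Longrightarrow> acd 0 1 (D i n j) (D i n (Suc j))"
    "L2_norm 0 1 (D i n (Suc k)) \<le> AH" "D i n 0 0 = 0" "D i n 0 1 = 0" "acd 0 1 (D i n 0) (D i n 1)" "acd 0 1 (D i n 1) (Z i n)"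
    "L2_norm 0 1 (Z i n) \<le> AH" "L2_norm 0 1 (D i n 1) \<le> AH"
proof -
  note p = profile_D[OF assms, of i, unfolded profile_def]
  from p show "AE y in leb 0 1. v i (t n) y = D i n 0 y" "j \<le> k \<Longrightarrow> acd 0 1 (D i n j) (D i n (Suc j))"
    "L2_norm 0 1 (D i n (Suc k)) \<le> AH" "D i n 0 0 = 0" "D i n 0 1 = 0" "acd 0 1 (D i n 1) (Z i n)"
    "L2_norm 0 1 (Z i n) \<le> AH" "L2_norm 0 1 (D i n 1) \<le> AH" by blast+
  from p have "\<forall>j\<le>k. acd 0 1 (D i n j) (D i n (Suc j))" by blast
  from this[rule_format, of 0] show "acd 0 1 (D i n 0) (D i n 1)" by simp
qed

definition R :: "'n \<Rightarrow> nat \<Rightarrow> real \<Rightarrow> real" where "R i n = (SOME R. ritz M x k (D i n 0) R)"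

lemma ritz_R:
  assumes "n \<le> ni" shows "ritz M x k (D i n 0) (R i n)"
proof -
  have "\<exists>R. ritz M x k (D i n 0) R"
    using ritz_exists[where D="D i n", OF P k D_props(2)[OF assms] D_props(4)[OF assms] D_props(5)[OF assms]] by blast
  then show ?thesis unfolding R_def by (rule someI_ex)
qed

lemma R_acd: "n \<le> ni \<Longrightarrow> \<exists>r. acd 0 1 (R i n) r"
  by (rule fe_acd_exists[OF P ritz_fe[OF ritz_R]])

lemma V_fe: "n \<le> ni \<Longrightarrow> V i n \<in> fe_space M x k"
  using euler by (cases n) (auto simp: backward_euler_def is_interpolant_def)

lemma L2_facts:
  assumes "n \<le> ni" shows "D i n 0 \<in> L2 0 1" "R i n \<in> L2 0 1" "V i n \<in> L2 0 1" "v i (t n) \<in> L2 0 1" "vt i (t n) \<in> L2 0 1"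
proof -
  show "D i n 0 \<in> L2 0 1" by (rule acd_L2_fun[OF D_props(6)[OF assms]])
  show "R i n \<in> L2 0 1" using R_acd[OF assms] acd_L2_fun by blast
  show "V i n \<in> L2 0 1" using fe_acd_exists[OF P V_fe[OF assms]] acd_L2_fun by blast
  show "v i (t n) \<in> L2 0 1" "vt i (t n) \<in> L2 0 1"
    by (rule continuous_in_L2_L2[OF v_continuous t_mem[OF assms]], rule continuous_in_L2_L2[OF vt_continuous t_mem[OF assms]])
qed

definition "p i n = L2_norm 0 1 (\<lambda>y. V i n y - R i n y)"

lemma p_nonneg: "0 \<le> p i n"
  by (simp add: p_def)

lemma rho_bound:
  assumes "n \<le> ni" shows "L2_norm 0 1 (\<lambda>y. D i n 0 y - R i n y) \<le> H * AH"
proof -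
  have "L2_norm 0 1 (\<lambda>y. D i n 0 y - R i n y) \<le> mesh_size M x ^ Suc k * L2_norm 0 1 (D i n (Suc k))"
    by (rule ritz_error[where D="D i n", OF P k D_props(2)[OF assms] D_props(4)[OF assms] D_props(5)[OF assms] ritz_R[OF assms]])
  also have "\<dots> \<le> H * AH" unfolding H_def[symmetric] using constants_pos(7) by (intro mult_left_mono D_props(3)[OF assms]) simp
  finally show ?thesis .
qed

text \<open>The increment of the projection error is the projection error of the increment, to which
  the order \<open>H\<close> and the Lipschitz bound in time both apply.\<close>

lemma rho_diff_bound:
  assumes "n < ni"
  shows "L2_norm 0 1 (\<lambda>y. (D i (Suc n) 0 y - R i (Suc n) y) - (D i n 0 y - R i n y)) \<le> H * (At * \<delta>)"
proof -
  have n: "n \<le> ni" "Suc n \<le> ni" using assms by auto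
  define F where "F j = (\<lambda>y. D i (Suc n) j y - D i n j y)" for j
  have rz: "ritz M x k (F 0) (\<lambda>y. R i (Suc n) y - R i n y)"
    unfolding F_def by (rule ritz_diff[OF P ritz_R[OF n(2)] ritz_R[OF n(1)] D_props(6)[OF n(2)] D_props(6)[OF n(1)]])
  have "L2_norm 0 1 (\<lambda>y. F 0 y - (R i (Suc n) y - R i n y)) \<le> mesh_size M x ^ Suc k * L2_norm 0 1 (F (Suc k))"
  proof (rule ritz_error[where D=F, OF P k _ _ _ rz])
    show "acd 0 1 (F j) (F (Suc j))" if "j \<le> k" for j
      unfolding F_def by (rule acd_diff[OF D_props(2)[OF n(2) that] D_props(2)[OF n(1) that]])
    show "F 0 0 = 0" "F 0 1 = 0" using D_props(4,5)[OF n(1), of i] D_props(4,5)[OF n(2), of i] by (simp_all add: F_def)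
  qed
  also have "\<dots> \<le> H * (At * \<delta>)"
  proof -
    have "L2_norm 0 1 (F (Suc k)) \<le> At * \<bar>t (Suc n) - t n\<bar>"
      unfolding F_def by (rule profile_diff_bound[OF T v_deriv v_continuous less_imp_le[OF constants_pos(2)] AE_vt t_mem[OF n(1)] t_mem[OF n(2)] profile_D[OF n(2)] profile_D[OF n(1)]])
    then show ?thesis unfolding H_def[symmetric] t_Suc using \<delta> constants_pos(7) by (intro mult_left_mono) auto
  qed
  finally show ?thesis by (simp add: F_def algebra_simps)
qed

text \<open>\<open>V\<close> starts from the interpolant: one \<open>H * AH\<close> for the
  interpolation error, one for the projection error.\<close>

lemma initial_bound: "p i 0 \<le> 2 * (H * AH)"
proof -
  note d = D_props[OF le0, where i=i] and l = L2_facts[OF le0, where i=i]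
  have int: "is_interpolant \<xi> M x k (initial \<alpha> \<beta> u0 i) (V i 0)" using euler by (simp add: backward_euler_def)
  have "AE y in leb 0 1. v i 0 y = initial \<alpha> \<beta> u0 i y" using weak by (simp add: weak_solution_def)
  moreover have "AE y in leb 0 1. v i 0 y = D i 0 0 y" using d(1) by simp
  ultimately have "AE y in leb 0 1. initial \<alpha> \<beta> u0 i y = D i 0 0 y" by eventually_elim simp
  from interpolation_error[where D="D i 0", OF P k \<xi> d(2) this int]
  have "L2_norm 0 1 (\<lambda>y. D i 0 0 y - V i 0 y) \<le> H * L2_norm 0 1 (D i 0 (Suc k))" unfolding H_def .
  also have "\<dots> \<le> H * AH" using constants_pos(7) by (intro mult_left_mono d(3)) simp
  finally have "L2_norm 0 1 (\<lambda>y. V i 0 y - D i 0 0 y) \<le> H * AH" using L2_norm_minus_commute[of 0 1 "V i 0"] by simp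
  then show ?thesis unfolding p_def
    using L2_norm_triangle_mid[OF l(3,1,2)] rho_bound[OF le0, of i] by linarith
qed

section \<open>Coefficients, consistency and the residual\<close>

lemma diffusion_bounds:
  assumes "s \<in> {0..T}"
  shows "c \<le> b2 \<alpha> \<beta> s * diffusion \<alpha> \<beta> a s w i" "\<bar>b2 \<alpha> \<beta> s * diffusion \<alpha> \<beta> a s w i\<bar> \<le> \<bar>M_a\<bar> / \<gamma>0\<^sup>2"
proof -
  note g = gap[OF assms]
  have gg: "\<gamma>0\<^sup>2 \<le> (gap \<alpha> \<beta> s)\<^sup>2" "(gap \<alpha> \<beta> s)\<^sup>2 \<le> \<gamma>1\<^sup>2" "0 < (gap \<alpha> \<beta> s)\<^sup>2"
    using g \<gamma>0 by (auto intro!: power_mono)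
  have a: "m_a \<le> diffusion \<alpha> \<beta> a s w i" "diffusion \<alpha> \<beta> a s w i \<le> M_a"
    using coefficients by (auto simp: admissible_coefficients_def diffusion_def)
  have eq: "b2 \<alpha> \<beta> s * diffusion \<alpha> \<beta> a s w i = diffusion \<alpha> \<beta> a s w i / (gap \<alpha> \<beta> s)\<^sup>2" by (simp add: b2_def)
  show "c \<le> b2 \<alpha> \<beta> s * diffusion \<alpha> \<beta> a s w i" unfolding eq c_def using a m_a gg by (intro frac_le) auto
  have "\<bar>diffusion \<alpha> \<beta> a s w i\<bar> \<le> \<bar>M_a\<bar>" using a m_a by linarith
  then show "\<bar>b2 \<alpha> \<beta> s * diffusion \<alpha> \<beta> a s w i\<bar> \<le> \<bar>M_a\<bar> / \<gamma>0\<^sup>2"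
    unfolding eq abs_divide using gg \<gamma>0 by (intro frac_le) auto
qed

lemma b1_bound:
  assumes "s \<in> {0..T}" "y \<in> {0..1}" shows "\<bar>da s / gap \<alpha> \<beta> s + (db s - da s) / gap \<alpha> \<beta> s * y\<bar> \<le> B"
    and "\<bar>(db s - da s) / gap \<alpha> \<beta> s\<bar> \<le> B"
proof -
  note g = gap[OF assms(1)]
  have 1: "\<bar>(db s - da s) / gap \<alpha> \<beta> s\<bar> \<le> \<bar>dgmax\<bar> / \<gamma>0" unfolding abs_divide using g \<gamma>0 by (intro frac_le) auto
  have 2: "\<bar>da s / gap \<alpha> \<beta> s\<bar> \<le> \<bar>damax\<bar> / \<gamma>0" unfolding abs_divide using g \<gamma>0 by (intro frac_le) auto
  have "\<bar>(db s - da s) / gap \<alpha> \<beta> s * y\<bar> \<le> \<bar>(db s - da s) / gap \<alpha> \<beta> s\<bar> * 1"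
    unfolding abs_mult using assms(2) by (intro mult_left_mono) auto
  then show "\<bar>da s / gap \<alpha> \<beta> s + (db s - da s) / gap \<alpha> \<beta> s * y\<bar> \<le> B"
    using 1 2 unfolding B_def add_divide_distrib by linarith
  have "0 \<le> \<bar>damax\<bar> / \<gamma>0" using \<gamma>0 by simp
  then show "\<bar>(db s - da s) / gap \<alpha> \<beta> s\<bar> \<le> B" using 1 unfolding B_def add_divide_distrib by linarith
qed

lemma b1_eq: "b1 \<alpha> da \<beta> db s = (\<lambda>y. da s / gap \<alpha> \<beta> s + (db s - da s) / gap \<alpha> \<beta> s * y)"
  by (simp add: b1_def fun_eq_iff add_divide_distrib)

lemma v_V_bound:
  assumes "n \<le> ni" shows "L2_norm 0 1 (\<lambda>y. V i n y - v i (t n) y) \<le> p i n + H * AH"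
proof -
  note l = L2_facts[OF assms, of i]
  have "AE y in leb 0 1. V i n y - v i (t n) y = V i n y - D i n 0 y" using D_props(1)[OF assms, of i] by eventually_elim simp
  then have "L2_norm 0 1 (\<lambda>y. V i n y - v i (t n) y) = L2_norm 0 1 (\<lambda>y. V i n y - D i n 0 y)"
    by (rule L2_norm_cong_AE[OF L2_diff[OF l(3,4)] L2_diff[OF l(3,1)]])
  also have "\<dots> \<le> p i n + L2_norm 0 1 (\<lambda>y. R i n y - D i n 0 y)" unfolding p_def by (rule L2_norm_triangle_mid[OF l(3,2,1)])
  finally show ?thesis using rho_bound[OF assms, of i] L2_norm_minus_commute[of 0 1 "R i n" "D i n 0"] by simp
qed

text \<open>The nonlocal arguments are means, bounded by \<open>L\<^sub>2\<close> norms, so they see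
  the full order of the error and no derivative. The factor \<open>AH\<close> is built in because
  the difference will multiply the norm of \<open>Z\<close>.\<close>

lemma diffusion_diff:
  assumes "n \<le> ni"
  shows "\<bar>b2 \<alpha> \<beta> (t n) * diffusion \<alpha> \<beta> a (t n) (\<lambda>j. v j (t n)) i - b2 \<alpha> \<beta> (t n) * diffusion \<alpha> \<beta> a (t n) (\<lambda>j. V j n) i\<bar> * AH
     \<le> E * ((\<Sum>j\<in>UNIV. p j n) + N * \<eta> * AH)"
proof -
  note g = gap[OF t_mem[OF assms]]
  let ?s = "t n"
  have nl: "\<bar>nonlocal \<alpha> \<beta> ?s (v j ?s) - nonlocal \<alpha> \<beta> ?s (V j n)\<bar> \<le> \<gamma>1 * (p j n + H * AH)" for j
  proof -
    note l = L2_facts[OF assms, of j]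
    have "(LINT y|leb 0 1. V j n y - v j ?s y) = (LINT y|leb 0 1. V j n y) - (LINT y|leb 0 1. v j ?s y)"
      by (rule Bochner_Integration.integral_diff[OF L2_integrable[OF l(3)] L2_integrable[OF l(4)]])
    moreover have "\<bar>LINT y|leb 0 1. V j n y - v j ?s y\<bar> \<le> L2_norm 0 1 (\<lambda>y. V j n y - v j ?s y)"
      using abs_LINT_le_L2[OF zero_le_one L2_diff[OF l(3,4)]] by simp
    ultimately have I: "\<bar>(LINT y|leb 0 1. v j ?s y) - (LINT y|leb 0 1. V j n y)\<bar> \<le> p j n + H * AH"
      using v_V_bound[OF assms, of j] by linarith
    have "\<bar>nonlocal \<alpha> \<beta> ?s (v j ?s) - nonlocal \<alpha> \<beta> ?s (V j n)\<bar> = \<bar>gap \<alpha> \<beta> ?s\<bar> * \<bar>(LINT y|leb 0 1. v j ?s y) - (LINT y|leb 0 1. V j n y)\<bar>"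
      unfolding nonlocal_def right_diff_distrib[symmetric] abs_mult ..
    also have "\<dots> \<le> \<gamma>1 * (p j n + H * AH)" using g \<gamma>0 I by (intro mult_mono) auto
    finally show ?thesis .
  qed
  define X where "X = (\<chi> j. nonlocal \<alpha> \<beta> ?s (v j ?s))"
  define Y where "Y = (\<chi> j. nonlocal \<alpha> \<beta> ?s (V j n))"
  have "dist X Y \<le> (\<Sum>j\<in>UNIV. \<bar>(X - Y) $ j\<bar>)" unfolding dist_norm by (rule norm_le_l1_cart)
  also have "\<dots> \<le> (\<Sum>j\<in>UNIV. \<gamma>1 * (p j n + H * AH))" by (rule sum_mono) (simp add: X_def Y_def nl)
  also have "\<dots> = \<gamma>1 * ((\<Sum>j\<in>UNIV. p j n) + N * (H * AH))"
    by (simp add: sum_distrib_left[symmetric] sum.distrib N_def)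
  also have "\<dots> \<le> \<gamma>1 * ((\<Sum>j\<in>UNIV. p j n) + N * \<eta> * AH)"
    using constants_pos \<gamma>1 by (intro mult_left_mono add_left_mono) (auto simp: mult.assoc intro!: mult_left_mono mult_right_mono)
  finally have dXY: "dist X Y \<le> \<gamma>1 * ((\<Sum>j\<in>UNIV. p j n) + N * \<eta> * AH)" .
  define Q where "Q = (\<Sum>j\<in>UNIV. p j n) + N * \<eta> * AH"
  have lip: "L_a-lipschitz_on UNIV (a i)" using coefficients by (simp add: admissible_coefficients_def)
  have La: "0 \<le> L_a" by (rule lipschitz_on_nonneg[OF lip])
  have "\<bar>a i X - a i Y\<bar> \<le> L_a * dist X Y" using lipschitz_onD[OF lip, of X Y] by (simp add: dist_real_def)
  also have "\<dots> \<le> L_a * (\<gamma>1 * Q)" using dXY La unfolding Q_def by (intro mult_left_mono) auto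
  finally have aXY: "\<bar>a i X - a i Y\<bar> \<le> L_a * (\<gamma>1 * Q)" .
  have b2: "0 \<le> b2 \<alpha> \<beta> ?s" "b2 \<alpha> \<beta> ?s \<le> 1 / \<gamma>0\<^sup>2" unfolding b2_def using g \<gamma>0 by (auto intro!: divide_left_mono power_mono)
  have "\<bar>b2 \<alpha> \<beta> ?s * a i X - b2 \<alpha> \<beta> ?s * a i Y\<bar> = b2 \<alpha> \<beta> ?s * \<bar>a i X - a i Y\<bar>"
    unfolding right_diff_distrib[symmetric] abs_mult using b2(1) by simp
  also have "\<dots> \<le> 1 / \<gamma>0\<^sup>2 * (L_a * (\<gamma>1 * Q))" using b2 aXY by (intro mult_mono) auto
  finally have "\<bar>b2 \<alpha> \<beta> ?s * a i X - b2 \<alpha> \<beta> ?s * a i Y\<bar> * AH \<le> 1 / \<gamma>0\<^sup>2 * (L_a * (\<gamma>1 * Q)) * AH"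
    using constants_pos(1) by (intro mult_right_mono) auto
  also have "\<dots> = E * Q" using La \<gamma>1 by (simp add: E_def)
  finally show ?thesis by (simp add: diffusion_def X_def Y_def Q_def)
qed

text \<open>Profiles differ from the solution on null sets only; what remains is the Taylor estimate
  divided by \<open>\<delta>\<close>.\<close>

lemma taylor_bound:
  assumes "n < ni"
  shows "L2_norm 0 1 (\<lambda>y. vt i (t (Suc n)) y - (D i (Suc n) 0 y - D i n 0 y) / \<delta>) \<le> Att * \<delta>"
proof -
  have n: "n \<le> ni" "Suc n \<le> ni" using assms by auto
  note l = L2_facts[OF n(2), of i] and l' = L2_facts[OF n(1), of i]
  have T1: "L2_norm 0 1 (\<lambda>y. v i (t (Suc n)) y - v i (t n) y - (t (Suc n) - t n) * vt i (t (Suc n)) y) \<le> Att * (t (Suc n) - t n)\<^sup>2"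
    by (rule weak_time_deriv_taylor[OF T v_deriv vt_deriv v_continuous vt_continuous less_imp_le[OF constants_pos(3)] AE_vtt])
      (use t_mem[OF n(1)] t_mem[OF n(2)] \<delta> in \<open>auto intro: mult_right_mono\<close>)
  let ?w = "\<lambda>y. v i (t (Suc n)) y - v i (t n) y - \<delta> * vt i (t (Suc n)) y"
  have wL: "?w \<in> L2 0 1" by (intro L2_diff L2_cmult l l')
  have rL: "(\<lambda>y. vt i (t (Suc n)) y - (D i (Suc n) 0 y - D i n 0 y) / \<delta>) \<in> L2 0 1" by (intro L2_diff L2_divide l l')
  have "AE y in leb 0 1. vt i (t (Suc n)) y - (D i (Suc n) 0 y - D i n 0 y) / \<delta> = (- 1 / \<delta>) * ?w y"
    using D_props(1)[OF n(1), of i] D_props(1)[OF n(2), of i]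
  proof eventually_elim
    fix y assume "v i (t n) y = D i n 0 y" "v i (t (Suc n)) y = D i (Suc n) 0 y"
    then show "vt i (t (Suc n)) y - (D i (Suc n) 0 y - D i n 0 y) / \<delta> = (- 1 / \<delta>) * ?w y" using \<delta> by (simp add: field_simps)
  qed
  then have "L2_norm 0 1 (\<lambda>y. vt i (t (Suc n)) y - (D i (Suc n) 0 y - D i n 0 y) / \<delta>) = L2_norm 0 1 (\<lambda>y. (- 1 / \<delta>) * ?w y)"
    by (rule L2_norm_cong_AE[OF rL L2_cmult[OF wL]])
  also have "\<dots> = L2_norm 0 1 ?w / \<delta>" unfolding L2_norm_cmult using \<delta> by simp
  also have "\<dots> \<le> Att * \<delta>\<^sup>2 / \<delta>" using T1 \<delta> unfolding t_Suc by (intro divide_right_mono) auto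
  also have "\<dots> = Att * \<delta>" using \<delta> by (simp add: power2_eq_square)
  finally show ?thesis .
qed

text \<open>Defect of the exact profile in the strong equation, defined also at the final
  time.\<close>

definition residual :: "'n \<Rightarrow> nat \<Rightarrow> real \<Rightarrow> real" where
  "residual i n y = source \<alpha> \<beta> f i (t n) y - (vt i (t n) y
     - b2 \<alpha> \<beta> (t n) * diffusion \<alpha> \<beta> a (t n) (\<lambda>j. v j (t n)) i * Z i n y - b1 \<alpha> da \<beta> db (t n) y * D i n 1 y)"

lemma b1_continuous: "continuous_on {0..1} (b1 \<alpha> da \<beta> db s)"
  unfolding b1_eq by (intro continuous_intros)

text \<open>The weak equation is assumed on the open time interval, hence the strict
  inequalities.\<close>

lemma residual_interior:
  assumes "0 < n" "n < ni" shows "L2_norm 0 1 (residual i n) = 0"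
proof -
  have n: "n \<le> ni" using assms by simp
  have tn: "t n \<in> {0<..<T}" using assms \<delta> by (simp add: T_eq)
  have "AE y in leb 0 1. residual i n y = 0" unfolding residual_def
  proof (rule strong_equation[OF profile_D[OF n] L2_facts(4)[OF n] L2_facts(5)[OF n] source_L2[OF n] b1_continuous])
    fix w assume w: "w \<in> sobolev0 0 1"
    show "L2_inner 0 1 (vt i (t n)) w + b2 \<alpha> \<beta> (t n) * diffusion \<alpha> \<beta> a (t n) (\<lambda>j. v j (t n)) i * L2_inner 0 1 (weak_deriv 0 1 1 (v i (t n))) (weak_deriv 0 1 1 w)
      - L2_inner 0 1 (\<lambda>y. b1 \<alpha> da \<beta> db (t n) y * weak_deriv 0 1 1 (v i (t n)) y) w = L2_inner 0 1 (source \<alpha> \<beta> f i (t n)) w"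
      using conjunct2[OF weak[unfolded weak_solution_def]] tn w by (subst mult.commute[of "b2 \<alpha> \<beta> (t n)"]) blast
  qed
  moreover have "residual i n \<in> L2 0 1" unfolding residual_def
    by (intro L2_diff source_L2[OF n] L2_facts(5)[OF n] L2_cmult acd_L2[OF D_props(7)[OF n]] L2_continuous_mult[OF b1_continuous] acd_L2[OF D_props(6)[OF n]])
  ultimately have "L2_norm 0 1 (residual i n) = L2_norm 0 1 (\<lambda>_. 0)" by (intro L2_norm_cong_AE L2_const)
  then show ?thesis by (simp add: L2_norm_def L2_inner_def)
qed

text \<open>At the final time there is no equation to use, but each of the four terms is bounded in
  norm.\<close>

lemma residual_bound:
  assumes n: "n \<le> ni" and G: "L2_norm 0 1 (source \<alpha> \<beta> f i (t n)) \<le> G"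
  shows "L2_norm 0 1 (residual i n) \<le> \<bar>G\<bar> + At + \<bar>M_a\<bar> / \<gamma>0\<^sup>2 * AH + B * AH"
proof -
  let ?b = "b2 \<alpha> \<beta> (t n) * diffusion \<alpha> \<beta> a (t n) (\<lambda>j. v j (t n)) i"
  note gL = source_L2[OF n, of i] and vtL = L2_facts(5)[OF n, of i] and zL = acd_L2[OF D_props(7)[OF n, of i]] and dL = acd_L2[OF D_props(6)[OF n, of i]]
  note bzL = L2_cmult[OF zL, of ?b] and bdL = L2_continuous_mult[OF b1_continuous dL, of "t n"]
  have 1: "L2_norm 0 1 (vt i (t n)) \<le> At"
    by (rule sobolev_norm_all_times[OF T vt_continuous less_imp_le[OF constants_pos(2)] AE_vt t_mem[OF n]])
  have 2: "L2_norm 0 1 (\<lambda>y. ?b * Z i n y) \<le> \<bar>M_a\<bar> / \<gamma>0\<^sup>2 * AH"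
    unfolding L2_norm_cmult using \<gamma>0 by (intro mult_mono diffusion_bounds(2)[OF t_mem[OF n]] D_props(8)[OF n]) auto
  have "L2_norm 0 1 (\<lambda>y. b1 \<alpha> da \<beta> db (t n) y * D i n 1 y) \<le> B * L2_norm 0 1 (D i n 1)"
  proof (rule L2_norm_bounded_mult[OF L2_measurable[OF L2_continuous[OF b1_continuous]] _ dL constants_pos(4)])
    show "\<bar>b1 \<alpha> da \<beta> db (t n) y\<bar> \<le> B" if "y \<in> {0<..<1}" for y
      unfolding b1_eq by (rule b1_bound(1)[OF t_mem[OF n]]) (use that in simp)
  qed
  also have "\<dots> \<le> B * AH" by (rule mult_left_mono[OF D_props(9)[OF n] constants_pos(4)])
  finally have 3: "L2_norm 0 1 (\<lambda>y. b1 \<alpha> da \<beta> db (t n) y * D i n 1 y) \<le> B * AH" .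
  have "L2_norm 0 1 (residual i n) \<le> L2_norm 0 1 (source \<alpha> \<beta> f i (t n)) + (L2_norm 0 1 (vt i (t n)) + L2_norm 0 1 (\<lambda>y. ?b * Z i n y)
      + L2_norm 0 1 (\<lambda>y. b1 \<alpha> da \<beta> db (t n) y * D i n 1 y))"
    unfolding residual_def
    using L2_norm_triangle_diff[OF gL L2_diff[OF L2_diff[OF vtL bzL] bdL]] L2_norm_triangle_diff[OF L2_diff[OF vtL bzL] bdL]
      L2_norm_triangle_diff[OF vtL bzL] by linarith
  then show ?thesis using 1 2 3 G by linarith
qed

text \<open>The constant of \<open>energy_absorb\<close> with \<open>A = Att + At\<close> and
  \<open>R = AH\<close>.\<close>

definition "K1 = (Att + At) + E * N * AH + E + B * AH + B\<^sup>2 / (2 * c) + (B * AH)\<^sup>2 / (2 * c)"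

lemma K1_nonneg: "0 \<le> K1"
  unfolding K1_def using constants_pos c_pos by (auto intro!: add_nonneg_nonneg)

text \<open>\<open>\<kappa>\<close> will be 0 at interior levels and the crude bound of
  \<open>residual_bound\<close> at the last one.\<close>

lemma species_step:
  assumes n: "n < ni" and \<kappa>: "L2_norm 0 1 (residual i (Suc n)) \<le> \<kappa>"
  shows "((p i (Suc n))\<^sup>2 - (p i n)\<^sup>2) / (2 * \<delta>) \<le> \<kappa> * p i (Suc n)
    + K1 * (p i (Suc n) * \<eta> + p i (Suc n) * (\<Sum>j\<in>UNIV. p j (Suc n)) + (p i (Suc n))\<^sup>2 + \<eta>\<^sup>2)"
proof -
  have n': "n \<le> ni" "Suc n \<le> ni" using n by auto
  let ?t = "t (Suc n)"
  let ?p = "p i (Suc n)" and ?\<rho> = "L2_norm 0 1 (\<lambda>y. D i (Suc n) 0 y - R i (Suc n) y)"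
  let ?av = "b2 \<alpha> \<beta> ?t * diffusion \<alpha> \<beta> a ?t (\<lambda>j. v j ?t) i" and ?aV = "b2 \<alpha> \<beta> ?t * diffusion \<alpha> \<beta> a ?t (\<lambda>j. V j (Suc n)) i"
  have eq: "L2_inner 0 1 (\<lambda>y. (V i (Suc n) y - V i n y) / \<delta>) W + ?aV * dinner (V i (Suc n)) W
       - L2_inner 0 1 (\<lambda>y. (da ?t / gap \<alpha> \<beta> ?t + (db ?t - da ?t) / gap \<alpha> \<beta> ?t * y) * weak_deriv 0 1 1 (V i (Suc n)) y) W
      = L2_inner 0 1 (source \<alpha> \<beta> f i ?t) W" if "W \<in> fe_space M x k" for W
    using euler n that unfolding backward_euler_def Let_def dinner_def b1_eq by blast
  have "\<exists>r\<ge>0. ((p i (Suc n))\<^sup>2 - (p i n)\<^sup>2) / (2 * \<delta>) \<le> ?p * (L2_norm 0 1 (\<lambda>y. source \<alpha> \<beta> f i ?t y - (vt i ?t y - ?av * Z i (Suc n) y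
          - (da ?t / gap \<alpha> \<beta> ?t + (db ?t - da ?t) / gap \<alpha> \<beta> ?t * y) * D i (Suc n) 1 y))
       + L2_norm 0 1 (\<lambda>y. vt i ?t y - (D i (Suc n) 0 y - D i n 0 y) / \<delta>)
       + L2_norm 0 1 (\<lambda>y. (D i (Suc n) 0 y - R i (Suc n) y) - (D i n 0 y - R i n y)) / \<delta> + \<bar>?av - ?aV\<bar> * L2_norm 0 1 (Z i (Suc n)))
       + B * r * ?p + B * ?\<rho> * (?p + r) - c * r\<^sup>2"
    unfolding p_def
    by (rule energy_step[OF P \<delta> D_props(6)[OF n'(2)] D_props(7)[OF n'(2)] D_props(6)[OF n'(1)] D_props(4)[OF n'(2)] D_props(5)[OF n'(2)]
        ritz_R[OF n'(2)] ritz_R[OF n'(1)] V_fe[OF n'(2)] V_fe[OF n'(1)] source_L2[OF n'(2)] L2_facts(5)[OF n'(2)] eq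
        b1_bound(1)[OF t_mem[OF n'(2)]] b1_bound(2)[OF t_mem[OF n'(2)], of 0] diffusion_bounds(1)[OF t_mem[OF n'(2)]]]) simp_all
  then obtain r where r: "0 \<le> r" "((p i (Suc n))\<^sup>2 - (p i n)\<^sup>2) / (2 * \<delta>) \<le> ?p * (L2_norm 0 1 (residual i (Suc n))
       + L2_norm 0 1 (\<lambda>y. vt i ?t y - (D i (Suc n) 0 y - D i n 0 y) / \<delta>)
       + L2_norm 0 1 (\<lambda>y. (D i (Suc n) 0 y - R i (Suc n) y) - (D i n 0 y - R i n y)) / \<delta> + \<bar>?av - ?aV\<bar> * L2_norm 0 1 (Z i (Suc n)))
       + B * r * ?p + B * ?\<rho> * (?p + r) - c * r\<^sup>2"
    unfolding residual_def b1_eq by blast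
  have 1: "L2_norm 0 1 (\<lambda>y. vt i ?t y - (D i (Suc n) 0 y - D i n 0 y) / \<delta>) \<le> Att * \<eta>"
    using taylor_bound[OF n, of i] mult_left_mono[OF constants_pos(10), of Att] constants_pos(3) by linarith
  have 2: "L2_norm 0 1 (\<lambda>y. (D i (Suc n) 0 y - R i (Suc n) y) - (D i n 0 y - R i n y)) / \<delta> \<le> At * \<eta>"
  proof -
    have "L2_norm 0 1 (\<lambda>y. (D i (Suc n) 0 y - R i (Suc n) y) - (D i n 0 y - R i n y)) / \<delta> \<le> H * (At * \<delta>) / \<delta>"
      using \<delta> by (intro divide_right_mono rho_diff_bound[OF n]) simp
    also have "\<dots> = At * H" using \<delta> by simp
    also have "\<dots> \<le> At * \<eta>" using constants_pos by (intro mult_left_mono) auto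
    finally show ?thesis .
  qed
  have "\<bar>?av - ?aV\<bar> * L2_norm 0 1 (Z i (Suc n)) \<le> \<bar>?av - ?aV\<bar> * AH" by (intro mult_left_mono D_props(8)[OF n'(2)]) simp
  then have 3: "\<bar>?av - ?aV\<bar> * L2_norm 0 1 (Z i (Suc n)) \<le> E * ((\<Sum>j\<in>UNIV. p j (Suc n)) + N * \<eta> * AH)"
    using diffusion_diff[OF n'(2), of i] by linarith
  have 4: "?\<rho> \<le> \<eta> * AH" using rho_bound[OF n'(2), of i] mult_right_mono[OF constants_pos(9), of AH] constants_pos(1) by linarith
  have sum: "L2_norm 0 1 (residual i (Suc n)) + L2_norm 0 1 (\<lambda>y. vt i ?t y - (D i (Suc n) 0 y - D i n 0 y) / \<delta>)
      + L2_norm 0 1 (\<lambda>y. (D i (Suc n) 0 y - R i (Suc n) y) - (D i n 0 y - R i n y)) / \<delta> + \<bar>?av - ?aV\<bar> * L2_norm 0 1 (Z i (Suc n))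
     \<le> \<kappa> + \<eta> * (Att + At) + E * ((\<Sum>j\<in>UNIV. p j (Suc n)) + N * \<eta> * AH)"
  proof -
    have "\<eta> * (Att + At) = Att * \<eta> + At * \<eta>" by (simp add: algebra_simps)
    then show ?thesis using \<kappa> 1 2 3 by linarith
  qed
  have "((p i (Suc n))\<^sup>2 - (p i n)\<^sup>2) / (2 * \<delta>) \<le> ?p * (\<kappa> + \<eta> * (Att + At) + E * ((\<Sum>j\<in>UNIV. p j (Suc n)) + N * \<eta> * AH))
      + B * r * ?p + B * ?\<rho> * (?p + r) - c * r\<^sup>2"
    using r(2) mult_left_mono[OF sum p_nonneg[of i "Suc n"]] by linarith
  then show ?thesis unfolding K1_def
    using constants_pos c_pos r(1) p_nonneg 4
    by (intro energy_absorb[where \<rho>="?\<rho>" and r=r]) (auto intro: sum_nonneg)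
qed

section \<open>Summation over the species and in time\<close>

definition "S n = (\<Sum>i\<in>UNIV. (p i n)\<^sup>2)"
text \<open>The factor is that of \<open>energy_sum\<close>.\<close>

definition "K = K1 * (2 + 2 * N)"

lemma S_nonneg: "0 \<le> S n"
  unfolding S_def by (simp add: sum_nonneg)

lemma K_nonneg: "0 \<le> K"
  unfolding K_def using K1_nonneg constants_pos(6) by simp

lemma total_step:
  assumes "n < ni" "\<And>i. L2_norm 0 1 (residual i (Suc n)) \<le> \<kappa>"
  shows "S (Suc n) \<le> S n + 2 * \<delta> * \<kappa> * (\<Sum>i\<in>UNIV. p i (Suc n)) + 2 * \<delta> * K * (S (Suc n) + \<eta>\<^sup>2)"
  unfolding S_def K_def N_def
  by (rule energy_sum[OF p_nonneg K1_nonneg less_imp_le[OF constants_pos(8)] \<delta> species_step[OF assms]])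

lemma S0_bound: "S 0 \<le> 4 * N * AH\<^sup>2 * \<eta>\<^sup>2"
proof -
  have "(p i 0)\<^sup>2 \<le> 4 * AH\<^sup>2 * \<eta>\<^sup>2" for i
  proof -
    have "p i 0 \<le> 2 * (\<eta> * AH)" using initial_bound[of i] mult_right_mono[OF constants_pos(9), of AH] constants_pos(1) by linarith
    then have "(p i 0)\<^sup>2 \<le> (2 * (\<eta> * AH))\<^sup>2" by (rule power_mono[OF _ p_nonneg])
    then show ?thesis by (simp add: power_mult_distrib mult_ac)
  qed
  then have "S 0 \<le> (\<Sum>i\<in>(UNIV :: 'n set). 4 * AH\<^sup>2 * \<eta>\<^sup>2)" unfolding S_def by (rule sum_mono)
  then show ?thesis by (simp add: N_def mult_ac)
qed

lemma S_bound_interior: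
  assumes \<delta>K: "2 * \<delta> * K \<le> 1 / 4" and n: "n < ni"
  shows "S n \<le> exp (4 * K * T) * (4 * N * AH\<^sup>2 + 2 * K * T) * \<eta>\<^sup>2"
proof -
  have x: "0 \<le> 2 * \<delta> * K" using \<delta> K_nonneg by simp
  have tT: "real n * \<delta> \<le> T" using n \<delta> by (simp add: T_eq)
  have "S n \<le> exp (2 * (2 * \<delta> * K) * real n) * (S 0 + real n * (2 * \<delta> * K * \<eta>\<^sup>2))"
  \<comment> \<open>The recursion stops at \<open>ni - 1\<close>, the last level known to have
    vanishing residual. With \<open>x = 2 * \<delta> * K\<close> the exponent
    \<open>2 * x * real n\<close> is at most \<open>4 * K * T\<close>.\<close>
  proof (rule discrete_gronwall[where m="ni - 1" and S=S, OF x _ _ S_nonneg])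
    show "2 * \<delta> * K \<le> 1 / 2" using \<delta>K by simp
    show "0 \<le> 2 * \<delta> * K * \<eta>\<^sup>2" using x by simp
    show "n \<le> ni - 1" using n by simp
    fix m assume m: "m < ni - 1"
    have "S (Suc m) \<le> S m + 2 * \<delta> * 0 * (\<Sum>i\<in>UNIV. p i (Suc m)) + 2 * \<delta> * K * (S (Suc m) + \<eta>\<^sup>2)"
      by (rule total_step) (use m residual_interior[of "Suc m"] in auto)
    then show "S (Suc m) * (1 - 2 * \<delta> * K) \<le> S m + 2 * \<delta> * K * \<eta>\<^sup>2" by (simp add: algebra_simps)
  qed
  also have "\<dots> \<le> exp (4 * K * T) * (4 * N * AH\<^sup>2 * \<eta>\<^sup>2 + T * (2 * K * \<eta>\<^sup>2))"
  proof (rule mult_mono)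
    have "K * (real n * \<delta>) \<le> K * T" by (rule mult_left_mono[OF tT K_nonneg])
    then show "exp (2 * (2 * \<delta> * K) * real n) \<le> exp (4 * K * T)" by (simp add: mult_ac)
    have "(real n * \<delta>) * (2 * K * \<eta>\<^sup>2) \<le> T * (2 * K * \<eta>\<^sup>2)" by (rule mult_right_mono[OF tT]) (use K_nonneg in simp)
    then show "S 0 + real n * (2 * \<delta> * K * \<eta>\<^sup>2) \<le> 4 * N * AH\<^sup>2 * \<eta>\<^sup>2 + T * (2 * K * \<eta>\<^sup>2)"
      using S0_bound by (simp add: mult_ac)
    show "0 \<le> S 0 + real n * (2 * \<delta> * K * \<eta>\<^sup>2)" using S_nonneg[of 0] x by simp
  qed simp
  also have "\<dots> = exp (4 * K * T) * (4 * N * AH\<^sup>2 + 2 * K * T) * \<eta>\<^sup>2" by (simp add: algebra_simps)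
  finally show ?thesis .
qed

text \<open>At the final time the source is only bounded, not tied to the equation; this costs one
  contribution of order \<open>\<delta>\<close>.\<close>

lemma S_bound:
  assumes \<delta>K: "2 * \<delta> * K \<le> 1 / 4" and G: "\<And>i. L2_norm 0 1 (source \<alpha> \<beta> f i T) \<le> G" and n: "n \<le> ni"
  defines "\<kappa> \<equiv> \<bar>G\<bar> + At + \<bar>M_a\<bar> / \<gamma>0\<^sup>2 * AH + B * AH"
  shows "S n \<le> 2 * (exp (4 * K * T) * (4 * N * AH\<^sup>2 + 2 * K * T) + 1 + 4 * N * \<kappa>\<^sup>2) * \<eta>\<^sup>2"
proof -
  define C1 where "C1 = exp (4 * K * T) * (4 * N * AH\<^sup>2 + 2 * K * T)"
  have C1: "0 \<le> C1" unfolding C1_def using K_nonneg T constants_pos by simp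
  have N: "0 \<le> N * \<kappa>\<^sup>2" using constants_pos by simp
  show ?thesis
  proof (cases "n < ni")
    case True
    have "S n \<le> C1 * \<eta>\<^sup>2" unfolding C1_def by (rule S_bound_interior[OF \<delta>K True])
    also have "\<dots> \<le> 2 * (C1 + 1 + 4 * N * \<kappa>\<^sup>2) * \<eta>\<^sup>2" using C1 N by (intro mult_right_mono) auto
    finally show ?thesis unfolding C1_def .
  next
    case False
    have "ni \<noteq> 0"
    proof
      assume "ni = 0"
      then have "T = 0" using T_eq by simp
      then show False using T by simp
    qed
    then obtain m where m: "n = Suc m" "m < ni" using n False by (cases n) auto
    have tn: "t n = T" using n False by (simp add: T_eq)
    have "L2_norm 0 1 (residual i (Suc m)) \<le> \<kappa>" for i
      unfolding \<kappa>_def m(1)[symmetric] by (rule residual_bound[OF n]) (simp add: tn G)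
    from total_step[OF m(2) this]
    have st: "S n \<le> S m + 2 * \<delta> * \<kappa> * (\<Sum>i\<in>UNIV. p i n) + 2 * \<delta> * K * (S n + \<eta>\<^sup>2)" unfolding m(1) .
    have "2 * \<delta> * \<kappa> * (\<Sum>i\<in>UNIV. p i n) = (\<Sum>i\<in>UNIV. 2 * \<delta> * \<kappa> * p i n)" by (simp add: sum_distrib_left)
    also have "\<dots> \<le> (\<Sum>i\<in>UNIV. (p i n)\<^sup>2 / 4 + 4 * \<kappa>\<^sup>2 * \<delta>\<^sup>2)"
    proof (rule sum_mono)
      fix i
      \<comment> \<open>Young's inequality weighted so that a quarter of \<open>S n\<close> pays for
        the residual.\<close>
      have "0 \<le> (p i n / 2 - 2 * (\<kappa> * \<delta>))\<^sup>2" by simp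
      then show "2 * \<delta> * \<kappa> * p i n \<le> (p i n)\<^sup>2 / 4 + 4 * \<kappa>\<^sup>2 * \<delta>\<^sup>2"
        by (simp add: power2_diff power_mult_distrib power_divide mult_ac)
    qed
    also have "\<dots> = S n / 4 + 4 * N * \<kappa>\<^sup>2 * \<delta>\<^sup>2" by (simp add: S_def N_def sum.distrib sum_divide_distrib)
    also have "\<dots> \<le> S n / 4 + 4 * N * \<kappa>\<^sup>2 * \<eta>\<^sup>2"
      using N constants_pos \<delta> by (intro add_left_mono mult_left_mono power_mono) auto
    finally have a: "2 * \<delta> * \<kappa> * (\<Sum>i\<in>UNIV. p i n) \<le> S n / 4 + 4 * N * \<kappa>\<^sup>2 * \<eta>\<^sup>2" .
    \<comment> \<open>A second quarter, and the reason for the threshold 1/4 where the recursion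
      alone would allow 1/2. Half of \<open>S n\<close> remains on the left, whence the factor
      2.\<close>
    have b: "2 * \<delta> * K * (S n + \<eta>\<^sup>2) \<le> 1 / 4 * (S n + \<eta>\<^sup>2)" by (rule mult_right_mono[OF \<delta>K]) (simp add: S_nonneg)
    have "S m \<le> C1 * \<eta>\<^sup>2" unfolding C1_def by (rule S_bound_interior[OF \<delta>K m(2)])
    then have "S n \<le> 2 * (C1 * \<eta>\<^sup>2 + \<eta>\<^sup>2 + 4 * N * \<kappa>\<^sup>2 * \<eta>\<^sup>2)" using st a b zero_le_power2[of \<eta>] by argo
    then show ?thesis unfolding C1_def by (simp add: algebra_simps)
  qed
qed

text \<open>The square root is the share of one species in \<open>S n\<close>; \<open>AH\<close>
  accounts for the projection error.\<close>

lemma error_bound: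
  assumes \<delta>K: "2 * \<delta> * K \<le> 1 / 4" and G: "\<And>i. L2_norm 0 1 (source \<alpha> \<beta> f i T) \<le> G" and n: "n \<le> ni"
  defines "\<kappa> \<equiv> \<bar>G\<bar> + At + \<bar>M_a\<bar> / \<gamma>0\<^sup>2 * AH + B * AH"
  shows "L2_norm 0 1 (\<lambda>y. V i n y - v i (t n) y)
    \<le> (sqrt (2 * (exp (4 * K * T) * (4 * N * AH\<^sup>2 + 2 * K * T) + 1 + 4 * N * \<kappa>\<^sup>2)) + AH) * (mesh_size M x ^ (k + 1) + \<delta>)"
proof -
  define C2 where "C2 = 2 * (exp (4 * K * T) * (4 * N * AH\<^sup>2 + 2 * K * T) + 1 + 4 * N * \<kappa>\<^sup>2)"
  have "(p i n)\<^sup>2 \<le> S n" unfolding S_def by (rule member_le_sum) auto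
  also have "\<dots> \<le> C2 * \<eta>\<^sup>2" unfolding C2_def \<kappa>_def by (rule S_bound[OF \<delta>K G n])
  finally have "sqrt ((p i n)\<^sup>2) \<le> sqrt (C2 * \<eta>\<^sup>2)" by (rule real_sqrt_le_mono)
  then have "p i n \<le> sqrt C2 * \<eta>" using p_nonneg[of i n] constants_pos(8) by (simp add: real_sqrt_mult)
  moreover have "H * AH \<le> \<eta> * AH" using constants_pos by (intro mult_right_mono) auto
  ultimately have "L2_norm 0 1 (\<lambda>y. V i n y - v i (t n) y) \<le> (sqrt C2 + AH) * \<eta>"
    using v_V_bound[OF n, of i] by (simp add: distrib_right mult.commute)
  then show ?thesis unfolding C2_def \<eta>_def H_def by simp
qed

end

theorem theorem9:
  fixes T \<gamma>0 \<gamma>1 dgmax damax m_a M_a L_a G Rtt Rt Ry RyH RH :: real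
    and \<xi> :: "nat \<Rightarrow> nat \<Rightarrow> real"
  assumes "0 < T" and "0 < \<gamma>0" and "0 < m_a"
    and "reference_nodes \<xi>"
  shows "\<exists>C \<delta>0. 0 < \<delta>0 \<and>
    (\<forall>\<alpha> da \<beta> db (a :: 'n::finite \<Rightarrow> real^'n \<Rightarrow> real) f u0 v vt vtt k M x \<delta> ni V.
       admissible_domain T \<gamma>0 \<gamma>1 dgmax damax \<alpha> da \<beta> db \<longrightarrow>
       admissible_coefficients m_a M_a L_a a \<longrightarrow>
       admissible_source T \<alpha> \<beta> f \<longrightarrow>
       (\<forall>i. u0 i \<in> sobolev0 (\<alpha> 0) (\<beta> 0)) \<longrightarrow>
       weak_solution T \<alpha> da \<beta> db a f u0 v vt \<longrightarrow>
       1 \<le> k \<longrightarrow>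
       regular_solution T k Rtt Rt Ry RyH RH v vt vtt \<longrightarrow>
       is_partition M x \<longrightarrow>
       0 < \<delta> \<longrightarrow> \<delta> \<le> \<delta>0 \<longrightarrow> T = real ni * \<delta> \<longrightarrow>
       (\<forall>i. \<forall>n\<le>ni. source \<alpha> \<beta> f i (real n * \<delta>) \<in> L2 0 1) \<longrightarrow>
       (\<forall>i. L2_norm 0 1 (source \<alpha> \<beta> f i T) \<le> G) \<longrightarrow>
       backward_euler \<alpha> da \<beta> db a f u0 \<xi> M x k \<delta> ni V \<longrightarrow>
       (\<forall>i. \<forall>n<ni. L2_norm 0 1 (\<lambda>y. V i (Suc n) y - v i (real (Suc n) * \<delta>) y)
                     \<le> C * (mesh_size M x ^ (k + 1) + \<delta>)))"
proof -
  \<comment> \<open>The locale constants are repeated here because they must be fixed before the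
    data are introduced.\<close>
  define AH where "AH = \<bar>RH\<bar> + 1"
  define At where "At = \<bar>Rt\<bar> + 1"
  define Att where "Att = \<bar>Rtt\<bar> + 1"
  define B where "B = (\<bar>damax\<bar> + \<bar>dgmax\<bar>) / \<gamma>0"
  define c where "c = m_a / \<gamma>1\<^sup>2"
  define E where "E = \<bar>L_a\<bar> * \<bar>\<gamma>1\<bar> / \<gamma>0\<^sup>2 * AH"
  define N where "N = real CARD('n)"
  define K1 where "K1 = (Att + At) + E * N * AH + E + B * AH + B\<^sup>2 / (2 * c) + (B * AH)\<^sup>2 / (2 * c)"
  define K where "K = K1 * (2 + 2 * N)"
  define \<kappa> where "\<kappa> = \<bar>G\<bar> + At + \<bar>M_a\<bar> / \<gamma>0\<^sup>2 * AH + B * AH"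
  define C where "C = sqrt (2 * (exp (4 * K * T) * (4 * N * AH\<^sup>2 + 2 * K * T) + 1 + 4 * N * \<kappa>\<^sup>2)) + AH"
  \<comment> \<open>Chosen to give \<open>2 * \<delta> * K \<le> 1 / 4\<close>; the absolute value
    makes it positive while no instance is at hand to provide the sign of \<open>K\<close>.\<close>
  define \<delta>0 where "\<delta>0 = 1 / (8 * (\<bar>K\<bar> + 1))"
  show ?thesis
  proof (rule exI[of _ C], rule exI[of _ \<delta>0], intro conjI allI impI)
    show "0 < \<delta>0" by (simp add: \<delta>0_def)
  next
    fix \<alpha> da \<beta> db :: "real \<Rightarrow> real" and a :: "'n \<Rightarrow> real^'n \<Rightarrow> real" and f u0 v vt vtt k M x \<delta> ni V i n
    assume A: "admissible_domain T \<gamma>0 \<gamma>1 dgmax damax \<alpha> da \<beta> db" "admissible_coefficients m_a M_a L_a a"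
      "weak_solution T \<alpha> da \<beta> db a f u0 v vt" "1 \<le> k" "regular_solution T k Rtt Rt Ry RyH RH v vt vtt"
      "is_partition M x" "0 < \<delta>" "T = real ni * \<delta>" "\<forall>i. \<forall>n\<le>ni. source \<alpha> \<beta> f i (real n * \<delta>) \<in> L2 0 1"
      "backward_euler \<alpha> da \<beta> db a f u0 \<xi> M x k \<delta> ni V"
      and \<delta>: "\<delta> \<le> \<delta>0" and G: "\<forall>i. L2_norm 0 1 (source \<alpha> \<beta> f i T) \<le> G" and n: "n < ni"
    interpret S: euler_scheme T \<gamma>0 \<gamma>1 dgmax damax m_a M_a L_a Rtt Rt Ry RyH RH \<xi> \<alpha> da \<beta> db a f u0 v vt vtt k M x \<delta> ni V
      by (rule euler_scheme.intro) (use assms A in blast)+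
    \<comment> \<open>Identifies the two families of constants; \<open>E\<close>, \<open>K1\<close>
      and \<open>K\<close> follow in order of dependence.\<close>
    have cs: "S.AH = AH" "S.At = At" "S.Att = Att" "S.B = B" "S.c = c" "S.N = N"
      by (simp_all only: S.AH_def S.At_def S.Att_def S.B_def S.c_def S.N_def AH_def At_def Att_def B_def c_def N_def)
    have "S.E = E" by (simp only: S.E_def E_def cs)
    then have "S.K1 = K1" by (simp only: S.K1_def K1_def cs)
    then have K: "S.K = K" by (simp only: S.K_def K_def cs)
    have "\<delta> * (8 * (\<bar>K\<bar> + 1)) \<le> 1" using \<delta> unfolding \<delta>0_def by (subst (asm) pos_le_divide_eq) auto
    moreover have "\<delta> * K \<le> \<delta> * (\<bar>K\<bar> + 1)" using A(7) by (intro mult_left_mono) auto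
    ultimately have "2 * \<delta> * S.K \<le> 1 / 4" unfolding K by linarith
    from S.error_bound[OF this, of G "Suc n" i] show "L2_norm 0 1 (\<lambda>y. V i (Suc n) y - v i (real (Suc n) * \<delta>) y) \<le> C * (mesh_size M x ^ (k + 1) + \<delta>)"
      using G n unfolding C_def \<kappa>_def K cs by simp
  qed
qed

end
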